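(* The total variation mixing time of the $n^2-1$ puzzle chain is $O(n^4\log n)$ as $n\to\infty$, and for each fixed $\epsilon\in(0,1)$ the $\frac{\epsilon}{|G|}$-$\ell^\infty$ mixing time of the $n^2-1$ puzzle chain is $O(n^4\log n)$ as $n\to\infty$.
   Context: The $n^2-1$ puzzle chain: the board is $(\mathbb{Z}/n\mathbb{Z})^2$ (an $n\times n$ board with periodic boundary conditions); $n^2-1$ labeled pieces occupy all squares but one, the remaining square being empty. In the initial configuration the pieces $1,\dots,n^2-1$ are placed left to right, then top down, with the empty square in the lower right corner. At each step, independently and with probability $\frac15$ each, either nothing happens or the empty square moves right, left, up or down, i.e. it exchanges positions with the piece occupying the corresponding (cyclically) adjacent square. Let $G=G_n$ denote the set of configurations reachable from the initial one (it can be identified with a finite group on which the chain is a symmetric random walk started at the identity). Let $P$ be the transition matrix on $G$ and $\mathbf{U}_G$ the uniform probability measure on $G$, which is the stationary measure. For probability measures $\mu,\nu$ on $G$ put $\|\mu-\nu\|_{\mathrm{TV}}=\frac12\sum_{x\in G}|\mu(x)-\nu(x)|$ and, for $0<\epsilon<1$, $\|\mu-\nu\|_{\epsilon,\infty}=\frac{|G|}{\epsilon}\sup_{x\in G}|\mu(x)-\nu(x)|$ (the $\frac{\epsilon}{|G|}$-$\ell^\infty$ distance). For either distance, the mixing time is the least $N$ such that the distribution of the chain after $N$ steps, started from the initial configuration, is at distance less than $\frac1e$ from $\mathbf{U}_G$. *)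

theory Defs
  imports "HOL-Probability.Probability" "HOL-Library.Landau_Symbols"
begin

(* A square is (row, column), rows counted downwards from 0, with canonical
   representatives of the residues modulo n as coordinates. *)
type_synonym square = "int \<times> int"

(* Square to piece; on the board, None marks the empty square, and
   configurations are None off the board. *)
type_synonym config = "square \<Rightarrow> int option"

definition board :: "nat \<Rightarrow> square set" where
  "board n = {0..<int n} \<times> {0..<int n}"

definition initial_config :: "nat \<Rightarrow> config" where
  "initial_config n = (\<lambda>(i, j).
     if (i, j) \<in> board n \<and> (i, j) \<noteq> (int n - 1, int n - 1)
     then Some (i * int n + j + 1) else None)"

definition empty_square :: "nat \<Rightarrow> config \<Rightarrow> square" where
  "empty_square n c = (THE s. s \<in> board n \<and> c s = None)"

(* Stay, right, left, up, down. *)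
definition moves :: "(int \<times> int) set" where
  "moves = {(0, 0), (0, 1), (0, -1), (-1, 0), (1, 0)}"

definition apply_move :: "nat \<Rightarrow> config \<Rightarrow> int \<times> int \<Rightarrow> config" where
  "apply_move n c v =
     (let s = empty_square n c;
          t = ((fst s + fst v) mod int n, (snd s + snd v) mod int n)
      in c(s := c t, t := c s))"

inductive_set reachable_configs :: "nat \<Rightarrow> config set" for n where
  initial: "initial_config n \<in> reachable_configs n"
| move: "c \<in> reachable_configs n \<Longrightarrow> v \<in> moves \<Longrightarrow> apply_move n c v \<in> reachable_configs n"

definition puzzle_step :: "nat \<Rightarrow> config \<Rightarrow> config pmf" where
  "puzzle_step n c = map_pmf (apply_move n c) (pmf_of_set moves)"

definition puzzle_dist :: "nat \<Rightarrow> nat \<Rightarrow> config pmf" where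
  "puzzle_dist n N = ((\<lambda>p. bind_pmf p (puzzle_step n)) ^^ N) (return_pmf (initial_config n))"

definition tv_distance :: "'a set \<Rightarrow> 'a pmf \<Rightarrow> 'a pmf \<Rightarrow> real" where
  "tv_distance G \<mu> \<nu> = 1 / 2 * (\<Sum>x\<in>G. \<bar>pmf \<mu> x - pmf \<nu> x\<bar>)"

definition linf_distance :: "real \<Rightarrow> 'a set \<Rightarrow> 'a pmf \<Rightarrow> 'a pmf \<Rightarrow> real" where
  "linf_distance \<epsilon> G \<mu> \<nu> = real (card G) / \<epsilon> * (SUP x\<in>G. \<bar>pmf \<mu> x - pmf \<nu> x\<bar>)"

(* The least N as an extended natural number: the infimum of the empty set is
   infinity, so a chain that never mixes cannot get a spurious finite value. *)
definition puzzle_mixing_time ::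
  "(config set \<Rightarrow> config pmf \<Rightarrow> config pmf \<Rightarrow> real) \<Rightarrow> nat \<Rightarrow> enat" where
  "puzzle_mixing_time d n =
     (INF N \<in> {N. d (reachable_configs n) (puzzle_dist n N)
                     (pmf_of_set (reachable_configs n)) < 1 / exp 1}. enat N)"

(* Below: the reachable configurations have exactly one empty square and form a
   finite nonempty set, so that THE and pmf_of_set have their intended meaning. *)
lemma reachable_configs_invariant:
  assumes "n \<ge> 1" "c \<in> reachable_configs n"
  shows "(\<exists>!s. s \<in> board n \<and> c s = None) \<and> dom c \<subseteq> board n \<and> ran c \<subseteq> {1..int n ^ 2 - 1}"
  using assms(2)
proof induction
  case initial
  have "i * int n + j + 1 \<le> int n ^ 2 - 1"
    if "0 \<le> i" "0 \<le> j" "i < int n" "j < int n" "i \<noteq> int n - 1 \<or> j \<noteq> int n - 1" for i j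
  proof (cases "i = int n - 1")
    case True
    have "i * int n + int n = int n ^ 2"
      by (simp add: True power2_eq_square algebra_simps)
    then show ?thesis using that True by linarith
  next
    case False
    then have "i * int n \<le> (int n - 2) * int n"
      using that by (intro mult_right_mono) auto
    then show ?thesis using that by (simp add: power2_eq_square algebra_simps)
  qed
  then have "dom (initial_config n) \<subseteq> board n \<and> ran (initial_config n) \<subseteq> {1..int n ^ 2 - 1}"
    by (auto simp: initial_config_def board_def ran_def split: if_splits)
  moreover have "\<exists>!s. s \<in> board n \<and> initial_config n s = None"
    using assms(1)
    by (intro ex1I[of _ "(int n - 1, int n - 1)"])
       (auto simp: initial_config_def board_def split: if_splits)
  ultimately show ?case by blast
next
  case (move c v)
  define s where "s = empty_square n c"
  define t where "t = ((fst s + fst v) mod int n, (snd s + snd v) mod int n)"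
  have s: "s \<in> board n" "c s = None"
    using theI'[of "\<lambda>s. s \<in> board n \<and> c s = None"] move.IH
    unfolding s_def empty_square_def by auto
  have uniq: "x = s" if "x \<in> board n" "c x = None" for x
    using move.IH s that by blast
  have t: "t \<in> board n"
    using assms(1) by (simp add: t_def board_def)
  have eq: "apply_move n c v = c(s := c t, t := None)"
    using s by (simp add: apply_move_def Let_def s_def[symmetric] t_def[symmetric])
  have "\<exists>!x. x \<in> board n \<and> (c(s := c t, t := None)) x = None"
    using t uniq by (intro ex1I[of _ t]) (auto split: if_splits)
  moreover have "dom (c(s := c t, t := None)) \<subseteq> board n"
    using move.IH s by (auto simp: dom_def split: if_splits)
  moreover have "ran (c(s := c t, t := None)) \<subseteq> ran c"
    unfolding ran_def fun_upd_def by (smt (verit) Collect_mono option.distinct(1))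
  ultimately show ?case
    using move.IH unfolding eq by blast
qed

lemma finite_reachable_configs:
  assumes "n \<ge> 1"
  shows "finite (reachable_configs n)" "reachable_configs n \<noteq> {}"
proof -
  have "finite (\<Union>A\<in>Pow (board n). {c :: config. dom c = A \<and> ran c \<subseteq> {1..int n ^ 2 - 1}})"
    by (intro finite_UN_I finite_set_of_finite_maps) (auto simp: board_def intro: finite_subset)
  then show "finite (reachable_configs n)"
    by (rule rev_finite_subset) (use reachable_configs_invariant[OF assms] in blast)
  show "reachable_configs n \<noteq> {}"
    using reachable_configs.initial by blast
qed

end

theory Submission
  imports Defs
begin

text \<open>Relative to the empty square, a configuration is a permutation \<open>p\<close> of the
  \<open>m = n\<^sup>2 - 1\<close> nonzero residues together with the place \<open>e\<close> of the empty square, and a move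
  multiplies \<open>p\<close> on the right by a fixed permutation and translates \<open>e\<close>. By carrying a piece along with
  the empty square, every product of two transpositions of pieces is a word of length \<open>O(n)\<close> in
  the moves. Hence the Dirichlet form of the puzzle dominates \<open>1 / n\<^sup>2\<close> times that of two
  steps of the random transposition walk.

  The transposition walk has gap at least of order \<open>k / m\<close> on the functions that are orthogonal to all
  functions of fewer than \<open>k\<close> values of the permutation, so the puzzle has gap at
  least of order \<open>k / n\<^sup>4\<close> there. The functions of \<open>k\<close> values form a space of dimension at
  most \<open>(m + 1)\<close> to the power \<open>2 k\<close>, and by left invariance this controls the part of a point mass on each level. For
  a large multiple of \<open>n\<^sup>4 log n\<close> steps the contraction beats the dimension on all levels
  simultaneously, which bounds the distance to uniformity in \<open>\<ell>\<^sup>2\<close>; doubling the time bounds it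
  in the supremum norm.\<close>

section \<open>Inner products and projections on finite sets\<close>

text \<open>A single spectral gap is too weak. With a gap of order \<open>1 / n^4\<close> on
  everything, the \<open>\<ell>^2\<close> argument started from a point mass pays a factor
  \<open>ln |G|\<close>, of order \<open>n^2 ln n\<close>, and yields only \<open>n^6 ln n\<close>.
  The extra factor \<open>k\<close> in the gap of level \<open>k\<close> pays for
  \<open>2 k ln (m + 1)\<close>, the logarithm of the dimension, and removes this loss. The power
  \<open>n^4\<close> is \<open>n^2\<close> from the squared word length times
  \<open>m \<le> n^2\<close> from the transposition walk.

  Parity shapes the rest. Only even products of transpositions are known to be short returning
  words, so the transposition walk enters through its square, which cannot see the sign character.
  Hence every level condition is imposed both on a function and on its product with the sign. What
  remains at level 0 depends on the sign of \<open>p\<close> and on \<open>e\<close> alone and is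
  treated by averaging over the abelian quotient. Which pairs are reachable is never determined:
  functions live on all pairs, and reachability is shown to depend only on the sign and on
  \<open>e\<close>.

  No representation theory is used: the eigenvalue bounds come from the growth of moments and from
  induction on \<open>m\<close>.\<close>

definition ip :: "'a set \<Rightarrow> ('a \<Rightarrow> real) \<Rightarrow> ('a \<Rightarrow> real) \<Rightarrow> real" where
  "ip A f g = (\<Sum>x\<in>A. f x * g x)"

lemma ip_commute: "ip A f g = ip A g f"
  by (simp add: ip_def mult.commute)

lemma ip_add_left: "ip A (\<lambda>x. f x + g x) h = ip A f h + ip A g h"
  by (simp add: ip_def sum.distrib algebra_simps)

lemma ip_diff_left: "ip A (\<lambda>x. f x - g x) h = ip A f h - ip A g h"
  by (simp add: ip_def sum_subtractf algebra_simps)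

lemma ip_scale_left: "ip A (\<lambda>x. c * f x) h = c * ip A f h"
  by (simp add: ip_def sum_distrib_left mult.assoc)

lemma ip_add_right: "ip A h (\<lambda>x. f x + g x) = ip A h f + ip A h g"
  by (simp add: ip_def sum.distrib algebra_simps)

lemma ip_diff_right: "ip A h (\<lambda>x. f x - g x) = ip A h f - ip A h g"
  by (simp add: ip_def sum_subtractf algebra_simps)

lemma ip_scale_right: "ip A h (\<lambda>x. c * f x) = c * ip A h f"
  by (simp add: ip_def sum_distrib_left algebra_simps)

lemma ip_sum_right: "ip A h (\<lambda>x. \<Sum>i\<in>I. F i x) = (\<Sum>i\<in>I. ip A h (F i))"
  unfolding ip_def sum_distrib_left by (rule sum.swap)

lemma ip_sum_left: "ip A (\<lambda>x. \<Sum>i\<in>I. F i x) h = (\<Sum>i\<in>I. ip A (F i) h)"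
  using ip_sum_right[of A h F I] by (simp add: ip_commute)

lemma ip_cong: "(\<And>x. x \<in> A \<Longrightarrow> f x = f' x) \<Longrightarrow> (\<And>x. x \<in> A \<Longrightarrow> g x = g' x) \<Longrightarrow> ip A f g = ip A f' g'"
  by (simp add: ip_def)

lemmas ip_linear = ip_add_left ip_diff_left ip_scale_left ip_add_right ip_diff_right ip_scale_right

lemma ip_self: "ip A f f = (\<Sum>x\<in>A. (f x)\<^sup>2)"
  by (simp add: ip_def power2_eq_square)

lemma ip_self_nonneg [simp]: "0 \<le> ip A f f"
  unfolding ip_self by (intro sum_nonneg) simp

lemma ip_self_eq_0: "finite A \<Longrightarrow> ip A f f = 0 \<longleftrightarrow> (\<forall>x\<in>A. f x = 0)"
  unfolding ip_self by (subst sum_nonneg_eq_0_iff) auto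

lemma ip_zero_left: "finite A \<Longrightarrow> ip A f f = 0 \<Longrightarrow> ip A f g = 0"
  unfolding ip_self_eq_0 by (simp add: ip_def)

lemma ip_zero_right: "finite A \<Longrightarrow> ip A f f = 0 \<Longrightarrow> ip A g f = 0"
  by (metis ip_commute ip_zero_left)

lemma ip_self_diff: "(\<Sum>x\<in>A. (f x - g x)\<^sup>2) = ip A f f - 2 * ip A f g + ip A g g"
  by (simp add: ip_def power2_diff power2_eq_square sum.distrib sum_subtractf sum_distrib_left algebra_simps)

lemma ip_Cauchy_Schwarz: "(ip A f g)\<^sup>2 \<le> ip A f f * ip A g g"
  unfolding ip_self unfolding ip_def by (rule Cauchy_Schwarz_ineq_sum)

lemma L2_set_ip: "L2_set f A = sqrt (ip A f f)"
  by (simp add: L2_set_def ip_self)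

text \<open>Polarisation: the form is tested at \<open>f + s * T f\<close> and
  \<open>f - s * T f\<close>. In the difference everything cancels except a multiple of the squared
  norm of \<open>T f\<close>, and \<open>s = 1 / \<rho>\<close> is the optimal choice. The predicate
  \<open>U\<close> plays the part of an invariant subspace.\<close>

lemma selfadjoint_norm_bound:
  assumes adj: "\<And>g h. ip A (T g) h = ip A g (T h)"
    and lin: "\<And>g h s. T (\<lambda>x. g x + s * h x) = (\<lambda>x. T g x + s * T h x)"
    and U: "\<And>g. U g \<Longrightarrow> U (T g)" "\<And>g h s. U g \<Longrightarrow> U h \<Longrightarrow> U (\<lambda>x. g x + s * h x)"
    and bound: "\<And>g. U g \<Longrightarrow> \<bar>ip A g (T g)\<bar> \<le> \<rho> * ip A g g"
    and "\<rho> > 0" and "U f"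
  shows "ip A (T f) (T f) \<le> \<rho>\<^sup>2 * ip A f f"
proof -
  define h where "h = T f"
  define s where "s = 1 / \<rho>"
  have Uh: "U h" unfolding h_def using U(1) \<open>U f\<close> .
  have eq: "ip A (\<lambda>x. f x + s * h x) (T (\<lambda>x. f x + s * h x)) =
      ip A f h + 2 * s * ip A h h + s\<^sup>2 * ip A h (T h)" for s
    unfolding lin using adj[of f h]
    by (simp add: ip_linear h_def algebra_simps power2_eq_square)
  have eq2: "ip A (\<lambda>x. f x + s * h x) (\<lambda>x. f x + s * h x) =
      ip A f f + 2 * s * ip A f h + s\<^sup>2 * ip A h h" for s
    using ip_commute[of A f h] by (simp add: ip_linear algebra_simps power2_eq_square)
  have 1: "ip A f h + 2 * s * ip A h h + s\<^sup>2 * ip A h (T h)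
      \<le> \<rho> * (ip A f f + 2 * s * ip A f h + s\<^sup>2 * ip A h h)"
    using bound[OF U(2)[OF \<open>U f\<close> Uh, of s]] unfolding eq eq2 by linarith
  have 2: "- (ip A f h + 2 * (-s) * ip A h h + (-s)\<^sup>2 * ip A h (T h))
      \<le> \<rho> * (ip A f f + 2 * (-s) * ip A f h + (-s)\<^sup>2 * ip A h h)"
    using bound[OF U(2)[OF \<open>U f\<close> Uh, of "-s"]] unfolding eq eq2 by linarith
  have "4 * s * ip A h h \<le> 2 * \<rho> * ip A f f + 2 * \<rho> * s\<^sup>2 * ip A h h"
    using 1 2 by (simp add: algebra_simps)
  then have "4 * ip A h h \<le> 2 * \<rho>\<^sup>2 * ip A f f + 2 * ip A h h"
    using \<open>\<rho> > 0\<close> by (simp add: s_def field_simps power2_eq_square)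
  then show ?thesis by (simp add: h_def)
qed

text \<open>Log-convexity of the moments \<open>\<langle>f, T\<^sup>j f\<rangle>\<close> turns their growth rate into a bound
  of the quadratic form, which replaces the spectral theorem.\<close>

lemma selfadjoint_moment_bound:
  assumes "finite A"
    and adj: "\<And>g h. ip A (T g) h = ip A g (T h)"
    and moments: "\<And>j. ip A f ((T ^^ j) f) \<le> C * \<rho> ^ j"
    and "\<rho> \<ge> 0"
  shows "ip A f (T f) \<le> \<rho> * ip A f f"
proof (cases "ip A f f = 0 \<or> ip A f (T f) \<le> 0")
  case True
  then show ?thesis
    using ip_zero_left[OF \<open>finite A\<close>, of f "T f"] \<open>\<rho> \<ge> 0\<close>
    by (metis ip_self_nonneg order_trans zero_le_mult_iff mult_zero_right order_refl)
next
  case False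
  define F where "F = ip A f f"
  define a where "a = ip A f (T f) / F"
  have F: "F > 0" using False ip_self_nonneg[of A f] unfolding F_def by linarith
  have a: "a > 0" using False F by (simp add: a_def)
  have adjn: "ip A ((T ^^ n) g) h = ip A g ((T ^^ n) h)" for n g h
    by (induction n arbitrary: g h) (simp_all add: adj funpow_swap1)
  \<comment> \<open>Cauchy-Schwarz and self-adjointness double the exponent, so the ratio
    \<open>a\<close> of the first two moments persists along the powers of two. Exponential growth
    with ratio \<open>a\<close> then contradicts the assumed rate unless
    \<open>a \<le> \<rho>\<close>.\<close>
  have step: "F * a ^ (2 ^ i) \<le> ip A f ((T ^^ (2 ^ i)) f)" for i
  proof (induction i)
    case 0
    show ?case using F by (simp add: a_def)
  next
    case (Suc i)
    let ?g = "(T ^^ (2 ^ i)) f"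
    have "(F * a ^ (2 ^ i))\<^sup>2 \<le> (ip A f ?g)\<^sup>2"
      using Suc F a by (intro power_mono) auto
    also have "\<dots> \<le> F * ip A ?g ?g" unfolding F_def by (rule ip_Cauchy_Schwarz)
    also have "ip A ?g ?g = ip A f ((T ^^ (2 ^ Suc i)) f)"
      by (simp add: adjn mult_2 funpow_add)
    finally show ?case
      using F by (simp add: power2_eq_square mult_2 power_add algebra_simps)
  qed
  have key: "F * a ^ (2 ^ i) \<le> C * \<rho> ^ (2 ^ i)" for i
    using step[of i] moments[of "2 ^ i"] by linarith
  have "a \<le> \<rho>"
  proof (rule ccontr)
    assume "\<not> a \<le> \<rho>"
    then have "a > \<rho>" by simp
    show False
    proof (cases "\<rho> = 0")
      case True
      then show False using key[of 0] F a by (simp add: mult_le_0_iff)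
    next
      case False
      then have \<rho>: "\<rho> > 0" using \<open>\<rho> \<ge> 0\<close> by simp
      then have "a / \<rho> > 1" using \<open>a > \<rho>\<close> by simp
      then obtain n where n: "C / F < (a / \<rho>) ^ n" using real_arch_pow by blast
      also have "\<dots> \<le> (a / \<rho>) ^ (2 ^ n)"
        using \<open>a / \<rho> > 1\<close> by (intro power_increasing) (auto simp: less_imp_le)
      finally have "C * \<rho> ^ (2 ^ n) < F * a ^ (2 ^ n)"
        using F \<rho> by (simp add: power_divide field_simps)
      then show False using key[of n] by simp
    qed
  qed
  then show ?thesis using F unfolding a_def F_def by (simp add: field_simps)
qed

section \<open>Orthonormal systems and projections of point masses\<close>

definition orthonormalization ::
  "'a set \<Rightarrow> 'i set \<Rightarrow> ('i \<Rightarrow> 'a \<Rightarrow> real) \<Rightarrow> ('i \<Rightarrow> 'a \<Rightarrow> real) \<Rightarrow> bool" where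
  "orthonormalization A I e u \<longleftrightarrow>
    (\<forall>i\<in>I. \<forall>j\<in>I. i \<noteq> j \<longrightarrow> ip A (u i) (u j) = 0) \<and>
    (\<forall>i\<in>I. ip A (u i) (u i) = 0 \<or> ip A (u i) (u i) = 1) \<and>
    (\<forall>i\<in>I. \<exists>c. \<forall>x. u i x = (\<Sum>j\<in>I. c j * e j x)) \<and>
    (\<forall>f. (\<forall>i\<in>I. ip A f (u i) = 0) \<longrightarrow> (\<forall>i\<in>I. ip A f (e i) = 0))"

lemma orthonormalizationD:
  assumes "orthonormalization A I e u"
  shows "\<And>i j. i \<in> I \<Longrightarrow> j \<in> I \<Longrightarrow> i \<noteq> j \<Longrightarrow> ip A (u i) (u j) = 0"
    and "\<And>i. i \<in> I \<Longrightarrow> ip A (u i) (u i) = 0 \<or> ip A (u i) (u i) = 1"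
    and "\<And>i. i \<in> I \<Longrightarrow> \<exists>c. \<forall>x. u i x = (\<Sum>j\<in>I. c j * e j x)"
    and "\<And>f j. (\<And>i. i \<in> I \<Longrightarrow> ip A f (u i) = 0) \<Longrightarrow> j \<in> I \<Longrightarrow> ip A f (e j) = 0"
  using assms unfolding orthonormalization_def by simp_all

lemma gram_schmidt:
  fixes e :: "'i \<Rightarrow> 'a \<Rightarrow> real"
  assumes "finite A" "finite I"
  shows "\<exists>u. orthonormalization A I e u"
  using \<open>finite I\<close>
proof (induction I rule: finite_induct)
  case empty
  show ?case by (simp add: orthonormalization_def)
next
  case (insert i I)
  then obtain u where uo: "orthonormalization A I e u" by blast
  note u = orthonormalizationD[OF uo]
  define w where "w = (\<lambda>x. e i x - (\<Sum>j\<in>I. ip A (e i) (u j) * u j x))"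
  define r where "r = sqrt (ip A w w)"
  define v where "v = (\<lambda>x. (if r = 0 then 0 else 1 / r) * w x)"
  have w_orth: "ip A w (u j) = 0" if "j \<in> I" for j
  proof -
    have "ip A w (u j) = ip A (e i) (u j) - (\<Sum>l\<in>I. ip A (e i) (u l) * ip A (u l) (u j))"
      by (simp add: w_def ip_diff_left ip_sum_left ip_scale_left)
    also have "(\<Sum>l\<in>I. ip A (e i) (u l) * ip A (u l) (u j)) =
        (\<Sum>l\<in>I. if l = j then ip A (e i) (u j) * ip A (u j) (u j) else 0)"
      using u(1) that by (intro sum.cong) auto
    also have "\<dots> = ip A (e i) (u j) * ip A (u j) (u j)"
      using that insert.hyps by simp
    also have "\<dots> = ip A (e i) (u j)"
      using u(2)[OF that] ip_zero_right[OF \<open>finite A\<close>, of "u j" "e i"] by auto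
    finally show ?thesis by simp
  qed
  have v_orth: "ip A v (u j) = 0" if "j \<in> I" for j
    using w_orth[OF that] by (simp only: v_def ip_scale_left)
  have v_norm: "ip A v v = 0 \<or> ip A v v = 1"
    by (simp add: v_def ip_scale_left ip_scale_right r_def real_sqrt_eq_zero_cancel_iff)
  have w_v: "ip A f w = r * ip A f v" for f
  proof (cases "r = 0")
    case True
    then show ?thesis using ip_zero_right[OF \<open>finite A\<close>, of w f] by (simp add: r_def)
  qed (simp only: v_def ip_scale_right, simp)
  obtain c where c: "\<And>j x. j \<in> I \<Longrightarrow> u j x = (\<Sum>l\<in>I. c j l * e l x)"
    using u(3) by metis
  have span_old: "\<exists>d. \<forall>x. u j x = (\<Sum>l\<in>insert i I. d l * e l x)" if "j \<in> I" for j
    using that insert.hyps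
    by (intro exI[of _ "\<lambda>l. if l = i then 0 else c j l"]) (auto simp: c intro!: sum.cong)
  have span_new: "\<exists>d. \<forall>x. v x = (\<Sum>l\<in>insert i I. d l * e l x)"
  proof (intro exI allI)
    fix x
    define q where "q = (if r = 0 then 0 else 1 / r)"
    define d where "d l = (\<Sum>j\<in>I. ip A (e i) (u j) * c j l)" for l
    have "(\<Sum>j\<in>I. ip A (e i) (u j) * u j x) = (\<Sum>l\<in>I. d l * e l x)"
      by (simp add: c d_def sum_distrib_left sum_distrib_right mult.assoc) (rule sum.swap)
    then have "v x = q * (e i x - (\<Sum>l\<in>I. d l * e l x))"
      by (simp only: v_def w_def q_def)
    also have "\<dots> = q * e i x + (\<Sum>l\<in>I. (- q * d l) * e l x)"
      by (simp add: right_diff_distrib sum_distrib_left sum_negf mult.assoc)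
    also have "\<dots> = (\<Sum>l\<in>insert i I. (if l = i then q else - q * d l) * e l x)"
      using insert.hyps by (auto intro!: sum.cong)
    finally show "v x = (\<Sum>l\<in>insert i I. (if l = i then q else
        - q * (\<Sum>j\<in>I. ip A (e i) (u j) * c j l)) * e l x)"
      unfolding d_def .
  qed
  have last: "ip A f (e i) = 0" if f: "\<And>j. j \<in> I \<Longrightarrow> ip A f (u j) = 0" and fv: "ip A f v = 0" for f
  proof -
    have "ip A f w = ip A f (e i) - (\<Sum>j\<in>I. ip A (e i) (u j) * ip A f (u j))"
      by (simp add: w_def ip_diff_right ip_sum_right ip_scale_right)
    then show ?thesis using f fv w_v[of f] by simp
  qed
  let ?u = "\<lambda>j. if j = i then v else u j"
  show ?case
  unfolding orthonormalization_def
  proof (intro exI[of _ ?u] conjI)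
    show "\<forall>j\<in>insert i I. \<forall>l\<in>insert i I. j \<noteq> l \<longrightarrow> ip A (?u j) (?u l) = 0"
      using u(1) v_orth ip_commute[of A v] by auto
    show "\<forall>j\<in>insert i I. ip A (?u j) (?u j) = 0 \<or> ip A (?u j) (?u j) = 1"
      using u(2) v_norm by auto
    show "\<forall>j\<in>insert i I. \<exists>d. \<forall>x. ?u j x = (\<Sum>l\<in>insert i I. d l * e l x)"
      using span_old span_new by auto
    show "\<forall>f. (\<forall>j\<in>insert i I. ip A f (?u j) = 0) \<longrightarrow> (\<forall>j\<in>insert i I. ip A f (e j) = 0)"
    proof (intro allI impI ballI)
      fix f j assume f: "\<forall>j\<in>insert i I. ip A f (?u j) = 0" and j: "j \<in> insert i I"
      have fu: "ip A f (u l) = 0" if "l \<in> I" for l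
        using f that insert.hyps by (metis insertCI)
      have fv: "ip A f v = 0" using f by auto
      show "ip A f (e j) = 0" using j last[OF fu fv] u(4)[OF fu] by auto
    qed
  qed
qed

lemma projection_residual:
  assumes "finite A" "finite I"
    and u: "orthonormalization A I e u" and i: "i \<in> I"
  shows "ip A (\<lambda>x. \<Sum>j\<in>I. ip A f (u j) * u j x) (u i) = ip A f (u i)"
proof -
  have "ip A (\<lambda>x. \<Sum>j\<in>I. ip A f (u j) * u j x) (u i) = (\<Sum>j\<in>I. ip A f (u j) * ip A (u j) (u i))"
    by (simp add: ip_sum_left ip_scale_left)
  also have "\<dots> = (\<Sum>j\<in>I. if j = i then ip A f (u i) * ip A (u i) (u i) else 0)"
    using orthonormalizationD(1)[OF u] i by (intro sum.cong) auto
  also have "\<dots> = ip A f (u i) * ip A (u i) (u i)" using i assms(2) by simp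
  also have "\<dots> = ip A f (u i)"
    using orthonormalizationD(2)[OF u i] ip_zero_right[OF \<open>finite A\<close>, of "u i" f] by auto
  finally show ?thesis .
qed

lemma orthogonal_projection:
  fixes e :: "'i \<Rightarrow> 'a \<Rightarrow> real"
  assumes "finite A" "finite I"
  shows "\<exists>c. \<forall>i\<in>I. ip A (\<lambda>x. f x - (\<Sum>j\<in>I. c j * e j x)) (e i) = 0"
proof -
  obtain u where uo: "orthonormalization A I e u" using gram_schmidt[OF assms, of e] by blast
  note u = orthonormalizationD[OF uo]
  obtain c where c: "\<And>j x. j \<in> I \<Longrightarrow> u j x = (\<Sum>l\<in>I. c j l * e l x)"
    using u(3) by metis
  define d where "d l = (\<Sum>j\<in>I. ip A f (u j) * c j l)" for l
  have d: "(\<Sum>j\<in>I. ip A f (u j) * u j x) = (\<Sum>l\<in>I. d l * e l x)" for x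
    by (simp add: c d_def sum_distrib_left sum_distrib_right mult.assoc) (rule sum.swap)
  have "ip A (\<lambda>x. f x - (\<Sum>l\<in>I. d l * e l x)) (u i) = 0" if "i \<in> I" for i
    using projection_residual[OF assms uo that, of f] by (simp add: d ip_diff_left)
  then show ?thesis using u(4) by blast
qed

text \<open>A trace argument: the squared norms of the projected point masses, summed over all
  points, give the trace of the projection, at most \<open>card I\<close>. Some point
  \<open>q\<close> is therefore no worse than average; on a group, translation carries the bound to
  every point.\<close>

lemma delta_projection:
  fixes e :: "'i \<Rightarrow> 'a \<Rightarrow> real"
  assumes "finite A" "A \<noteq> {}" "finite I"
  shows "\<exists>q\<in>A. \<exists>d. (\<forall>i\<in>I. ip A d (e i) = e i q) \<and> ip A d d \<le> card I / card A"
proof -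
  obtain u where uo: "orthonormalization A I e u" using gram_schmidt[OF assms(1,3), of e] by blast
  note u = orthonormalizationD[OF uo]
  define \<delta> where "\<delta> q x = (if x = q then 1 else 0 :: real)" for q x :: 'a
  define d where "d q = (\<lambda>x. \<Sum>j\<in>I. ip A (\<delta> q) (u j) * u j x)" for q
  have \<delta>: "ip A (\<delta> q) g = g q" if "q \<in> A" for q g
    unfolding ip_def \<delta>_def using that \<open>finite A\<close> by (simp add: if_distrib if_distribR cong: if_cong)
  have "ip A (\<lambda>x. \<delta> q x - d q x) (u i) = 0" if "i \<in> I" for i q
    using projection_residual[OF assms(1,3) uo that, of "\<delta> q"] by (simp add: d_def ip_diff_left)
  then have "ip A (\<lambda>x. \<delta> q x - d q x) (e i) = 0" if "i \<in> I" for i q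
    using u(4) that by blast
  then have d1: "ip A (d q) (e i) = e i q" if "q \<in> A" "i \<in> I" for q i
    using that \<delta>[OF that(1), of "e i"] by (simp add: ip_diff_left)
  have d2: "ip A (d q) (d q) = (\<Sum>j\<in>I. (u j q)\<^sup>2)" if "q \<in> A" for q
  proof -
    have "ip A (d q) (d q) = (\<Sum>j\<in>I. ip A (\<delta> q) (u j) * ip A (d q) (u j))"
      by (subst (2) d_def) (simp add: ip_sum_right ip_scale_right)
    also have "\<dots> = (\<Sum>j\<in>I. ip A (\<delta> q) (u j) * ip A (\<delta> q) (u j))"
      using projection_residual[OF assms(1,3) uo, of _ "\<delta> q"] by (simp add: d_def)
    finally show ?thesis using \<delta>[OF that] by (simp add: power2_eq_square)
  qed
  have "\<exists>q\<in>A. ip A (d q) (d q) \<le> card I / card A"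
  proof (rule ccontr)
    assume "\<not> ?thesis"
    then have "(\<Sum>q\<in>A. real (card I) / card A) < (\<Sum>q\<in>A. ip A (d q) (d q))"
      using assms by (intro sum_strict_mono) auto
    also have "\<dots> = (\<Sum>q\<in>A. \<Sum>j\<in>I. (u j q)\<^sup>2)" using d2 by simp
    also have "\<dots> = (\<Sum>j\<in>I. ip A (u j) (u j))" unfolding ip_self by (rule sum.swap)
    also have "\<dots> \<le> (\<Sum>j\<in>I. 1)" using u(2) by (intro sum_mono) fastforce
    finally show False using assms by simp
  qed
  then show ?thesis using d1 by blast
qed

section \<open>The transposition walk on the symmetric group\<close>

abbreviation Sym :: "'a set \<Rightarrow> ('a \<Rightarrow> 'a) set" where
  "Sym X \<equiv> {p. p permutes X}"

abbreviation transp :: "'a \<Rightarrow> 'a \<Rightarrow> 'a \<Rightarrow> 'a" where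
  "transp \<equiv> Transposition.transpose"

text \<open>The indicators \<open>agree a b\<close> with \<open>length a < k\<close> span the functions of degree below \<open>k\<close>, which are
  the isotypic components of the partitions of \<open>card X\<close> whose first row is longer than
  \<open>card X - k\<close>.\<close>

definition agree :: "'a list \<Rightarrow> 'a list \<Rightarrow> ('a \<Rightarrow> 'a) \<Rightarrow> real" where
  "agree a b p = (if map p a = b then 1 else 0)"

definition cells :: "'a set \<Rightarrow> nat \<Rightarrow> ('a list \<times> 'a list) set" where
  "cells X k = {(a, b). distinct a \<and> distinct b \<and> set a \<subseteq> X \<and> set b \<subseteq> X \<and>
     length a = length b \<and> length a < k}"

definition low_free :: "'a set \<Rightarrow> nat \<Rightarrow> (('a \<Rightarrow> 'a) \<Rightarrow> real) \<Rightarrow> bool" where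
  "low_free X k f \<longleftrightarrow> (\<forall>a b. (a, b) \<in> cells X k \<longrightarrow> ip (Sym X) f (agree a b) = 0)"

lemma cells_mono: "k \<le> l \<Longrightarrow> cells X k \<subseteq> cells X l"
  by (auto simp: cells_def)

lemma low_free_antimono: "low_free X l f \<Longrightarrow> k \<le> l \<Longrightarrow> low_free X k f"
  using cells_mono[of k l X] by (auto simp: low_free_def)

lemma card_lists_length_less:
  assumes "finite X"
  shows "finite {a. set a \<subseteq> X \<and> length a < Suc k}"
    and "card {a. set a \<subseteq> X \<and> length a < Suc k} \<le> (card X + 1) ^ k"
proof -
  have eq: "{a. set a \<subseteq> X \<and> length a < Suc k} = {a. set a \<subseteq> X \<and> length a \<le> k}" by auto
  show "finite {a. set a \<subseteq> X \<and> length a < Suc k}"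
    unfolding eq by (rule finite_lists_length_le[OF assms])
  have "(\<Sum>i\<le>k. n ^ i) \<le> (n + 1) ^ k" for n :: nat
  proof (induction k)
    case (Suc k)
    have "(\<Sum>i\<le>Suc k. n ^ i) \<le> (n + 1) ^ k + n * n ^ k" using Suc by simp
    also have "\<dots> \<le> (n + 1) ^ k + n * (n + 1) ^ k"
      by (intro add_left_mono mult_left_mono power_mono) auto
    finally show ?case by simp
  qed simp
  then show "card {a. set a \<subseteq> X \<and> length a < Suc k} \<le> (card X + 1) ^ k"
    unfolding eq card_lists_length_le[OF assms] .
qed

lemma cells_bound:
  assumes "finite X"
  shows "finite (cells X (Suc k))" "card (cells X (Suc k)) \<le> (card X + 1) ^ (2 * k)"
proof -
  let ?L = "{a. set a \<subseteq> X \<and> length a < Suc k}"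
  have sub: "cells X (Suc k) \<subseteq> ?L \<times> ?L" by (auto simp: cells_def)
  note fin = card_lists_length_less[OF assms, of k]
  show "finite (cells X (Suc k))" using sub fin(1) by (meson finite_SigmaI finite_subset)
  have "card (cells X (Suc k)) \<le> card (?L \<times> ?L)"
    using sub fin(1) by (intro card_mono) auto
  also have "\<dots> \<le> (card X + 1) ^ k * (card X + 1) ^ k"
    using fin(2) by (simp add: card_cartesian_product mult_le_mono)
  finally show "card (cells X (Suc k)) \<le> (card X + 1) ^ (2 * k)"
    by (simp add: power_add mult_2)
qed

lemma finite_cells: "finite X \<Longrightarrow> finite (cells X k)"
  using cells_bound(1)[of X k] cells_mono[of k "Suc k" X] finite_subset by fastforce

lemma agree_comp: "agree a b (p \<circ> t) = agree (map t a) b p"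
  by (simp add: agree_def)

lemma ip_Sym_right:
  assumes "t permutes X"
  shows "ip (Sym X) (\<lambda>p. f (p \<circ> t)) (\<lambda>p. g (p \<circ> t)) = ip (Sym X) f g"
  unfolding ip_def using sum_permutations_compose_right[OF assms, of "\<lambda>p. f p * g p"] by simp

lemma ip_Sym_left:
  assumes "t permutes X"
  shows "ip (Sym X) (\<lambda>p. f (t \<circ> p)) (\<lambda>p. g (t \<circ> p)) = ip (Sym X) f g"
  unfolding ip_def using setum_permutations_compose_left[OF assms, of "\<lambda>p. f p * g p"] by simp

lemma ip_Sym_transpose:
  assumes "i \<in> X" "j \<in> X"
  shows "ip (Sym X) (\<lambda>p. f (p \<circ> transp i j)) g = ip (Sym X) f (\<lambda>p. g (p \<circ> transp i j))"
  using ip_Sym_right[OF permutes_swap_id[OF assms], of f "\<lambda>p. g (p \<circ> transp i j)"]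
  by (simp add: comp_assoc)

lemma low_free_right:
  assumes "t permutes X" "low_free X k f"
  shows "low_free X k (\<lambda>p. f (p \<circ> t))"
  unfolding low_free_def
proof clarify
  fix a b assume ab: "(a, b) \<in> cells X k"
  note perm = permutes_inv[OF assms(1)]
  have "ip (Sym X) (\<lambda>p. f (p \<circ> t)) (agree a b) =
      ip (Sym X) (\<lambda>p. f (p \<circ> t)) (\<lambda>p. agree (map (inv t) a) b (p \<circ> t))"
    by (intro ip_cong) (simp_all add: agree_def permutes_inverses[OF assms(1)] o_def)
  also have "\<dots> = ip (Sym X) f (agree (map (inv t) a) b)"
    by (rule ip_Sym_right[OF assms(1)])
  also have "\<dots> = 0"
  proof -
    have "set (map (inv t) a) \<subseteq> X" "distinct (map (inv t) a)"
      using ab permutes_in_image[OF perm] permutes_inj_on[OF perm]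
      by (auto simp: cells_def distinct_map)
    then show ?thesis using assms(2) ab by (auto simp: low_free_def cells_def)
  qed
  finally show "ip (Sym X) (\<lambda>p. f (p \<circ> t)) (agree a b) = 0" .
qed

lemma low_free_add:
  "low_free X k f \<Longrightarrow> low_free X k g \<Longrightarrow> low_free X k (\<lambda>p. f p + s * g p)"
  unfolding low_free_def by (auto simp: ip_linear)

lemma low_free_diff:
  "low_free X k f \<Longrightarrow> low_free X k g \<Longrightarrow> low_free X k (\<lambda>p. f p - g p)"
  unfolding low_free_def by (auto simp: ip_linear)

lemma low_free_scale: "low_free X k f \<Longrightarrow> low_free X k (\<lambda>p. s * f p)"
  unfolding low_free_def by (auto simp: ip_linear)

lemma low_free_sum:
  "(\<And>i. i \<in> I \<Longrightarrow> low_free X k (F i)) \<Longrightarrow> low_free X k (\<lambda>p. \<Sum>i\<in>I. F i p)"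
  unfolding low_free_def by (simp add: ip_sum_left)

text \<open>Replacing one entry of a position list by a free position and summing gives an indicator of
  lower length; modulo such indicators the sum over all transpositions acts on position lists of
  length \<open>k\<close> almost like a scalar.\<close>

lemma agree_replace_sum:
  assumes "finite X" "low_free X k h" "distinct a" "set a \<subseteq> X" "distinct b" "set b \<subseteq> X"
    "length a = k" "length b = k" "i \<in> set a"
  shows "(\<Sum>j\<in>X - set a. ip (Sym X) h (agree (map (transp i j) a) b)) = - ip (Sym X) h (agree a b)"
proof -
  obtain u v where a: "a = u @ i # v" using \<open>i \<in> set a\<close> by (meson split_list)
  obtain u' y v' where b: "b = u' @ y # v'" and len: "length u' = length u" "length v' = length v"
  proof
    show "b = take (length u) b @ b ! length u # drop (Suc (length u)) b"
      using a assms(7,8) by (intro id_take_nth_drop) simp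
  qed (use a assms(7,8) in auto)
  have map_a: "map (transp i j) a = u @ j # v" if "j \<in> X - set a" for j
    using that a \<open>distinct a\<close> by (auto intro!: map_idI simp: Transposition.transpose_def)
  \<comment> \<open>If \<open>p\<close> matches the remaining entries, exactly one position
    \<open>j0\<close> has the value \<open>y\<close>. It cannot be a remaining position because
    \<open>b\<close> is distinct, so it is free or equal to \<open>i\<close>.\<close>
  have point: "(\<Sum>j\<in>insert i (X - set a). agree (u @ j # v) b p) = agree (u @ v) (u' @ v') p"
    if p: "p permutes X" for p
  proof (cases "map p u = u' \<and> map p v = v'")
    case True
    define j0 where "j0 = inv p y"
    have pj: "p j = y \<longleftrightarrow> j = j0" for j
      unfolding j0_def using permutes_inv_eq[OF p] by metis
    have "y \<in> X" using assms(6) b by auto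
    then have "j0 \<in> X" using permutes_in_image[OF permutes_inv[OF p]] by (simp add: j0_def)
    moreover have "j0 \<notin> set u" "j0 \<notin> set v"
      using True pj assms(5) b by fastforce+
    ultimately have j0: "j0 \<in> insert i (X - set a)" using a by auto
    have "agree (u @ j # v) b p = (if j = j0 then 1 else 0)" for j
      using True b pj by (auto simp: agree_def)
    then show ?thesis using True j0 \<open>finite X\<close> by (simp add: agree_def)
  next
    case False
    then have "agree (u @ j # v) b p = 0" for j using b len by (auto simp: agree_def)
    then show ?thesis using False len by (auto simp: agree_def)
  qed
  have "i \<notin> X - set a" using \<open>i \<in> set a\<close> by simp
  then have "(\<Sum>j\<in>X - set a. ip (Sym X) h (agree (u @ j # v) b)) + ip (Sym X) h (agree a b) =
      ip (Sym X) h (\<lambda>p. \<Sum>j\<in>insert i (X - set a). agree (u @ j # v) b p)"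
    using \<open>finite X\<close> by (simp add: ip_add_right ip_sum_right a)
  also have "\<dots> = ip (Sym X) h (agree (u @ v) (u' @ v'))"
    by (intro ip_cong) (use point in auto)
  also have "\<dots> = 0"
    using assms(2-8) a b len by (auto simp: low_free_def cells_def)
  finally show ?thesis using map_a by simp
qed

section \<open>The sum of all transpositions on one level\<close>

definition swap_sum :: "'a set \<Rightarrow> (('a \<Rightarrow> 'a) \<Rightarrow> real) \<Rightarrow> ('a \<Rightarrow> 'a) \<Rightarrow> real" where
  "swap_sum X f p = (\<Sum>i\<in>X. \<Sum>j\<in>X. f (p \<circ> transp i j))"

lemma swap_sum_linear: "swap_sum X (\<lambda>x. g x + s * h x) = (\<lambda>x. swap_sum X g x + s * swap_sum X h x)"
  by (simp add: swap_sum_def sum.distrib sum_distrib_left fun_eq_iff)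

lemma swap_sum_adjoint: "ip (Sym X) (swap_sum X g) h = ip (Sym X) g (swap_sum X h)"
  unfolding swap_sum_def ip_sum_left ip_sum_right
  by (intro sum.cong refl ip_Sym_transpose)

lemma low_free_swap_sum: "low_free X k f \<Longrightarrow> low_free X k (swap_sum X f)"
  unfolding swap_sum_def by (intro low_free_sum low_free_right permutes_swap_id)

lemma ip_swap_sum_agree:
  "ip (Sym X) (swap_sum X h) (agree a b) =
    (\<Sum>i\<in>X. \<Sum>j\<in>X. ip (Sym X) h (agree (map (transp i j) a) b))"
  unfolding swap_sum_adjoint by (simp add: swap_sum_def[abs_def] ip_sum_right agree_comp)

text \<open>The pairs \<open>(i, j)\<close> are split by membership in the set \<open>A\<close> of
  positions. Each mixed block gives \<open>- k\<close> times the coefficient by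
  \<open>agree_replace_sum\<close>, pairs outside \<open>A\<close> leave \<open>a\<close> unchanged,
  and pairs inside \<open>A\<close> permute its entries, where only the uniform bound
  \<open>C\<close> is available.\<close>

lemma swap_sum_coefficient_bound:
  assumes "finite X" "low_free X k h" "distinct a" "set a \<subseteq> X" "distinct b" "set b \<subseteq> X"
    "length a = k" "length b = k"
    and C: "\<And>a'. distinct a' \<Longrightarrow> set a' \<subseteq> X \<Longrightarrow> length a' = k \<Longrightarrow> \<bar>ip (Sym X) h (agree a' b)\<bar> \<le> C"
  shows "\<bar>ip (Sym X) (swap_sum X h) (agree a b) + 2 * real k * ip (Sym X) h (agree a b)\<bar>
    \<le> ((real (card X) - real k)\<^sup>2 + (real k)\<^sup>2) * C"
proof -
  define A where "A = set a"
  define F where "F = ip (Sym X) h (agree a b)"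
  define G where "G i j = ip (Sym X) h (agree (map (transp i j) a) b)" for i j
  have A: "A \<subseteq> X" "card A = k" "finite A" "card (X - A) = card X - k" "k \<le> card X"
    using assms by (auto simp: A_def distinct_card card_Diff_subset card_mono)
      (metis card_mono distinct_card)
  have G_commute: "G i j = G j i" for i j by (simp add: G_def transpose_commute)
  have row: "(\<Sum>j\<in>X - A. G i j) = - F" if "i \<in> A" for i
    unfolding G_def F_def A_def using that
    by (intro agree_replace_sum[OF assms(1-8)]) (simp add: A_def)
  have S12: "(\<Sum>i\<in>A. \<Sum>j\<in>X - A. G i j) = - real k * F"
    using row A by simp
  then have S21: "(\<Sum>i\<in>X - A. \<Sum>j\<in>A. G i j) = - real k * F"
    by (subst sum.swap) (simp add: G_commute)
  have "G i j = F" if "i \<in> X - A" "j \<in> X - A" for i j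
  proof -
    have "map (transp i j) a = a"
      using that by (intro map_idI) (auto simp: A_def Transposition.transpose_def)
    then show ?thesis by (simp add: G_def F_def)
  qed
  then have S22: "(\<Sum>i\<in>X - A. \<Sum>j\<in>X - A. G i j) = (real (card X) - real k)\<^sup>2 * F"
    using A by (simp add: of_nat_diff power2_eq_square mult.assoc)
  have G_bound: "\<bar>G i j\<bar> \<le> C" if "i \<in> A" "j \<in> A" for i j
  proof -
    have t: "transp i j permutes X"
      using that A by (intro permutes_swap_id) auto
    show ?thesis unfolding G_def
      using assms(3,4,7) permutes_in_image[OF t] permutes_inj_on[OF t]
      by (intro C) (auto simp: distinct_map)
  qed
  have "\<bar>\<Sum>i\<in>A. \<Sum>j\<in>A. G i j\<bar> \<le> (\<Sum>i\<in>A. \<Sum>j\<in>A. C)"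
    by (rule order_trans[OF sum_abs] sum_mono)+ (use G_bound in auto)
  then have S11: "\<bar>\<Sum>i\<in>A. \<Sum>j\<in>A. G i j\<bar> \<le> (real k)\<^sup>2 * C"
    using A by (simp add: power2_eq_square mult.assoc)
  have split: "sum g X = sum g (X - A) + sum g A" for g :: "'a \<Rightarrow> real"
    using A assms(1) by (intro sum.subset_diff)
  have "ip (Sym X) (swap_sum X h) (agree a b) = (\<Sum>i\<in>X. \<Sum>j\<in>X. G i j)"
    by (simp add: ip_swap_sum_agree G_def)
  also have "\<dots> = (\<Sum>i\<in>X - A. (\<Sum>j\<in>X - A. G i j) + (\<Sum>j\<in>A. G i j)) +
      (\<Sum>i\<in>A. (\<Sum>j\<in>X - A. G i j) + (\<Sum>j\<in>A. G i j))"
    by (simp only: split)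
  also have "\<dots> = (real (card X) - real k)\<^sup>2 * F - 2 * real k * F + (\<Sum>i\<in>A. \<Sum>j\<in>A. G i j)"
    unfolding sum.distrib S12 S21 S22 by simp
  finally have "\<bar>ip (Sym X) (swap_sum X h) (agree a b) + 2 * real k * F\<bar>
      = \<bar>(real (card X) - real k)\<^sup>2 * F + (\<Sum>i\<in>A. \<Sum>j\<in>A. G i j)\<bar>" by simp
  also have "\<dots> \<le> (real (card X) - real k)\<^sup>2 * \<bar>F\<bar> + (real k)\<^sup>2 * C"
    using S11 by (intro order_trans[OF abs_triangle_ineq]) (simp add: abs_mult)
  also have "\<dots> \<le> (real (card X) - real k)\<^sup>2 * C + (real k)\<^sup>2 * C"
    using C[OF assms(3,4,7)] by (intro add_right_mono mult_left_mono) (auto simp: F_def)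
  finally show ?thesis by (simp add: F_def algebra_simps)
qed

text \<open>The constant is the eigenvalue of the partition \<open>(card X - k, k)\<close>.\<close>

lemma swap_sum_level_bound:
  assumes "finite X" "low_free X k f"
    and span: "\<And>p. p permutes X \<Longrightarrow> f p = (\<Sum>z\<in>cells X (Suc k). c z * agree (fst z) (snd z) p)"
  shows "ip (Sym X) f (swap_sum X f) \<le> ((real (card X) - real k)\<^sup>2 + (real k)\<^sup>2 - 2 * real k) * ip (Sym X) f f"
proof -
  \<comment> \<open>The shift by \<open>2 * k\<close> cancels the two mixed blocks, so that the
    largest coefficient against indicators of length \<open>k\<close> grows by at most the factor
    \<open>\<rho>\<close> per application.\<close>
  define B where "B = (\<lambda>g p. swap_sum X g p + 2 * real k * g p)"
  define \<rho> where "\<rho> = (real (card X) - real k)\<^sup>2 + (real k)\<^sup>2"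
  define C where "C = (\<Sum>p\<in>Sym X. \<bar>f p\<bar>)"
  have fin: "finite (Sym X)" using \<open>finite X\<close> by (rule finite_permutations)
  have \<rho>: "\<rho> \<ge> 0" by (simp add: \<rho>_def)
  have adj: "ip (Sym X) (B g) h = ip (Sym X) g (B h)" for g h
    by (simp add: B_def ip_linear swap_sum_adjoint)
  have low: "low_free X k ((B ^^ j) f)" for j
    by (induction j) (auto simp: assms(2) B_def intro!: low_free_add low_free_swap_sum)
  have coeff: "\<bar>ip (Sym X) ((B ^^ j) f) (agree a b)\<bar> \<le> C * \<rho> ^ j"
    if "distinct a" "set a \<subseteq> X" "length a = k" and b: "distinct b" "set b \<subseteq> X" "length b = k" for j a b
    using that(1-3)
  proof (induction j arbitrary: a)
    case 0
    have "\<bar>ip (Sym X) f (agree a b)\<bar> \<le> C"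
      unfolding ip_def C_def by (rule order_trans[OF sum_abs]) (auto intro!: sum_mono simp: agree_def)
    then show ?case by simp
  next
    case (Suc j)
    have "ip (Sym X) (B ((B ^^ j) f)) (agree a b) = ip (Sym X) (swap_sum X ((B ^^ j) f)) (agree a b)
        + 2 * real k * ip (Sym X) ((B ^^ j) f) (agree a b)"
      by (simp add: B_def ip_linear)
    also have "\<bar>\<dots>\<bar> \<le> \<rho> * (C * \<rho> ^ j)"
      unfolding \<rho>_def
      by (rule swap_sum_coefficient_bound[OF \<open>finite X\<close> low Suc.prems(1,2) b(1,2) Suc.prems(3) b(3)])
        (use Suc.IH in \<open>simp add: \<rho>_def\<close>)
    finally show ?case by (simp add: mult_ac)
  qed
  define D where "D = (\<Sum>z\<in>cells X (Suc k). \<bar>c z\<bar> * C)"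
  \<comment> \<open>Since \<open>f\<close> lies in the span of the indicators of length at most
    \<open>k\<close>, its moments see only the coefficients just bounded; those of smaller length
    vanish because \<open>B\<close> preserves \<open>low_free\<close>.\<close>
  have "ip (Sym X) f ((B ^^ j) f) \<le> D * \<rho> ^ j" for j
  proof -
    have summand: "c z * ip (Sym X) (agree (fst z) (snd z)) ((B ^^ j) f) \<le> \<bar>c z\<bar> * C * \<rho> ^ j"
      if z: "z \<in> cells X (Suc k)" for z
    proof -
      have "\<bar>ip (Sym X) ((B ^^ j) f) (agree (fst z) (snd z))\<bar> \<le> C * \<rho> ^ j"
      proof (cases "length (fst z) = k")
        case True
        then show ?thesis using z by (intro coeff) (auto simp: cells_def)
      next
        case False
        then have "ip (Sym X) ((B ^^ j) f) (agree (fst z) (snd z)) = 0"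
          using z low[of j] by (force simp: cells_def low_free_def)
        then show ?thesis using \<rho> by (simp add: C_def sum_nonneg)
      qed
      then have "\<bar>c z\<bar> * \<bar>ip (Sym X) (agree (fst z) (snd z)) ((B ^^ j) f)\<bar> \<le> \<bar>c z\<bar> * (C * \<rho> ^ j)"
        by (intro mult_left_mono) (auto simp: ip_commute)
      then show ?thesis unfolding abs_mult[symmetric] by (simp add: mult.assoc)
    qed
    have "ip (Sym X) f ((B ^^ j) f) =
        ip (Sym X) (\<lambda>p. \<Sum>z\<in>cells X (Suc k). c z * agree (fst z) (snd z) p) ((B ^^ j) f)"
      by (intro ip_cong) (use span in auto)
    also have "\<dots> = (\<Sum>z\<in>cells X (Suc k). c z * ip (Sym X) (agree (fst z) (snd z)) ((B ^^ j) f))"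
      by (simp add: ip_sum_left ip_scale_left)
    also have "\<dots> \<le> (\<Sum>z\<in>cells X (Suc k). \<bar>c z\<bar> * C * \<rho> ^ j)"
      by (intro sum_mono summand)
    finally show ?thesis by (simp add: D_def sum_distrib_right)
  qed
  then have "ip (Sym X) f (B f) \<le> \<rho> * ip (Sym X) f f"
    by (rule selfadjoint_moment_bound[OF fin adj _ \<rho>])
  then show ?thesis
    unfolding B_def ip_add_right ip_scale_right \<rho>_def by (simp add: algebra_simps)
qed

section \<open>Descent along the levels\<close>

lemma low_free_eq_0:
  assumes "finite X" "low_free X k f" "card X < k" "p permutes X"
  shows "f p = 0"
proof -
  obtain a where a: "set a = X" "distinct a"
    using finite_distinct_list[OF \<open>finite X\<close>] by blast
  \<comment> \<open>A list of all points pins down the permutation, so this indicator is a point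
    mass.\<close>
  have "agree a (map p a) q = (if q = p then 1 else 0)" if "q permutes X" for q
    unfolding agree_def using a that \<open>p permutes X\<close> by (auto simp: fun_eq_iff) (metis permutes_not_in)
  then have "ip (Sym X) f (agree a (map p a)) = ip (Sym X) f (\<lambda>q. if q = p then 1 else 0)"
    by (intro ip_cong) auto
  also have "\<dots> = f p"
    using \<open>p permutes X\<close> finite_permutations[OF \<open>finite X\<close>]
    by (simp add: ip_def if_distrib cong: if_cong)
  moreover have "(a, map p a) \<in> cells X k"
    using a assms(3,4) permutes_inj_on[OF assms(4)] permutes_image[OF assms(4)]
    by (auto simp: cells_def distinct_map distinct_card[symmetric])
  ultimately show ?thesis using assms(2) by (auto simp: low_free_def)
qed

lemma low_free_orthogonal_span:
  assumes "low_free X k g"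
    and "\<And>p. p permutes X \<Longrightarrow> f p = (\<Sum>z\<in>cells X k. c z * agree (fst z) (snd z) p)"
  shows "ip (Sym X) g f = 0"
proof -
  have "ip (Sym X) g f = ip (Sym X) g (\<lambda>p. \<Sum>z\<in>cells X k. c z * agree (fst z) (snd z) p)"
    by (intro ip_cong) (use assms in auto)
  also have "\<dots> = (\<Sum>z\<in>cells X k. c z * ip (Sym X) g (agree (fst z) (snd z)))"
    by (simp add: ip_sum_right ip_scale_right)
  also have "\<dots> = 0" using assms(1) by (intro sum.neutral) (auto simp: low_free_def)
  finally show ?thesis .
qed

text \<open>Removing the projection onto indicators of length at most \<open>k\<close> leaves a
  remainder in the next level. Since \<open>swap_sum\<close> is self-adjoint and preserves that
  level, the quadratic form splits without a cross term.\<close>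

lemma swap_sum_bound_descend:
  assumes "finite X" "low_free X k f"
    and level: "(real (card X) - real k)\<^sup>2 + (real k)\<^sup>2 - 2 * real k \<le> \<kappa>"
    and high: "\<And>g. low_free X (Suc k) g \<Longrightarrow> ip (Sym X) g (swap_sum X g) \<le> \<kappa> * ip (Sym X) g g"
  shows "ip (Sym X) f (swap_sum X f) \<le> \<kappa> * ip (Sym X) f f"
proof -
  have "\<exists>c. \<forall>z\<in>cells X (Suc k). ip (Sym X)
      (\<lambda>p. f p - (\<Sum>w\<in>cells X (Suc k). c w * agree (fst w) (snd w) p)) (agree (fst z) (snd z)) = 0"
    by (rule orthogonal_projection[OF finite_permutations[OF \<open>finite X\<close>] finite_cells[OF \<open>finite X\<close>]])
  then obtain c where c: "\<And>z. z \<in> cells X (Suc k) \<Longrightarrow> ip (Sym X)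
      (\<lambda>p. f p - (\<Sum>w\<in>cells X (Suc k). c w * agree (fst w) (snd w) p)) (agree (fst z) (snd z)) = 0"
    by blast
  define f1 where "f1 = (\<lambda>p. \<Sum>w\<in>cells X (Suc k). c w * agree (fst w) (snd w) p)"
  define f2 where "f2 = (\<lambda>p. f p - f1 p)"
  have f2: "low_free X (Suc k) f2"
    unfolding low_free_def f2_def f1_def using c by force
  have f_eq: "f = (\<lambda>p. f1 p + 1 * f2 p)" by (simp add: f2_def)
  have f1: "low_free X k f1"
    using low_free_diff[OF assms(2) low_free_antimono[OF f2, of k]] by (simp add: f2_def)
  have 0: "ip (Sym X) f2 f1 = 0"
    by (rule low_free_orthogonal_span[OF f2, where c = c]) (simp add: f1_def)
  have 1: "ip (Sym X) (swap_sum X f2) f1 = 0"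
    by (rule low_free_orthogonal_span[OF low_free_swap_sum[OF f2], where c = c]) (simp add: f1_def)
  have 2: "ip (Sym X) f2 (swap_sum X f1) = 0" using 1 by (simp add: swap_sum_adjoint)
  have "ip (Sym X) f1 (swap_sum X f1) \<le>
      ((real (card X) - real k)\<^sup>2 + (real k)\<^sup>2 - 2 * real k) * ip (Sym X) f1 f1"
    by (rule swap_sum_level_bound[OF \<open>finite X\<close> f1, where c = c]) (simp add: f1_def)
  also have "\<dots> \<le> \<kappa> * ip (Sym X) f1 f1" using level by (intro mult_right_mono) auto
  finally have 3: "ip (Sym X) f1 (swap_sum X f1) \<le> \<kappa> * ip (Sym X) f1 f1" .
  have 4: "ip (Sym X) f1 f2 = 0" "ip (Sym X) f1 (swap_sum X f2) = 0"
    using 0 1 by (simp_all add: ip_commute[of _ f1])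
  have "swap_sum X f = (\<lambda>p. swap_sum X f1 p + 1 * swap_sum X f2 p)"
    by (subst f_eq) (rule swap_sum_linear)
  then have "ip (Sym X) f (swap_sum X f) =
      ip (Sym X) (\<lambda>p. f1 p + 1 * f2 p) (\<lambda>p. swap_sum X f1 p + 1 * swap_sum X f2 p)"
    using f_eq by simp
  also have "\<dots> = ip (Sym X) f1 (swap_sum X f1) + ip (Sym X) f2 (swap_sum X f2)"
    by (simp only: ip_add_left ip_add_right ip_scale_left ip_scale_right 2 4 mult_1 mult_zero_right add_0_left add_0_right)
  finally have 5: "ip (Sym X) f (swap_sum X f) =
      ip (Sym X) f1 (swap_sum X f1) + ip (Sym X) f2 (swap_sum X f2)" .
  have "ip (Sym X) f f = ip (Sym X) (\<lambda>p. f1 p + 1 * f2 p) (\<lambda>p. f1 p + 1 * f2 p)"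
    using f_eq by simp
  also have "\<dots> = ip (Sym X) f1 f1 + ip (Sym X) f2 f2"
    by (simp only: ip_add_left ip_add_right ip_scale_left ip_scale_right 0 4 mult_1 mult_zero_right add_0_left add_0_right)
  finally have "ip (Sym X) f f = ip (Sym X) f1 f1 + ip (Sym X) f2 f2" .
  then show ?thesis using 3 5 high[OF f2] by (simp add: algebra_simps)
qed

lemma swap_sum_bound_descend_range:
  assumes "finite X" "k \<le> K" "low_free X k f"
    and "\<And>j. k \<le> j \<Longrightarrow> j < K \<Longrightarrow> (real (card X) - real j)\<^sup>2 + (real j)\<^sup>2 - 2 * real j \<le> \<kappa>"
    and "\<And>g. low_free X K g \<Longrightarrow> ip (Sym X) g (swap_sum X g) \<le> \<kappa> * ip (Sym X) g g"
  shows "ip (Sym X) f (swap_sum X f) \<le> \<kappa> * ip (Sym X) f f"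
  using assms(2,3,4)
proof (induction k arbitrary: f rule: inc_induct)
  case base
  then show ?case using assms(5) by blast
next
  case (step k)
  show ?case
    by (rule swap_sum_bound_descend[OF \<open>finite X\<close> step.prems(1)])
      (use step in auto)
qed

section \<open>Deleting a point\<close>

lemma sum_rotate:
  "(\<Sum>i\<in>I. \<Sum>j\<in>J. \<Sum>y\<in>Z. H i j y) = (\<Sum>y\<in>Z. \<Sum>i\<in>I. \<Sum>j\<in>J. H i j y :: real)"
proof -
  have "(\<Sum>i\<in>I. \<Sum>j\<in>J. \<Sum>y\<in>Z. H i j y) = (\<Sum>i\<in>I. \<Sum>y\<in>Z. \<Sum>j\<in>J. H i j y)"
    by (intro sum.cong refl sum.swap)
  also have "\<dots> = (\<Sum>y\<in>Z. \<Sum>i\<in>I. \<Sum>j\<in>J. H i j y)" by (rule sum.swap)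
  finally show ?thesis .
qed

lemma ip_Sym_insert:
  assumes "finite Y" "x \<notin> Y"
  shows "ip (Sym (insert x Y)) f g =
    (\<Sum>y\<in>insert x Y. ip (Sym Y) (\<lambda>q. f (transp x y \<circ> q)) (\<lambda>q. g (transp x y \<circ> q)))"
  unfolding ip_def by (rule sum_over_permutations_insert[OF assms])

text \<open>Prefixing \<open>x\<close> and \<open>y\<close> to an indicator restricts it to the
  coset of permutations sending \<open>x\<close> to \<open>y\<close>, at the price of one unit of
  length. The coset is parametrised by \<open>transp x y \<circ> q\<close>, so the values
  \<open>b\<close> have to be carried through the same transposition.\<close>

lemma low_free_delete:
  assumes "finite Y" "x \<notin> Y" "y \<in> insert x Y" "low_free (insert x Y) (Suc k) f"
  shows "low_free Y k (\<lambda>q. f (transp x y \<circ> q))"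
  unfolding low_free_def
proof (intro allI impI)
  fix a b assume ab: "(a, b) \<in> cells Y k"
  let ?t = "\<lambda>y. transp x y"
  have x: "q x = x" if "q permutes Y" for q using that \<open>x \<notin> Y\<close> by (rule permutes_not_in)
  have point: "agree (x # a) (y # map (?t y) b) (?t z \<circ> q) = (if z = y then agree a b q else 0)"
    if "q permutes Y" for z q
    using x[OF that] by (auto simp: agree_def inj_map_eq_map[OF inj_transpose] simp flip: map_map)
  have "ip (Sym (insert x Y)) f (agree (x # a) (y # map (?t y) b)) =
      (\<Sum>z\<in>insert x Y. ip (Sym Y) (\<lambda>q. f (?t z \<circ> q)) (\<lambda>q. if z = y then agree a b q else 0))"
    unfolding ip_Sym_insert[OF assms(1,2)] by (intro sum.cong ip_cong refl) (simp_all add: point)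
  also have "\<dots> = (\<Sum>z\<in>insert x Y. if z = y then ip (Sym Y) (\<lambda>q. f (?t y \<circ> q)) (agree a b) else 0)"
    by (intro sum.cong) (auto simp: ip_def)
  also have "\<dots> = ip (Sym Y) (\<lambda>q. f (?t y \<circ> q)) (agree a b)"
    using assms(1,3) by (subst sum.delta) auto
  moreover have "(x # a, y # map (?t y) b) \<in> cells (insert x Y) (Suc k)"
  proof -
    have "y \<notin> ?t y ` set b"
    proof
      assume "y \<in> ?t y ` set b"
      then obtain c where "c \<in> set b" "y = ?t y c" by auto
      then have "c = x" by (metis transpose_apply_second transpose_involutory)
      then show False using \<open>c \<in> set b\<close> ab \<open>x \<notin> Y\<close> by (auto simp: cells_def)
    qed
    moreover have "?t y ` set b \<subseteq> insert x Y"
      using ab assms(3) by (auto simp: cells_def Transposition.transpose_def)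
    ultimately show ?thesis
      using ab assms(2,3) by (auto simp: cells_def distinct_map)
  qed
  ultimately show "ip (Sym Y) (\<lambda>q. f (?t y \<circ> q)) (agree a b) = 0"
    using assms(4) by (simp add: low_free_def)
qed

text \<open>Average the inequality on the cosets of \<open>Sym (X - {x})\<close> over \<open>x\<close>.\<close>

lemma swap_sum_bound_delete:
  assumes "finite X" "card X = m" "m \<ge> 3" "low_free X (Suc k) f"
    and IH: "\<And>x g. x \<in> X \<Longrightarrow> low_free (X - {x}) k g \<Longrightarrow>
      ip (Sym (X - {x})) g (swap_sum (X - {x}) g) \<le> ((real m - 1)\<^sup>2 - \<gamma>) * ip (Sym (X - {x})) g g"
  shows "(real m - 2) * ip (Sym X) f (swap_sum X f) \<le> ((real m - 2) * (real m)\<^sup>2 - real m * \<gamma>) * ip (Sym X) f f"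
proof -
  let ?t = "\<lambda>i j. transp i j"
  define F where "F = ip (Sym X) f f"
  define D where "D i j = F - ip (Sym X) f (\<lambda>p. f (p \<circ> ?t i j))" for i j
  have deleted: "\<gamma> * F \<le> (\<Sum>i\<in>X - {x}. \<Sum>j\<in>X - {x}. D i j)" if "x \<in> X" for x
  proof -
    define Y where "Y = X - {x}"
    have X: "X = insert x Y" and Y: "finite Y" "x \<notin> Y" "card Y = m - 1"
      using that assms(1,2) by (auto simp: Y_def)
    define g where "g y = (\<lambda>q. f (?t x y \<circ> q))" for y
    have "(\<Sum>i\<in>Y. \<Sum>j\<in>Y. ip (Sym X) f (\<lambda>p. f (p \<circ> ?t i j)))
        = (\<Sum>y\<in>X. ip (Sym Y) (g y) (swap_sum Y (g y)))"
      unfolding X ip_Sym_insert[OF Y(1,2)] swap_sum_def[abs_def] ip_sum_right g_def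
      by (subst sum_rotate) (simp add: comp_assoc)
    also have "\<dots> \<le> (\<Sum>y\<in>X. ((real m - 1)\<^sup>2 - \<gamma>) * ip (Sym Y) (g y) (g y))"
    proof (rule sum_mono)
      fix y assume "y \<in> X"
      then have "low_free Y k (g y)"
        unfolding g_def using assms(4) unfolding X by (intro low_free_delete[OF Y(1,2)])
      then show "ip (Sym Y) (g y) (swap_sum Y (g y)) \<le> ((real m - 1)\<^sup>2 - \<gamma>) * ip (Sym Y) (g y) (g y)"
        unfolding Y_def by (intro IH that)
    qed
    also have "\<dots> = ((real m - 1)\<^sup>2 - \<gamma>) * F"
    proof -
      have "F = (\<Sum>y\<in>X. ip (Sym Y) (g y) (g y))"
        unfolding F_def X g_def by (rule ip_Sym_insert[OF Y(1,2)])
      then show ?thesis by (simp add: sum_distrib_left)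
    qed
    finally have "(\<Sum>i\<in>Y. \<Sum>j\<in>Y. ip (Sym X) f (\<lambda>p. f (p \<circ> ?t i j))) \<le> ((real m - 1)\<^sup>2 - \<gamma>) * F" .
    moreover have "(\<Sum>i\<in>Y. \<Sum>j\<in>Y. D i j) = (real m - 1)\<^sup>2 * F -
        (\<Sum>i\<in>Y. \<Sum>j\<in>Y. ip (Sym X) f (\<lambda>p. f (p \<circ> ?t i j)))"
      using Y(3) \<open>m \<ge> 3\<close> by (simp add: D_def sum_subtractf power2_eq_square of_nat_diff mult.assoc)
    ultimately show ?thesis by (simp add: Y_def[symmetric] algebra_simps)
  qed
  have D0: "D i i = 0" for i by (simp add: D_def F_def)
  have "real m * \<gamma> * F = (\<Sum>x\<in>X. \<gamma> * F)" using assms(2) by simp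
  also have "\<dots> \<le> (\<Sum>x\<in>X. \<Sum>i\<in>X - {x}. \<Sum>j\<in>X - {x}. D i j)"
    using deleted by (intro sum_mono)
  also have "\<dots> = (\<Sum>x\<in>X. \<Sum>i\<in>X. \<Sum>j\<in>X. if x \<noteq> i \<and> x \<noteq> j then D i j else 0)"
  proof (rule sum.cong[OF refl])
    fix x assume "x \<in> X"
    have inner: "(\<Sum>j\<in>X - {x}. D i j) = (\<Sum>j\<in>X. if x \<noteq> j then D i j else 0)" for i
      using assms(1) by (intro sum.mono_neutral_cong_left) auto
    show "(\<Sum>i\<in>X - {x}. \<Sum>j\<in>X - {x}. D i j) = (\<Sum>i\<in>X. \<Sum>j\<in>X. if x \<noteq> i \<and> x \<noteq> j then D i j else 0)"
      unfolding inner using assms(1) by (intro sum.mono_neutral_cong_left) auto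
  qed
  also have "\<dots> = (\<Sum>i\<in>X. \<Sum>j\<in>X. \<Sum>x\<in>X. if x \<noteq> i \<and> x \<noteq> j then D i j else 0)"
    by (rule sum_rotate[symmetric])
  \<comment> \<open>A pair \<open>i \<noteq> j\<close> survives the deletion of \<open>m - 2\<close>
    points; on the diagonal \<open>D\<close> vanishes.\<close>
  also have "\<dots> = (\<Sum>i\<in>X. \<Sum>j\<in>X. (real m - 2) * D i j)"
  proof (intro sum.cong refl)
    fix i j assume "i \<in> X" "j \<in> X"
    have "(\<Sum>x\<in>X. if x \<noteq> i \<and> x \<noteq> j then D i j else 0) = (\<Sum>x\<in>X - {i, j}. D i j)"
      using assms(1) by (intro sum.mono_neutral_cong_right) auto
    also have "\<dots> = (real m - 2) * D i j"
      using \<open>i \<in> X\<close> \<open>j \<in> X\<close> assms(1-3) D0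
      by (cases "i = j") (auto simp: card_Diff_subset of_nat_diff)
    finally show "(\<Sum>x\<in>X. if x \<noteq> i \<and> x \<noteq> j then D i j else 0) = (real m - 2) * D i j" .
  qed
  also have "\<dots> = (real m - 2) * (\<Sum>i\<in>X. \<Sum>j\<in>X. D i j)"
    by (simp add: sum_distrib_left)
  also have "(\<Sum>i\<in>X. \<Sum>j\<in>X. D i j) = (real m)\<^sup>2 * F - ip (Sym X) f (swap_sum X f)"
    using assms(2) by (simp add: D_def sum_subtractf power2_eq_square swap_sum_def[abs_def] ip_sum_right)
  finally show ?thesis by (simp add: F_def algebra_simps)
qed

text \<open>The constant 4/9 comes from \<open>2 j (m - j) \<ge> 4/9 m^2\<close>, which holds
  exactly for \<open>m / 3 \<le> j \<le> 2 m / 3\<close>. On this range the level constants suffice;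
  beyond it deletion takes over. Deletion reproduces the deficit: \<open>m / (m - 2)\<close> times
  \<open>4/9 (m - 1) (m - 2)\<close> is \<open>4/9 m (m - 1)\<close>.\<close>

lemma swap_sum_bound_high:
  assumes "finite X" "card X = m" "low_free X k f" "m \<le> 3 * k"
  shows "ip (Sym X) f (swap_sum X f) \<le> ((real m)\<^sup>2 - 4 / 9 * real m * (real m - 1)) * ip (Sym X) f f"
  using assms
proof (induction m arbitrary: X k f rule: less_induct)
  case (less m)
  let ?\<kappa> = "(real m)\<^sup>2 - 4 / 9 * real m * (real m - 1)"
  have zero: "ip (Sym X) g (swap_sum X g) \<le> ?\<kappa> * ip (Sym X) g g"
    if "low_free X j g" "m < j" for j g
    using low_free_eq_0[OF less.prems(1) that(1)] that(2) less.prems(2) by (simp add: ip_def)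
  \<comment> \<open>The deletion inequality has to be divided by \<open>m - 2\<close>, so
    \<open>m \<le> 2\<close> is checked by hand.\<close>
  show ?case
  proof (cases "m \<le> 2")
    case True
    then have m: "m = 0 \<or> m = 1 \<or> m = 2" by linarith
    show ?thesis
    proof (cases "k \<le> Suc m")
      case k: True
      show ?thesis
      proof (rule swap_sum_bound_descend_range[OF less.prems(1) k less.prems(3)])
        fix j assume "k \<le> j" "j < Suc m"
        then show "(real (card X) - real j)\<^sup>2 + (real j)\<^sup>2 - 2 * real j \<le> ?\<kappa>"
          using m less.prems(2,4) by (cases "j = 0"; cases "j = 1"; cases "j = 2"; auto)
      qed (use zero in auto)
    qed (use zero less.prems in auto)
  next
    case False
    have rec: "ip (Sym X) g (swap_sum X g) \<le> ?\<kappa> * ip (Sym X) g g"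
      if g: "low_free X K g" "2 * m < 3 * K" for g K
    proof -
      obtain l where l: "K = Suc l" using g(2) by (cases K) auto
      have IH: "ip (Sym (X - {x})) h (swap_sum (X - {x}) h) \<le>
          ((real m - 1)\<^sup>2 - 4 / 9 * (real m - 1) * (real m - 2)) * ip (Sym (X - {x})) h h"
        if "x \<in> X" "low_free (X - {x}) l h" for x h
        using less.IH[of "m - 1" "X - {x}" l h] that g(2) l False less.prems(1,2)
        by (simp add: of_nat_diff)
      have "(real m - 2) * ip (Sym X) g (swap_sum X g) \<le>
          ((real m - 2) * (real m)\<^sup>2 - real m * (4 / 9 * (real m - 1) * (real m - 2))) * ip (Sym X) g g"
        using False g(1) l by (intro swap_sum_bound_delete[OF less.prems(1,2) _ _ IH]) auto
      also have "\<dots> = (real m - 2) * (?\<kappa> * ip (Sym X) g g)" by (simp add: algebra_simps)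
      finally show ?thesis using False by simp
    qed
    show ?thesis
    proof (cases "2 * m < 3 * k")
      case True
      then show ?thesis using rec less.prems by blast
    next
      case k: False
      have "k \<le> 2 * m div 3 + 1" using k by linarith
      then show ?thesis
      proof (rule swap_sum_bound_descend_range[OF less.prems(1) _ less.prems(3)])
        fix j assume j: "k \<le> j" "j < 2 * m div 3 + 1"
        then have "m \<le> 3 * j" "3 * j \<le> 2 * m" using less.prems(4) by linarith+
        then have "real m \<le> 3 * real j" "3 * real j \<le> 2 * real m" by linarith+
        then have "0 \<le> (3 * real j - real m) * (2 * real m - 3 * real j)" by simp
        then show "(real (card X) - real j)\<^sup>2 + (real j)\<^sup>2 - 2 * real j \<le> ?\<kappa>"
        proof -
          assume *: "0 \<le> (3 * real j - real m) * (2 * real m - 3 * real j)"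
          have "(real m - real j)\<^sup>2 + (real j)\<^sup>2 - 2 * real j
              = (real m)\<^sup>2 - 2 * (real j * real m) + 2 * (real j * real j) - 2 * real j"
            by (simp add: power2_eq_square algebra_simps)
          moreover have "2 * (real m * real m) \<le> 9 * (real j * real m) - 9 * (real j * real j)"
            using * by (simp add: algebra_simps)
          moreover have "?\<kappa> = (real m)\<^sup>2 - 4 / 9 * (real m * real m) + 4 / 9 * real m"
            by (simp add: field_simps)
          ultimately show ?thesis unfolding less.prems(2) by linarith
        qed
      next
        fix g assume "low_free X (2 * m div 3 + 1) g"
        then show "ip (Sym X) g (swap_sum X g) \<le> ?\<kappa> * ip (Sym X) g g"
          by (rule rec) presburger
      qed
    qed
  qed
qed

text \<open>Levels up to \<open>m / 3\<close> satisfy the bound through their own constants. Above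
  \<open>m / 3\<close> the deficit of order \<open>m (m - 1)\<close> is even larger, because
  \<open>k \<le> m\<close>.\<close>

lemma swap_sum_bound:
  assumes "finite X" "card X = m" "low_free X k f" "k \<le> m"
  shows "ip (Sym X) f (swap_sum X f) \<le> ((real m)\<^sup>2 - 4 / 9 * real k * (real m - 1)) * ip (Sym X) f f"
proof (cases "m = 0")
  case True
  then show ?thesis using assms swap_sum_bound_high[OF assms(1-3)] by simp
next
  case m: False
  have high: "ip (Sym X) g (swap_sum X g) \<le> ((real m)\<^sup>2 - 4 / 9 * real k * (real m - 1)) * ip (Sym X) g g"
    if "low_free X j g" "m \<le> 3 * j" for j g
  proof -
    have "real k * (real m - 1) \<le> real m * (real m - 1)"
      using assms(4) m by (intro mult_right_mono) auto
    then show ?thesis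
      by (intro order_trans[OF swap_sum_bound_high[OF assms(1,2) that]] mult_right_mono) auto
  qed
  show ?thesis
  proof (cases "m \<le> 3 * k")
    case True
    then show ?thesis using high assms(3) by blast
  next
    case k: False
    have "k \<le> m div 3 + 1" using k by linarith
    then show ?thesis
    proof (rule swap_sum_bound_descend_range[OF assms(1) _ assms(3)])
      fix j assume j: "k \<le> j" "j < m div 3 + 1"
      then have "3 * j \<le> m" by linarith
      then have "3 * real j \<le> real m" by linarith
      then have "real j * (2 * real m) \<le> real j * (3 * (real m - real j + 1))"
        by (intro mult_left_mono) auto
      then have 1: "3 * (real j * real j) \<le> real j * real m + 3 * real j"
        by (simp add: algebra_simps)
      have 2: "real k * (real m - 1) \<le> real j * real m"
        using j m by (intro mult_mono) auto
      have 3: "0 \<le> real j * real m" by simp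
      have "(real m - real j)\<^sup>2 + (real j)\<^sup>2 - 2 * real j
          = (real m)\<^sup>2 - 2 * (real j * real m) + 2 * (real j * real j) - 2 * real j"
        by (simp add: power2_eq_square algebra_simps)
      also have "\<dots> \<le> (real m)\<^sup>2 - 4 / 9 * (real k * (real m - 1))"
        using 1 2 3 by linarith
      finally show "(real (card X) - real j)\<^sup>2 + (real j)\<^sup>2 - 2 * real j
          \<le> (real m)\<^sup>2 - 4 / 9 * real k * (real m - 1)"
        unfolding assms(2) by (simp add: mult.assoc)
    next
      fix g assume "low_free X (m div 3 + 1) g"
      then show "ip (Sym X) g (swap_sum X g)
          \<le> ((real m)\<^sup>2 - 4 / 9 * real k * (real m - 1)) * ip (Sym X) g g"
        by (rule high) presburger
    qed
  qed
qed

section \<open>The sign twist and products of two transpositions\<close>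

abbreviation rsign :: "('a \<Rightarrow> 'a) \<Rightarrow> real" where
  "rsign p \<equiv> of_int (sign p)"

lemma rsign_comp:
  "finite X \<Longrightarrow> p permutes X \<Longrightarrow> q permutes X \<Longrightarrow> rsign (p \<circ> q) = rsign p * rsign q"
  using sign_compose[of p q] permutes_imp_permutation[of X] by simp

lemma rsign_sq [simp]: "rsign p * rsign p = 1"
  by (simp flip: of_int_mult)

lemma rsign_sq_left [simp]: "rsign p * (rsign p * c) = c"
  by (simp flip: mult.assoc)

definition off_diag :: "'a set \<Rightarrow> ('a \<times> 'a) set" where
  "off_diag X = {(i, j). i \<in> X \<and> j \<in> X \<and> i \<noteq> j}"

abbreviation swap_of :: "'a \<times> 'a \<Rightarrow> 'a \<Rightarrow> 'a" where
  "swap_of z \<equiv> transp (fst z) (snd z)"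

lemma off_diag_altdef: "off_diag X = X \<times> X - (\<lambda>i. (i, i)) ` X"
  by (auto simp: off_diag_def)

lemma card_off_diag:
  assumes "finite X"
  shows "real (card (off_diag X)) = real (card X) * (real (card X) - 1)"
proof -
  have "card (off_diag X) = card X * card X - card X"
    unfolding off_diag_altdef using assms
    by (subst card_Diff_subset) (auto simp: card_image inj_on_def card_cartesian_product)
  moreover have "card X \<le> card X * card X" by simp
  ultimately show ?thesis by (simp add: of_nat_diff algebra_simps)
qed

text \<open>The diagonal pairs are left out because they contribute a multiple of the identity; only
  without it does multiplication by the sign turn the operator into its negative.\<close>

definition transp_sum :: "'a set \<Rightarrow> (('a \<Rightarrow> 'a) \<Rightarrow> real) \<Rightarrow> ('a \<Rightarrow> 'a) \<Rightarrow> real" where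
  "transp_sum X f p = (\<Sum>z\<in>off_diag X. f (p \<circ> swap_of z))"

lemma transp_sum_eq:
  assumes "finite X"
  shows "transp_sum X f = (\<lambda>p. swap_sum X f p - real (card X) * f p)"
proof
  fix p
  have "swap_sum X f p = (\<Sum>z\<in>X \<times> X. f (p \<circ> swap_of z))"
    by (simp add: swap_sum_def sum.cartesian_product split_def)
  also have "\<dots> = transp_sum X f p + (\<Sum>z\<in>(\<lambda>i. (i, i)) ` X. f (p \<circ> swap_of z))"
    unfolding transp_sum_def off_diag_altdef
    by (rule sum.subset_diff) (use assms in auto)
  also have "(\<Sum>z\<in>(\<lambda>i. (i, i)) ` X. f (p \<circ> swap_of z)) = real (card X) * f p"
    by (subst sum.reindex) (auto simp: inj_on_def)
  finally show "transp_sum X f p = swap_sum X f p - real (card X) * f p" by simp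
qed

lemma low_free_cong: "(\<And>p. p permutes X \<Longrightarrow> f p = g p) \<Longrightarrow> low_free X k f \<longleftrightarrow> low_free X k g"
  unfolding low_free_def using ip_cong[of "Sym X" f g] by simp

definition twisted_low_free :: "'a set \<Rightarrow> nat \<Rightarrow> (('a \<Rightarrow> 'a) \<Rightarrow> real) \<Rightarrow> bool" where
  "twisted_low_free X k f \<longleftrightarrow> low_free X k f \<and> low_free X k (\<lambda>p. rsign p * f p)"

lemma twisted_low_free_add:
  "twisted_low_free X k f \<Longrightarrow> twisted_low_free X k g \<Longrightarrow> twisted_low_free X k (\<lambda>p. f p + s * g p)"
  unfolding twisted_low_free_def
  using low_free_add[of X k f g s]
    low_free_add[of X k "\<lambda>p. rsign p * f p" "\<lambda>p. rsign p * g p" s]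
  by (simp add: algebra_simps)

lemma twisted_low_free_right:
  assumes "finite X" "t permutes X" "twisted_low_free X k f"
  shows "twisted_low_free X k (\<lambda>p. f (p \<circ> t))"
proof -
  have "low_free X k (\<lambda>p. rsign t * (rsign (p \<circ> t) * f (p \<circ> t)))"
    using assms(3) unfolding twisted_low_free_def
    by (intro low_free_scale low_free_right[OF assms(2), of k "\<lambda>p. rsign p * f p"]) auto
  then have "low_free X k (\<lambda>p. rsign p * f (p \<circ> t))"
    by (rule low_free_cong[THEN iffD1, rotated])
      (simp add: rsign_comp[OF assms(1) _ assms(2)] mult_ac)
  then show ?thesis
    using assms low_free_right unfolding twisted_low_free_def by blast
qed

lemma rsign_transp_sum:
  assumes "finite X" "p permutes X"
  shows "transp_sum X (\<lambda>p. rsign p * f p) p = - (rsign p * transp_sum X f p)"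
proof -
  have "rsign (p \<circ> swap_of z) = - rsign p" if "z \<in> off_diag X" for z
    using that by (subst rsign_comp[OF assms]) (auto simp: off_diag_def sign_swap_id intro!: permutes_swap_id)
  then show ?thesis
    by (simp add: transp_sum_def sum_distrib_left sum_negf)
qed

text \<open>Twisting with the sign turns the upper bound for the transposition walk into a lower bound,
  so that two steps of this walk, which stay in the alternating group, still contract.\<close>

lemma transp_sum_norm_bound:
  assumes "finite X" "card X = m" "m \<ge> 2" "k \<le> m" "twisted_low_free X k f"
  defines "\<rho> \<equiv> real m * (real m - 1) - 4 / 9 * real k * (real m - 1)"
  shows "ip (Sym X) (transp_sum X f) (transp_sum X f) \<le> \<rho>\<^sup>2 * ip (Sym X) f f"
proof (rule selfadjoint_norm_bound[where U = "twisted_low_free X k"])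
  show "ip (Sym X) (transp_sum X g) h = ip (Sym X) g (transp_sum X h)" for g h
    by (simp add: transp_sum_eq[OF \<open>finite X\<close>] ip_linear swap_sum_adjoint)
  show "transp_sum X (\<lambda>x. g x + s * h x) = (\<lambda>x. transp_sum X g x + s * transp_sum X h x)" for g h s
    by (simp add: transp_sum_def sum.distrib sum_distrib_left fun_eq_iff)
  have low: "low_free X k (transp_sum X g)" if "low_free X k g" for g
    unfolding transp_sum_eq[OF \<open>finite X\<close>]
    using that by (intro low_free_diff low_free_swap_sum low_free_scale)
  show "twisted_low_free X k (transp_sum X g)" if g: "twisted_low_free X k g" for g
  proof -
    have "low_free X k (\<lambda>p. (-1) * transp_sum X (\<lambda>p. rsign p * g p) p)"
      using g by (intro low_free_scale low) (simp add: twisted_low_free_def)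
    then have "low_free X k (\<lambda>p. rsign p * transp_sum X g p)"
      by (rule low_free_cong[THEN iffD1, rotated]) (simp add: rsign_transp_sum[OF \<open>finite X\<close>])
    then show ?thesis using g low by (simp add: twisted_low_free_def)
  qed
  have "real k * (real m - 1) \<le> real m * (real m - 1)" "0 < real m * (real m - 1)"
    using assms(3,4) by (auto intro!: mult_right_mono)
  then show "\<rho> > 0" unfolding \<rho>_def mult.assoc by linarith
  have upper: "ip (Sym X) g (transp_sum X g) \<le> \<rho> * ip (Sym X) g g" if "low_free X k g" for g
    using swap_sum_bound[OF assms(1,2) that assms(4)]
    by (simp add: transp_sum_eq[OF \<open>finite X\<close>] ip_linear assms(2) \<rho>_def algebra_simps power2_eq_square)
  show "\<bar>ip (Sym X) g (transp_sum X g)\<bar> \<le> \<rho> * ip (Sym X) g g" if g: "twisted_low_free X k g" for g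
  proof -
    have "ip (Sym X) (\<lambda>p. rsign p * g p) (transp_sum X (\<lambda>p. rsign p * g p))
        = ip (Sym X) (\<lambda>p. rsign p * g p) (\<lambda>p. - (rsign p * transp_sum X g p))"
      by (intro ip_cong) (simp_all add: rsign_transp_sum[OF \<open>finite X\<close>])
    also have "\<dots> = - ip (Sym X) g (transp_sum X g)"
      by (simp add: ip_def sum_negf mult_ac)
    finally have 1: "ip (Sym X) (\<lambda>p. rsign p * g p) (transp_sum X (\<lambda>p. rsign p * g p))
        = - ip (Sym X) g (transp_sum X g)" .
    have 2: "ip (Sym X) (\<lambda>p. rsign p * g p) (\<lambda>p. rsign p * g p) = ip (Sym X) g g"
      by (simp add: ip_def mult_ac)
    show ?thesis
      using upper[of g] upper[of "\<lambda>p. rsign p * g p"] g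
      unfolding 1 2 twisted_low_free_def by auto
  qed
qed (use assms twisted_low_free_add in auto)

text \<open>The right side is twice \<open>M^2 F\<close> minus twice the squared norm of
  \<open>transp_sum X f\<close>. With the norm bound \<open>M - \<gamma>\<close> the difference is
  \<open>2 \<gamma> (2 M - \<gamma>) F\<close>, and \<open>\<gamma> \<le> M\<close> leaves
  \<open>2 \<gamma> M F\<close>.\<close>

lemma double_swap_bound:
  assumes "finite X" "card X = m" "m \<ge> 2" "k \<le> m" "twisted_low_free X k f"
  shows "8 / 9 * real k * real m * (real m - 1)\<^sup>2 * ip (Sym X) f f \<le>
    (\<Sum>y\<in>off_diag X. \<Sum>z\<in>off_diag X. \<Sum>p\<in>Sym X. (f p - f (p \<circ> swap_of y \<circ> swap_of z))\<^sup>2)"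
proof -
  define M where "M = real m * (real m - 1)"
  define \<gamma> where "\<gamma> = 4 / 9 * real k * (real m - 1)"
  define F where "F = ip (Sym X) f f"
  have M: "real (card (off_diag X)) = M"
    unfolding M_def card_off_diag[OF assms(1)] assms(2) ..
  have adj: "ip (Sym X) (transp_sum X g) h = ip (Sym X) g (transp_sum X h)" for g h
    by (simp add: transp_sum_eq[OF \<open>finite X\<close>] ip_linear swap_sum_adjoint)
  have "(\<Sum>p\<in>Sym X. (f p - f (p \<circ> swap_of y \<circ> swap_of z))\<^sup>2)
      = 2 * F - 2 * ip (Sym X) f (\<lambda>p. f (p \<circ> swap_of y \<circ> swap_of z))"
    if "y \<in> off_diag X" "z \<in> off_diag X" for y z
  proof -
    have "swap_of y \<circ> swap_of z permutes X"
      using that by (intro permutes_compose permutes_swap_id) (auto simp: off_diag_def)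
    from ip_Sym_right[OF this, of f f]
    have "ip (Sym X) (\<lambda>p. f (p \<circ> swap_of y \<circ> swap_of z)) (\<lambda>p. f (p \<circ> swap_of y \<circ> swap_of z)) = F"
      by (simp add: F_def comp_assoc)
    then show ?thesis unfolding ip_self_diff by (simp add: F_def)
  qed
  then have "(\<Sum>y\<in>off_diag X. \<Sum>z\<in>off_diag X. \<Sum>p\<in>Sym X. (f p - f (p \<circ> swap_of y \<circ> swap_of z))\<^sup>2)
      = (\<Sum>y\<in>off_diag X. \<Sum>z\<in>off_diag X. 2 * F - 2 * ip (Sym X) f (\<lambda>p. f (p \<circ> swap_of y \<circ> swap_of z)))"
    by (simp cong: sum.cong)
  also have "\<dots> = 2 * M\<^sup>2 * F - 2 * ip (Sym X) f (transp_sum X (transp_sum X f))"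
    by (simp add: sum_subtractf M power2_eq_square transp_sum_def[abs_def] ip_sum_right sum_distrib_left)
  also have "ip (Sym X) f (transp_sum X (transp_sum X f)) = ip (Sym X) (transp_sum X f) (transp_sum X f)"
    by (simp add: adj)
  also have "2 * M\<^sup>2 * F - 2 * ip (Sym X) (transp_sum X f) (transp_sum X f) \<ge> 2 * M\<^sup>2 * F - 2 * ((M - \<gamma>)\<^sup>2 * F)"
    using transp_sum_norm_bound[OF assms] by (simp add: M_def \<gamma>_def F_def)
  finally have 1: "2 * M\<^sup>2 * F - 2 * ((M - \<gamma>)\<^sup>2 * F) \<le>
    (\<Sum>y\<in>off_diag X. \<Sum>z\<in>off_diag X. \<Sum>p\<in>Sym X. (f p - f (p \<circ> swap_of y \<circ> swap_of z))\<^sup>2)" .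
  have "4 / 9 * (real k * (real m - 1)) \<le> 1 * (real m * (real m - 1))"
    using assms(3,4) by (intro mult_mono) auto
  then have "\<gamma> \<le> M" by (simp add: \<gamma>_def M_def)
  moreover have "0 \<le> \<gamma>" "0 \<le> F" using assms(3) by (auto simp: \<gamma>_def F_def)
  ultimately have "2 * \<gamma> * M * F \<le> 2 * \<gamma> * (2 * M - \<gamma>) * F"
    by (intro mult_right_mono mult_left_mono) auto
  also have "\<dots> = 2 * M\<^sup>2 * F - 2 * ((M - \<gamma>)\<^sup>2 * F)"
    by (simp add: power2_eq_square algebra_simps)
  finally show ?thesis using 1 by (simp add: M_def \<gamma>_def F_def power2_eq_square mult_ac)
qed

text \<open>The trace argument gives the norm bound at one unknown permutation \<open>q0\<close>.
  Left translation by \<open>q0 \<circ> inv q\<close> moves it to \<open>q\<close>: it maps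
  indicators to indicators with the same positions and changes the sign only by a constant. The
  Boolean index adds the twisted indicators, hence the factor 2.\<close>

lemma delta_projection_cells:
  fixes X :: "'a set"
  assumes "finite X" "q permutes X"
  shows "\<exists>d. (\<forall>a b. (a, b) \<in> cells X (Suc k) \<longrightarrow> ip (Sym X) d (agree a b) = agree a b q \<and>
      ip (Sym X) (\<lambda>p. rsign p * d p) (agree a b) = rsign q * agree a b q) \<and>
    ip (Sym X) d d \<le> 2 * (real (card X) + 1) ^ (2 * k) / fact (card X)"
proof -
  define I where "I = cells X (Suc k) \<times> (UNIV :: bool set)"
  define e :: "('a list \<times> 'a list) \<times> bool \<Rightarrow> ('a \<Rightarrow> 'a) \<Rightarrow> real"
    where "e = (\<lambda>((a, b), \<tau>) p. agree a b p * (if \<tau> then rsign p else 1))"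
  have fin: "finite (Sym X)" "finite I"
    using assms(1) by (auto simp: I_def finite_permutations finite_cells)
  have ne: "Sym X \<noteq> {}" using assms(2) by auto
  obtain q0 d0 where q0: "q0 permutes X" and d0: "\<And>i. i \<in> I \<Longrightarrow> ip (Sym X) d0 (e i) = e i q0"
    and norm: "ip (Sym X) d0 d0 \<le> card I / card (Sym X)"
    using delta_projection[OF fin(1) ne fin(2), of e] by auto
  define g where "g = q0 \<circ> inv q"
  define d where "d p = d0 (g \<circ> p)" for p
  have g: "g permutes X" unfolding g_def using assms(2) q0 by (intro permutes_compose permutes_inv)
  have gq: "g \<circ> q = q0" by (simp add: g_def comp_assoc permutes_inv_o(2)[OF assms(2)])
  have sign_gq: "rsign q0 = rsign g * rsign q"
    using rsign_comp[OF assms(1) g assms(2)] gq by simp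
  have cell_g: "(a, map g b) \<in> cells X (Suc k)" if "(a, b) \<in> cells X (Suc k)" for a b
    using that permutes_in_image[OF g] permutes_inj_on[OF g] by (auto simp: cells_def distinct_map)
  have shift: "agree a (map g b) (g \<circ> p) = agree a b p" for a b p
    using inj_map_eq_map[OF permutes_inj[OF g]] by (auto simp: agree_def simp flip: map_map)
  have "ip (Sym X) d (agree a b) = agree a b q \<and>
      ip (Sym X) (\<lambda>p. rsign p * d p) (agree a b) = rsign q * agree a b q"
    if ab: "(a, b) \<in> cells X (Suc k)" for a b
  proof
    have I: "((a, map g b), \<tau>) \<in> I" for \<tau> using cell_g[OF ab] by (simp add: I_def)
    have "ip (Sym X) d (agree a b) = ip (Sym X) (\<lambda>p. d0 (g \<circ> p)) (\<lambda>p. agree a (map g b) (g \<circ> p))"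
      by (simp add: shift d_def[abs_def] cong: ip_cong)
    also have "\<dots> = ip (Sym X) d0 (agree a (map g b))" by (rule ip_Sym_left[OF g])
    also have "\<dots> = agree a (map g b) (g \<circ> q)" using d0[OF I[of False]] by (simp add: e_def gq)
    finally show "ip (Sym X) d (agree a b) = agree a b q" by (simp only: shift)
    have "ip (Sym X) (\<lambda>p. rsign p * d p) (agree a b) =
        ip (Sym X) (\<lambda>p. rsign g * (rsign (g \<circ> p) * d0 (g \<circ> p))) (\<lambda>p. agree a (map g b) (g \<circ> p))"
      by (intro ip_cong) (simp_all add: shift d_def rsign_comp[OF assms(1) g] mult.assoc)
    also have "\<dots> = rsign g * ip (Sym X) (\<lambda>p. rsign p * d0 p) (agree a (map g b))"
      unfolding ip_scale_left ip_Sym_left[OF g, of "\<lambda>p. rsign p * d0 p"] ..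
    also have "ip (Sym X) (\<lambda>p. rsign p * d0 p) (agree a (map g b)) =
        ip (Sym X) d0 (e ((a, map g b), True))"
      by (simp add: ip_def e_def mult_ac)
    also have "\<dots> = agree a (map g b) (g \<circ> q) * rsign q0"
      using d0[OF I[of True]] by (simp add: e_def gq)
    finally show "ip (Sym X) (\<lambda>p. rsign p * d p) (agree a b) = rsign q * agree a b q"
      by (simp only: shift) (simp add: sign_gq mult_ac)
  qed
  moreover have "ip (Sym X) d d \<le> 2 * (real (card X) + 1) ^ (2 * k) / fact (card X)"
  proof -
    have "ip (Sym X) d d = ip (Sym X) d0 d0"
      unfolding d_def[abs_def] by (rule ip_Sym_left[OF g])
    also have "\<dots> \<le> card I / card (Sym X)" by (rule norm)
    also have "real (card (Sym X)) = fact (card X)"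
      using card_permutations[OF refl assms(1)] by simp
    also have "real (card I) \<le> 2 * (real (card X) + 1) ^ (2 * k)"
    proof -
      have "card I = 2 * card (cells X (Suc k))" by (simp add: I_def card_cartesian_product)
      also have "\<dots> \<le> 2 * (card X + 1) ^ (2 * k)" using cells_bound(2)[OF assms(1), of k] by simp
      finally have "real (card I) \<le> real (2 * (card X + 1) ^ (2 * k))" by (rule of_nat_mono)
      then show ?thesis by (simp add: add.commute)
    qed
    finally show ?thesis by (simp add: divide_right_mono)
  qed
  ultimately show ?thesis by blast
qed

section \<open>Words of the puzzle\<close>

definition wrap :: "nat \<Rightarrow> square \<Rightarrow> square" where
  "wrap n u = (fst u mod int n, snd u mod int n)"

lemma wrap_simps [simp]:
  "wrap n (wrap n u + v) = wrap n (u + v)" "wrap n (u + wrap n v) = wrap n (u + v)"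
  "wrap n (wrap n u - v) = wrap n (u - v)" "wrap n (u - wrap n v) = wrap n (u - v)"
  "wrap n (wrap n u) = wrap n u" "wrap n 0 = 0" "wrap n (- wrap n u) = wrap n (- u)"
  by (simp_all add: wrap_def mod_simps prod_eq_iff)

lemma wrap_in_board [simp]: "n > 0 \<Longrightarrow> wrap n u \<in> board n"
  by (simp add: wrap_def board_def)

lemma wrap_board [simp]: "u \<in> board n \<Longrightarrow> wrap n u = u"
  by (auto simp: wrap_def board_def)

lemma wrap_cancel: "wrap n (u + v) = wrap n (w + v) \<longleftrightarrow> wrap n u = wrap n w"
proof
  assume "wrap n (u + v) = wrap n (w + v)"
  then have "wrap n (wrap n (u + v) - v) = wrap n (wrap n (w + v) - v)" by simp
  then show "wrap n u = wrap n w" by simp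
next
  assume "wrap n u = wrap n w"
  then have "wrap n (wrap n u + v) = wrap n (wrap n w + v)" by simp
  then show "wrap n (u + v) = wrap n (w + v)" by simp
qed

lemma wrap_diff_eq_0: "wrap n (u - v) = 0 \<longleftrightarrow> wrap n u = wrap n v"
  using wrap_cancel[of n "u - v" v 0] by simp

definition pieces :: "nat \<Rightarrow> square set" where
  "pieces n = board n - {0}"

lemma finite_board [simp]: "finite (board n)"
  by (simp add: board_def)

lemma finite_pieces [simp]: "finite (pieces n)"
  by (simp add: pieces_def)

lemma card_board: "card (board n) = n * n"
  by (simp add: board_def card_cartesian_product)

lemma card_pieces: "n > 0 \<Longrightarrow> card (pieces n) = n * n - 1"
  by (simp add: pieces_def card_Diff_subset card_board) (simp add: board_def zero_prod_def card_board)

text \<open>Positions are taken relative to the empty square. When the empty square moves by \<open>v\<close>,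
  the piece now at relative position \<open>u\<close> was at relative position \<open>slide n v u\<close> before.\<close>

definition slide :: "nat \<Rightarrow> square \<Rightarrow> square \<Rightarrow> square" where
  "slide n v u = (if u \<in> pieces n then (if wrap n (u + v) = 0 then wrap n v else wrap n (u + v)) else u)"

lemma slide_in_pieces:
  assumes "n > 0" "u \<in> pieces n"
  shows "slide n v u \<in> pieces n"
proof -
  have "wrap n v \<noteq> 0" if "wrap n (u + v) = 0"
  proof
    assume "wrap n v = 0"
    then have "wrap n (u + wrap n v) = u" using assms by (simp add: pieces_def del: wrap_simps)
    then show False using that assms by (simp add: pieces_def)
  qed
  then show ?thesis using assms by (simp add: slide_def pieces_def)
qed

lemma slide_inverse:
  assumes "n > 0"
  shows "slide n (- v) (slide n v u) = u"
proof (cases "u \<in> pieces n")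
  case True
  then have u: "u \<in> board n" "u \<noteq> 0" by (auto simp: pieces_def)
  show ?thesis
  proof (cases "wrap n (u + v) = 0")
    case 0: True
    have "wrap n (wrap n (u + v) - v) = wrap n (- v)" unfolding 0 by simp
    then have "wrap n (- v) = u" using u by simp
    then show ?thesis
      using 0 True slide_in_pieces[OF assms True, of v] by (simp add: slide_def)
  next
    case False
    then show ?thesis
      using True u slide_in_pieces[OF assms True, of v] by (simp add: slide_def)
  qed
qed (simp add: slide_def)

lemma slide_permutes: "n > 0 \<Longrightarrow> slide n v permutes pieces n"
  using slide_inverse[of n v] slide_inverse[of n "- v"] slide_in_pieces[of n]
  by (intro bij_imp_permutes bij_betw_byWitness[where f' = "slide n (- v)"])
    (simp_all add: image_subset_iff, simp add: slide_def)

lemma slide_compose_inverse: "n > 0 \<Longrightarrow> slide n v \<circ> slide n (- v) = id"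
  using slide_inverse[of n "- v"] by (simp add: fun_eq_iff)

lemma slide_zero: "slide n 0 = id"
  by (auto simp: slide_def pieces_def fun_eq_iff)

section \<open>Words in the moves\<close>

definition word_perm :: "nat \<Rightarrow> square list \<Rightarrow> square \<Rightarrow> square" where
  "word_perm n ws = foldr (\<lambda>v q. slide n v \<circ> q) ws id"

lemma word_perm_simps [simp]:
  "word_perm n [] = id" "word_perm n (v # ws) = slide n v \<circ> word_perm n ws"
  by (simp_all add: word_perm_def)

lemma word_perm_append: "word_perm n (ws @ vs) = word_perm n ws \<circ> word_perm n vs"
  by (induction ws) (simp_all add: comp_assoc)

lemma word_perm_permutes: "n > 0 \<Longrightarrow> word_perm n ws permutes pieces n"
  by (induction ws) (auto intro!: permutes_compose slide_permutes)

lemma word_perm_inverse: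
  "n > 0 \<Longrightarrow> word_perm n ws \<circ> word_perm n (rev (map uminus ws)) = id"
proof (induction ws)
  case (Cons v ws)
  have "word_perm n (v # ws) \<circ> word_perm n (rev (map uminus (v # ws)))
      = slide n v \<circ> (word_perm n ws \<circ> word_perm n (rev (map uminus ws))) \<circ> slide n (- v)"
    by (simp add: word_perm_append comp_assoc)
  also have "\<dots> = id"
    unfolding Cons.IH[OF Cons.prems] by (simp add: slide_compose_inverse[OF Cons.prems])
  finally show ?case .
qed simp

lemma word_perm_rev_uminus:
  assumes "n > 0"
  shows "word_perm n (rev (map uminus ws)) = inv (word_perm n ws)"
  using word_perm_inverse[OF assms, of ws] permutes_inv_o(2)[OF word_perm_permutes[OF assms, of ws]]
  by (metis comp_assoc id_comp comp_id)

lemma uminus_moves: "v \<in> moves \<Longrightarrow> - v \<in> moves"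
  by (auto simp: moves_def)

lemma set_rev_uminus_moves: "set ws \<subseteq> moves \<Longrightarrow> set (rev (map uminus ws)) \<subseteq> moves"
  using uminus_moves by auto

lemma sum_list_rev_uminus: "sum_list (rev (map uminus ws)) = - sum_list (ws :: square list)"
  by (induction ws) simp_all

text \<open>The condition on the sum returns the empty square to its place, so that the word acts on
  the permutation alone.\<close>

definition has_word :: "nat \<Rightarrow> (square \<Rightarrow> square) \<Rightarrow> nat \<Rightarrow> bool" where
  "has_word n p L \<longleftrightarrow> (\<exists>ws. set ws \<subseteq> moves \<and> length ws \<le> L \<and> wrap n (sum_list ws) = 0 \<and> word_perm n ws = p)"

lemma has_word_mono: "has_word n p L \<Longrightarrow> L \<le> M \<Longrightarrow> has_word n p M"
  unfolding has_word_def using order_trans by blast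

lemma has_word_id: "has_word n id L"
  unfolding has_word_def by (rule exI[of _ "[]"]) simp

lemma has_word_comp:
  assumes "has_word n p L" "has_word n q M"
  shows "has_word n (p \<circ> q) (L + M)"
proof -
  obtain ws vs where *: "set ws \<subseteq> moves" "length ws \<le> L" "wrap n (sum_list ws) = 0" "word_perm n ws = p"
    "set vs \<subseteq> moves" "length vs \<le> M" "wrap n (sum_list vs) = 0" "word_perm n vs = q"
    using assms unfolding has_word_def by blast
  have "wrap n (sum_list ws + sum_list vs) = wrap n (wrap n (sum_list ws) + wrap n (sum_list vs))" by simp
  also have "\<dots> = 0" unfolding *(3,7) by simp
  finally show ?thesis
    unfolding has_word_def using * by (intro exI[of _ "ws @ vs"]) (auto simp: word_perm_append)
qed

text \<open>The conjugating word may displace the empty square, since its inverse undoes the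
  displacement.\<close>

lemma has_word_conj:
  assumes "n > 0" "has_word n p L" "set ws \<subseteq> moves"
  shows "has_word n (word_perm n ws \<circ> p \<circ> inv (word_perm n ws)) (L + 2 * length ws)"
proof -
  obtain vs where *: "set vs \<subseteq> moves" "length vs \<le> L" "wrap n (sum_list vs) = 0" "word_perm n vs = p"
    using assms unfolding has_word_def by blast
  let ?us = "ws @ vs @ rev (map uminus ws)"
  have "set ?us \<subseteq> moves" using set_rev_uminus_moves[OF assms(3)] assms(3) * by simp
  moreover have "wrap n (sum_list ?us) = 0"
    by (simp only: sum_list_append sum_list_rev_uminus) (simp add: *)
  moreover have "word_perm n ?us = word_perm n ws \<circ> p \<circ> inv (word_perm n ws)"
    by (simp only: word_perm_append word_perm_rev_uminus[OF assms(1)] * comp_assoc)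
  ultimately show ?thesis
    unfolding has_word_def using *(2) by (intro exI[of _ ?us]) auto
qed

lemma has_word_inv:
  assumes "n > 0" "has_word n p L"
  shows "has_word n (inv p) L"
proof -
  obtain vs where *: "set vs \<subseteq> moves" "length vs \<le> L" "wrap n (sum_list vs) = 0" "word_perm n vs = p"
    using assms unfolding has_word_def by blast
  have "wrap n (- wrap n (sum_list vs)) = 0" unfolding * by simp
  then have "wrap n (- sum_list vs) = 0" by simp
  then show ?thesis
    unfolding has_word_def
    using * set_rev_uminus_moves[OF *(1)] word_perm_rev_uminus[OF assms(1), of vs]
    by (intro exI[of _ "rev (map uminus vs)"], simp only: sum_list_rev_uminus) simp
qed

lemma has_word_transpose_comm:
  assumes "n > 0" "has_word n (transp a b \<circ> transp c d) L"
  shows "has_word n (transp c d \<circ> transp a b) L"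
  using has_word_inv[OF assms] by (simp add: o_inv_distrib)

section \<open>Explicit three-cycles and carrying words\<close>

lemma slide_right:
  "0 \<le> a \<Longrightarrow> a < int n \<Longrightarrow> 0 \<le> b \<Longrightarrow> b < int n \<Longrightarrow> a \<noteq> 0 \<or> b \<noteq> 0 \<Longrightarrow> n \<ge> 2 \<Longrightarrow>
    slide n (0, 1) (a, b) = (if b = int n - 1 then if a = 0 then (0, 1) else (a, 0) else (a, b + 1))"
  by (auto simp: slide_def pieces_def board_def wrap_def zero_prod_def)

lemma slide_left:
  "0 \<le> a \<Longrightarrow> a < int n \<Longrightarrow> 0 \<le> b \<Longrightarrow> b < int n \<Longrightarrow> a \<noteq> 0 \<or> b \<noteq> 0 \<Longrightarrow> n \<ge> 2 \<Longrightarrow>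
    slide n (0, -1) (a, b) = (if b = 0 then (a, int n - 1) else if a = 0 \<and> b = 1 then (0, int n - 1) else (a, b - 1))"
  by (auto simp: slide_def pieces_def board_def wrap_def zero_prod_def zmod_minus1)

lemma slide_down:
  "0 \<le> a \<Longrightarrow> a < int n \<Longrightarrow> 0 \<le> b \<Longrightarrow> b < int n \<Longrightarrow> a \<noteq> 0 \<or> b \<noteq> 0 \<Longrightarrow> n \<ge> 2 \<Longrightarrow>
    slide n (1, 0) (a, b) = (if a = int n - 1 then if b = 0 then (1, 0) else (0, b) else (a + 1, b))"
  by (auto simp: slide_def pieces_def board_def wrap_def zero_prod_def)

lemma slide_up:
  "0 \<le> a \<Longrightarrow> a < int n \<Longrightarrow> 0 \<le> b \<Longrightarrow> b < int n \<Longrightarrow> a \<noteq> 0 \<or> b \<noteq> 0 \<Longrightarrow> n \<ge> 2 \<Longrightarrow>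
    slide n (-1, 0) (a, b) = (if a = 0 then (int n - 1, b) else if b = 0 \<and> a = 1 then (int n - 1, 0) else (a - 1, b))"
  by (auto simp: slide_def pieces_def board_def wrap_def zero_prod_def zmod_minus1)

lemmas slide_dirs = slide_right slide_left slide_down slide_up

text \<open>The square \<open>(0, 1)\<close> is a hub: for distinct \<open>y\<close>,
  \<open>z\<close> other than the hub, \<open>star y \<circ> star z\<close> is a 3-cycle through it,
  and the carrying words keep it fixed.\<close>

definition star :: "square \<Rightarrow> square \<Rightarrow> square" where
  "star y = transp (0, 1) y"

lemma star_involutive [simp]: "star y (star y u) = u" "star y \<circ> star y = id"
  by (simp_all add: star_def fun_eq_iff)

text \<open>Moving the empty square around a \<open>2 \<times> 2\<close> block is a 3-cycle.\<close>

lemma has_word_block: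
  assumes "n \<ge> 4"
  shows "has_word n (star (1, 0) \<circ> star (1, 1)) 4"
proof -
  let ?ws = "[(0, 1), (1, 0), (0, -1), (-1, 0)] :: square list"
  have "word_perm n ?ws u = (star (1, 0) \<circ> star (1, 1)) u" for u
  proof (cases "u \<in> pieces n")
    case True
    then obtain a b where u: "u = (a, b)" "0 \<le> a" "a < int n" "0 \<le> b" "b < int n" "a \<noteq> 0 \<or> b \<noteq> 0"
      by (cases u) (auto simp: pieces_def board_def zero_prod_def)
    then show ?thesis
      using assms by (auto simp: slide_dirs star_def Transposition.transpose_def)
  next
    case False
    have "word_perm n ?ws permutes pieces n" using assms by (intro word_perm_permutes) auto
    moreover have "star (1, 0) \<circ> star (1, 1) permutes pieces n"
      unfolding star_def using assms
      by (intro permutes_compose permutes_swap_id) (auto simp: pieces_def board_def zero_prod_def)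
    ultimately show ?thesis using False by (metis permutes_not_in)
  qed
  then have "word_perm n ?ws = star (1, 0) \<circ> star (1, 1)" by blast
  then show ?thesis
    unfolding has_word_def using assms
    by (intro exI[of _ ?ws]) (auto simp: moves_def wrap_def zero_prod_def)
qed

text \<open>Words that carry the piece to the right of the empty square along with it, by one square to
  the left or down.\<close>

definition carry_left :: "square list" where
  "carry_left = [(0, 1), (1, 0), (0, -1), (0, -1), (-1, 0)]"

definition carry_down :: "square list" where
  "carry_down = [(1, 0), (0, 1), (-1, 0), (0, -1), (1, 0)]"

lemma carry_moves: "set carry_left \<subseteq> moves" "set carry_down \<subseteq> moves"
  by (auto simp: carry_left_def carry_down_def moves_def)

lemma carry_left_perm:
  assumes "n \<ge> 4"
  shows "word_perm n carry_left (0, 1) = (0, 1)"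
    "word_perm n carry_left (1, 0) = (0, int n - 1)"
    "word_perm n carry_left (1, 1) = (1, int n - 1)"
    "2 \<le> b \<Longrightarrow> b \<le> int n - 2 \<Longrightarrow> word_perm n carry_left (0, b + 1) = (0, b)"
    "2 \<le> b \<Longrightarrow> b \<le> int n - 2 \<Longrightarrow> word_perm n carry_left (1, b + 1) = (1, b)"
  using assms by (auto simp: carry_left_def slide_dirs)

lemma carry_down_perm:
  assumes "n \<ge> 4"
  shows "word_perm n carry_down (0, 1) = (0, 1)"
    "1 \<le> a \<Longrightarrow> a \<le> int n - 2 \<Longrightarrow> 0 \<le> b \<Longrightarrow> b < int n \<Longrightarrow> word_perm n carry_down (a, b) = (a + 1, b)"
  using assms by (auto simp: carry_down_def slide_dirs)

text \<open>The points \<open>(1, 0)\<close> and \<open>(1, 1)\<close> belong to the block 3-cycle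
  that will be conjugated. One carry takes both around the torus into the last column, and each
  further carry moves them back by one column.\<close>

lemma carry_word_row:
  assumes "n \<ge> 4" "d \<le> n - 3"
  shows "\<exists>ws. set ws \<subseteq> moves \<and> length ws = 5 * (d + 1) \<and> word_perm n ws (0, 1) = (0, 1) \<and>
    word_perm n ws (1, 0) = (0, int n - 1 - int d) \<and> word_perm n ws (1, 1) = (1, int n - 1 - int d)"
  using assms(2)
proof (induction d)
  case 0
  show ?case
    using carry_left_perm[OF assms(1)] carry_moves
    by (intro exI[of _ carry_left]) (auto simp: carry_left_def)
next
  case (Suc d)
  then obtain ws where ws: "set ws \<subseteq> moves" "length ws = 5 * (d + 1)" "word_perm n ws (0, 1) = (0, 1)"
    "word_perm n ws (1, 0) = (0, int n - 1 - int d)" "word_perm n ws (1, 1) = (1, int n - 1 - int d)"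
    by auto
  have "2 \<le> int n - 1 - int (Suc d)" "int n - 1 - int (Suc d) \<le> int n - 2"
    using Suc.prems assms(1) by auto
  note step = carry_left_perm(4)[OF assms(1), OF this] carry_left_perm(5)[OF assms(1), OF this]
    carry_left_perm(1)[OF assms(1)]
  have "int n - 1 - int d = int n - 1 - int (Suc d) + 1" by simp
  then show ?case
    using ws carry_moves step
    by (intro exI[of _ "carry_left @ ws"])
      (simp only: word_perm_append o_apply set_append Un_subset_iff length_append, simp add: carry_left_def)
qed

lemma carry_word_row01:
  assumes "n \<ge> 4" "0 \<le> b" "b < int n" "a = 1 \<or> a = 0 \<and> b \<ge> 2"
  shows "\<exists>ws. set ws \<subseteq> moves \<and> length ws \<le> 5 * n \<and> word_perm n ws (0, 1) = (0, 1) \<and>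
    (word_perm n ws (1, 0) = (a, b) \<or> word_perm n ws (1, 1) = (a, b))"
proof (cases "b \<ge> 2")
  case True
  define d where "d = nat (int n - 1 - b)"
  have d: "d \<le> n - 3" "int n - 1 - int d = b" using True assms by (auto simp: d_def)
  from carry_word_row[OF assms(1) d(1)] obtain ws where
    "set ws \<subseteq> moves" "length ws = 5 * (d + 1)" "word_perm n ws (0, 1) = (0, 1)"
    "word_perm n ws (1, 0) = (0, b)" "word_perm n ws (1, 1) = (1, b)"
    unfolding d(2) by blast
  then show ?thesis using assms d(1) by (intro exI[of _ ws]) auto
next
  case False
  then have "a = 1" "b = 0 \<or> b = 1" using assms by auto
  then show ?thesis by (intro exI[of _ "[]"]) auto
qed

text \<open>The column is adjusted first in the top rows, then each downward carry adds one row.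
  Only one of the two block points is steered to the target, hence the disjunction.\<close>

lemma carry_word_down:
  assumes "n \<ge> 4" "0 \<le> b" "b < int n" "d \<le> n - 2"
  shows "\<exists>ws. set ws \<subseteq> moves \<and> length ws \<le> 5 * n + 5 * d \<and> word_perm n ws (0, 1) = (0, 1) \<and>
    (word_perm n ws (1, 0) = (1 + int d, b) \<or> word_perm n ws (1, 1) = (1 + int d, b))"
  using assms(4)
proof (induction d)
  case 0
  then show ?case using carry_word_row01[OF assms(1-3), of 1] by auto
next
  case (Suc d)
  then obtain ws where ws: "set ws \<subseteq> moves" "length ws \<le> 5 * n + 5 * d" "word_perm n ws (0, 1) = (0, 1)"
    "word_perm n ws (1, 0) = (1 + int d, b) \<or> word_perm n ws (1, 1) = (1 + int d, b)" by auto
  have "word_perm n carry_down (1 + int d, b) = (1 + int (Suc d), b)"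
    using carry_down_perm(2)[OF assms(1), of "1 + int d" b] Suc.prems assms by auto
  then show ?case
    using ws carry_moves carry_down_perm(1)[OF assms(1)]
    by (intro exI[of _ "carry_down @ ws"])
      (auto simp: word_perm_append carry_down_def)
qed

lemma carry_word:
  assumes "n \<ge> 4" "y \<in> pieces n - {(0, 1)}"
  shows "\<exists>ws. set ws \<subseteq> moves \<and> length ws \<le> 10 * n \<and> word_perm n ws (0, 1) = (0, 1) \<and>
    (word_perm n ws (1, 0) = y \<or> word_perm n ws (1, 1) = y)"
proof -
  obtain a b where y: "y = (a, b)" "0 \<le> a" "a < int n" "0 \<le> b" "b < int n" "a \<noteq> 0 \<or> b \<ge> 2"
    using assms(2) by (cases y) (auto simp: pieces_def board_def zero_prod_def)
  show ?thesis
  proof (cases "a = 0")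
    case True
    then show ?thesis using carry_word_row01[OF assms(1) y(4,5), of a] y by fastforce
  next
    case False
    define d where "d = nat (a - 1)"
    have d: "d \<le> n - 2" "1 + int d = a" using y False by (auto simp: d_def)
    from carry_word_down[OF assms(1) y(4,5) d(1)] obtain ws where
      "set ws \<subseteq> moves" "length ws \<le> 5 * n + 5 * d" "word_perm n ws (0, 1) = (0, 1)"
      "word_perm n ws (1, 0) = y \<or> word_perm n ws (1, 1) = y"
      unfolding d(2) y(1) by blast
    then show ?thesis using d(1) by (intro exI[of _ ws]) auto
  qed
qed

section \<open>Short words for products of two transpositions\<close>

lemma transpose_conj:
  assumes "bij w"
  shows "w \<circ> transp a b \<circ> inv w = transp (w a) (w b)"
proof
  fix u
  obtain x where x: "u = w x" using assms by (meson bij_pointE)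
  show "(w \<circ> transp a b \<circ> inv w) u = transp (w a) (w b) u"
    using bij_is_inj[OF assms] by (auto simp: x Transposition.transpose_def inj_eq)
qed

text \<open>Conjugating the block 3-cycle by a carrying word gives a 3-cycle through the hub and
  \<open>y\<close>. Its third point is wherever the other block point lands, so it is only asserted
  to exist. The length is at most \<open>4 + 2 * (10 * n)\<close>.\<close>

lemma has_word_partner:
  assumes "n \<ge> 4" "y \<in> pieces n - {(0, 1)}"
  shows "\<exists>y'\<in>pieces n - {(0, 1), y}. has_word n (star y \<circ> star y') (24 * n)"
proof -
  have n: "n > 0" using assms by simp
  obtain ws where ws: "set ws \<subseteq> moves" "length ws \<le> 10 * n" "word_perm n ws (0, 1) = (0, 1)"
    "word_perm n ws (1, 0) = y \<or> word_perm n ws (1, 1) = y"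
    using carry_word[OF assms] by blast
  let ?w = "word_perm n ws"
  have perm: "?w permutes pieces n" using n by (rule word_perm_permutes)
  have bij: "bij ?w" using perm by (rule permutes_bij)
  have "?w \<circ> (star (1, 0) \<circ> star (1, 1)) \<circ> inv ?w =
      (?w \<circ> star (1, 0) \<circ> inv ?w) \<circ> (?w \<circ> star (1, 1) \<circ> inv ?w)"
    using bij_is_inj[OF bij] by (simp add: fun_eq_iff)
  also have "\<dots> = star (?w (1, 0)) \<circ> star (?w (1, 1))"
    unfolding star_def transpose_conj[OF bij] ws(3) ..
  finally have "has_word n (star (?w (1, 0)) \<circ> star (?w (1, 1))) (4 + 2 * length ws)"
    using has_word_conj[OF n has_word_block[OF assms(1)] ws(1)] by simp
  then have 1: "has_word n (star (?w (1, 0)) \<circ> star (?w (1, 1))) (24 * n)"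
    by (rule has_word_mono) (use ws(2) assms(1) in linarith)
  then have 2: "has_word n (star (?w (1, 1)) \<circ> star (?w (1, 0))) (24 * n)"
    unfolding star_def by (rule has_word_transpose_comm[OF n])
  have "(1, 0) \<in> pieces n" "(1, 1) \<in> pieces n"
    using assms(1) by (auto simp: pieces_def board_def zero_prod_def)
  then have 3: "?w (1, 0) \<in> pieces n" "?w (1, 1) \<in> pieces n"
    using permutes_in_image[OF perm] by auto
  have "?w (1, 0) \<noteq> ?w (0, 1)" "?w (1, 1) \<noteq> ?w (0, 1)" "?w (1, 1) \<noteq> ?w (1, 0)"
    using inj_eq[OF bij_is_inj[OF bij]] by auto
  then have 4: "?w (1, 0) \<noteq> (0, 1)" "?w (1, 1) \<noteq> (0, 1)" "?w (1, 1) \<noteq> ?w (1, 0)"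
    unfolding ws(3) .
  show ?thesis using ws(4)
  proof
    assume "?w (1, 0) = y"
    then show ?thesis using 1 3 4 by (intro bexI[of _ "?w (1, 1)"]) auto
  next
    assume "?w (1, 1) = y"
    then show ?thesis using 2 3 4 by (intro bexI[of _ "?w (1, 0)"]) auto
  qed
qed

text \<open>The commutator of two 3-cycles that share exactly one point is again a 3-cycle.\<close>

lemma has_word_star_pair:
  assumes "n \<ge> 4" "y \<in> pieces n - {(0, 1)}" "z \<in> pieces n - {(0, 1)}"
  shows "has_word n (star y \<circ> star z) (96 * n)"
proof -
  have n: "n > 0" using assms by simp
  obtain y' where y': "y' \<in> pieces n - {(0, 1), y}" and wy: "has_word n (star y \<circ> star y') (24 * n)"
    using has_word_partner[OF assms(1,2)] by blast
  obtain z' where z': "z' \<in> pieces n - {(0, 1), z}" and wz: "has_word n (star z \<circ> star z') (24 * n)"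
    using has_word_partner[OF assms(1,3)] by blast
  have wy': "has_word n (star y' \<circ> star y) (24 * n)" and wz': "has_word n (star z' \<circ> star z) (24 * n)"
    using wy wz has_word_transpose_comm[OF n] unfolding star_def by blast+
  \<comment> \<open>If some of the points coincide, at most two of the available words suffice.
    Otherwise the 3-cycles meet only in the hub and their commutator uses four words of length
    \<open>24 * n\<close>.\<close>
  consider "y = z" | "y' = z" | "z' = y" | "y' = z'"
    | "y \<noteq> z" "y' \<noteq> z" "z' \<noteq> y" "y' \<noteq> z'" by blast
  then show ?thesis
  proof cases
    case 1
    then show ?thesis by (simp add: has_word_id)
  next
    case 2
    then show ?thesis using wy by (auto intro: has_word_mono)
  next
    case 3
    then show ?thesis using wz' by (auto intro: has_word_mono)
  next
    case 4
    have "(star y \<circ> star y') \<circ> (star z' \<circ> star z) = star y \<circ> star z"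
      using 4 by (simp add: fun_eq_iff)
    then show ?thesis using has_word_comp[OF wy wz'] by (auto intro: has_word_mono)
  next
    case 5
    have "(star z' \<circ> star z) \<circ> (star y' \<circ> star y) \<circ> (star z \<circ> star z') \<circ> (star y \<circ> star y')
        = star y \<circ> star z"
    proof
      fix u
      show "((star z' \<circ> star z) \<circ> (star y' \<circ> star y) \<circ> (star z \<circ> star z') \<circ> (star y \<circ> star y')) u
          = (star y \<circ> star z) u"
        using assms(2,3) y' z' 5 by (auto simp: star_def Transposition.transpose_def)
    qed
    then show ?thesis
      using has_word_comp[OF has_word_comp[OF has_word_comp[OF wz' wy'] wz] wy]
      by (auto intro: has_word_mono)
  qed
qed

lemma transpose_star:
  assumes "(i, j) \<in> off_diag (pieces n)"
  shows "(\<exists>a\<in>pieces n - {(0, 1)}. transp i j = star a) \<or>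
    (\<exists>a\<in>pieces n - {(0, 1)}. \<exists>b\<in>pieces n - {(0, 1)}. transp i j = star a \<circ> star b \<circ> star a)"
proof -
  consider "i = (0, 1)" | "j = (0, 1)" | "i \<noteq> (0, 1)" "j \<noteq> (0, 1)" by blast
  then show ?thesis
  proof cases
    case 1
    then show ?thesis using assms by (auto simp: off_diag_def star_def)
  next
    case 2
    then show ?thesis using assms by (auto simp: off_diag_def star_def transpose_commute)
  next
    case 3
    then have "transp i j = star i \<circ> star j \<circ> star i"
      using assms by (auto simp: off_diag_def star_def Transposition.transpose_def fun_eq_iff)
    then show ?thesis using assms 3 by (auto simp: off_diag_def)
  qed
qed

text \<open>A transposition is a product of one or three hub transpositions, so a product of two has
  an even number of factors, at most six. These group into at most three pairs of cost
  \<open>96 * n\<close>.\<close>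

lemma has_word_double_swap:
  assumes "n \<ge> 4" "y \<in> off_diag (pieces n)" "z \<in> off_diag (pieces n)"
  shows "has_word n (swap_of y \<circ> swap_of z) (288 * n)"
proof -
  let ?P = "pieces n - {(0, 1)}"
  have pair: "has_word n (star a \<circ> star b) (96 * n)" if "a \<in> ?P" "b \<in> ?P" for a b
    using has_word_star_pair[OF assms(1) that] .
  have four: "has_word n (star a \<circ> star b \<circ> (star c \<circ> star d)) (192 * n)"
    if "a \<in> ?P" "b \<in> ?P" "c \<in> ?P" "d \<in> ?P" for a b c d
    using has_word_comp[OF pair pair, OF that] by simp
  have six: "has_word n (star a \<circ> star b \<circ> (star c \<circ> star d) \<circ> (star e \<circ> star f)) (288 * n)"
    if "a \<in> ?P" "b \<in> ?P" "c \<in> ?P" "d \<in> ?P" "e \<in> ?P" "f \<in> ?P" for a b c d e f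
    using has_word_comp[OF four pair, OF that] by simp
  consider a where "a \<in> ?P" "swap_of y = star a"
    | a b where "a \<in> ?P" "b \<in> ?P" "swap_of y = star a \<circ> star b \<circ> star a"
    using transpose_star[of "fst y" "snd y" n] assms(2) unfolding prod.collapse by blast
  then show ?thesis
  proof cases
    case y: (1 a)
    consider c where "c \<in> ?P" "swap_of z = star c"
      | c d where "c \<in> ?P" "d \<in> ?P" "swap_of z = star c \<circ> star d \<circ> star c"
      using transpose_star[of "fst z" "snd z" n] assms(3) unfolding prod.collapse by blast
    then show ?thesis
    proof cases
      case z: (1 c)
      show ?thesis unfolding y z by (rule has_word_mono[OF pair]) (use y z in auto)
    next
      case z: (2 c d)
      have "swap_of y \<circ> swap_of z = star a \<circ> star c \<circ> (star d \<circ> star c)"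
        unfolding y z by (simp only: comp_assoc)
      then show ?thesis by (simp only:) (rule has_word_mono[OF four], use y z in auto)
    qed
  next
    case y: (2 a b)
    consider c where "c \<in> ?P" "swap_of z = star c"
      | c d where "c \<in> ?P" "d \<in> ?P" "swap_of z = star c \<circ> star d \<circ> star c"
      using transpose_star[of "fst z" "snd z" n] assms(3) unfolding prod.collapse by blast
    then show ?thesis
    proof cases
      case z: (1 c)
      have "swap_of y \<circ> swap_of z = star a \<circ> star b \<circ> (star a \<circ> star c)"
        unfolding y z by (simp only: comp_assoc)
      then show ?thesis by (simp only:) (rule has_word_mono[OF four], use y z in auto)
    next
      case z: (2 c d)
      have "swap_of y \<circ> swap_of z = star a \<circ> star b \<circ> (star a \<circ> star c) \<circ> (star d \<circ> star c)"
        unfolding y z by (simp only: comp_assoc)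
      then show ?thesis by (simp only:) (rule six, use y z in auto)
    qed
  qed
qed

section \<open>The puzzle as a walk on permutations and empty squares\<close>

type_synonym state = "(square \<Rightarrow> square) \<times> square"

definition states :: "nat \<Rightarrow> state set" where
  "states n = Sym (pieces n) \<times> board n"

definition act :: "nat \<Rightarrow> state \<Rightarrow> square \<Rightarrow> state" where
  "act n x v = (fst x \<circ> slide n v, wrap n (snd x + v))"

definition start :: "nat \<Rightarrow> state" where
  "start n = (id, (int n - 1, int n - 1))"

definition reach :: "nat \<Rightarrow> state set" where
  "reach n = {foldl (act n) (start n) ws |ws. set ws \<subseteq> moves}"

lemma act_in_states: "n > 0 \<Longrightarrow> x \<in> states n \<Longrightarrow> act n x v \<in> states n"
  by (auto simp: act_def states_def intro!: permutes_compose slide_permutes)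

lemma start_in_states: "n > 0 \<Longrightarrow> start n \<in> states n"
  by (auto simp: start_def states_def board_def permutes_id)

lemma act_inverse:
  assumes "n > 0" "x \<in> states n"
  shows "act n (act n x v) (- v) = x"
  using assms slide_compose_inverse[OF assms(1), of v]
  by (cases x) (auto simp: act_def states_def comp_assoc)

lemma act_inverse': "n > 0 \<Longrightarrow> x \<in> states n \<Longrightarrow> act n (act n x (- v)) v = x"
  using act_inverse[of n x "- v"] by simp

lemma finite_states: "finite (states n)"
  by (simp add: states_def finite_permutations)

lemma foldl_act:
  assumes "x \<in> states n"
  shows "foldl (act n) x ws = (fst x \<circ> word_perm n ws, wrap n (snd x + sum_list ws))"
proof (induction ws rule: rev_induct)
  case Nil
  then show ?case using assms by (auto simp: states_def)
next
  case (snoc v ws)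
  then show ?case by (simp add: act_def[of _ "(_, _)"] word_perm_append add.assoc) (simp add: fun_eq_iff)
qed

lemma foldl_act_in_states: "n > 0 \<Longrightarrow> x \<in> states n \<Longrightarrow> foldl (act n) x ws \<in> states n"
  by (induction ws arbitrary: x) (auto simp: act_in_states)

lemma start_in_reach: "start n \<in> reach n"
  unfolding reach_def by (auto intro: exI[of _ "[]"])

lemma foldl_act_in_reach:
  assumes "x \<in> reach n" "set ws \<subseteq> moves"
  shows "foldl (act n) x ws \<in> reach n"
proof -
  obtain vs where "x = foldl (act n) (start n) vs" "set vs \<subseteq> moves"
    using assms(1) by (auto simp: reach_def)
  then show ?thesis
    using assms(2) unfolding reach_def by (intro CollectI exI[of _ "vs @ ws"]) auto
qed

lemma act_in_reach: "x \<in> reach n \<Longrightarrow> v \<in> moves \<Longrightarrow> act n x v \<in> reach n"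
  using foldl_act_in_reach[of x n "[v]"] by simp

lemma reach_subset: "n > 0 \<Longrightarrow> reach n \<subseteq> states n"
  unfolding reach_def using foldl_act_in_states start_in_states by blast

lemma finite_reach: "n > 0 \<Longrightarrow> finite (reach n)"
  using finite_states reach_subset finite_subset by blast

lemma act_in_reach_iff:
  assumes "n > 0" "x \<in> states n" "v \<in> moves"
  shows "act n x v \<in> reach n \<longleftrightarrow> x \<in> reach n"
  using act_in_reach[of "act n x v" n "- v"] act_in_reach[of x n v] act_inverse[OF assms(1,2)]
    uminus_moves[OF assms(3)] assms(3) by auto

text \<open>The permutation sends a present position relative to the empty square to the initial one
  of the same piece. The initial empty square is the corner, which is \<open>(-1, -1)\<close> modulo
  \<open>n\<close>; adding it recovers the square that names the piece.\<close>

definition conf :: "nat \<Rightarrow> state \<Rightarrow> config" where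
  "conf n x = (\<lambda>s. if s \<in> board n \<and> s \<noteq> snd x
     then initial_config n (wrap n ((-1, -1) + fst x (wrap n (s - snd x)))) else None)"

lemma wrap_corner: "n > 0 \<Longrightarrow> wrap n (-1, -1) = (int n - 1, int n - 1)"
  by (simp add: wrap_def zmod_minus1)

lemma wrap_ne_corner:
  assumes "n > 0" "u \<in> pieces n"
  shows "wrap n ((-1, -1) + u) \<noteq> (int n - 1, int n - 1)"
  using wrap_cancel[of n u "(-1, -1)" 0] wrap_corner[OF assms(1)] assms(2)
  by (auto simp: pieces_def add.commute)

lemma wrap_diff_in_pieces:
  assumes "n > 0" "s \<in> board n" "e \<in> board n" "s \<noteq> e"
  shows "wrap n (s - e) \<in> pieces n"
  using assms wrap_diff_eq_0[of n s e] by (simp add: pieces_def)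

lemma initial_config_Some:
  assumes "w \<in> board n" "w \<noteq> (int n - 1, int n - 1)"
  shows "initial_config n w = Some (fst w * int n + snd w + 1)"
  using assms by (cases w) (auto simp: initial_config_def)

lemma conf_eq_None_iff:
  assumes "n > 0" "x \<in> states n" "s \<in> board n"
  shows "conf n x s = None \<longleftrightarrow> s = snd x"
proof -
  have "conf n x s \<noteq> None" if "s \<noteq> snd x"
  proof -
    have "wrap n (s - snd x) \<in> pieces n"
      using assms that by (intro wrap_diff_in_pieces) (auto simp: states_def)
    then have "fst x (wrap n (s - snd x)) \<in> pieces n"
      using assms(2) permutes_in_image[of "fst x" "pieces n" "wrap n (s - snd x)"]
      by (simp add: states_def mem_Times_iff)
    then show ?thesis
      using initial_config_Some[OF wrap_in_board wrap_ne_corner] assms that by (simp add: conf_def)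
  qed
  then show ?thesis by (cases "s = snd x") (auto simp: conf_def)
qed

lemma empty_square_conf:
  assumes "n > 0" "x \<in> states n"
  shows "empty_square n (conf n x) = snd x"
  unfolding empty_square_def
  using assms conf_eq_None_iff[OF assms] by (intro the_equality) (auto simp: states_def)

lemma initial_config_inj:
  assumes "w \<in> board n" "w \<noteq> (int n - 1, int n - 1)" "w' \<in> board n" "w' \<noteq> (int n - 1, int n - 1)"
    "initial_config n w = initial_config n w'"
  shows "w = w'"
proof -
  have "fst w * int n + snd w = fst w' * int n + snd w'"
    using assms by (simp add: initial_config_Some)
  moreover have "(fst z * int n + snd z) div int n = fst z" "(fst z * int n + snd z) mod int n = snd z"
    if "z \<in> board n" for z
    using that by (auto simp: board_def)
  ultimately show ?thesis using assms(1,3) by (metis prod_eqI)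
qed

lemma inj_on_conf:
  assumes "n > 0"
  shows "inj_on (conf n) (states n)"
proof (rule inj_onI)
  fix x y assume x: "x \<in> states n" and y: "y \<in> states n" and eq: "conf n x = conf n y"
  have e: "snd x = snd y" using empty_square_conf[OF assms] x y eq by metis
  have "fst x u = fst y u" for u
  proof (cases "u \<in> pieces n")
    case True
    define s where "s = wrap n (snd x + u)"
    have s: "s \<in> board n" "s \<noteq> snd x" "wrap n (s - snd x) = u"
    proof -
      show "s \<in> board n" using assms by (simp add: s_def)
      show 1: "wrap n (s - snd x) = u" using True by (simp add: s_def pieces_def)
      show "s \<noteq> snd x" using 1 True by (auto simp: pieces_def)
    qed
    have "initial_config n (wrap n ((-1, -1) + fst x u)) = initial_config n (wrap n ((-1, -1) + fst y u))"
      using fun_cong[OF eq, of s] s e by (simp add: conf_def)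
    moreover have in_p: "fst x u \<in> pieces n" "fst y u \<in> pieces n"
      using True x y permutes_in_image[of "fst x" "pieces n" u]
        permutes_in_image[of "fst y" "pieces n" u] by (simp_all add: states_def mem_Times_iff)
    ultimately have "wrap n ((-1, -1) + fst x u) = wrap n ((-1, -1) + fst y u)"
      using assms wrap_ne_corner by (intro initial_config_inj) auto
    then have "wrap n (fst x u) = wrap n (fst y u)"
      using wrap_cancel[of n "fst x u" "(-1, -1)" "fst y u"] by (simp add: add.commute)
    then show ?thesis using in_p by (simp add: pieces_def)
  next
    case False
    then show ?thesis using x y by (auto simp: states_def permutes_not_in)
  qed
  then show "x = y" using e by (simp add: prod_eq_iff fun_eq_iff)
qed

lemma conf_start:
  assumes "n > 0"
  shows "conf n (start n) = initial_config n"
proof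
  fix s
  have corner: "(int n - 1, int n - 1) = wrap n (-1, -1)" using wrap_corner[OF assms] by simp
  show "conf n (start n) s = initial_config n s"
  proof (cases "s \<in> board n \<and> s \<noteq> (int n - 1, int n - 1)")
    case True
    have "wrap n ((-1, -1) + wrap n (s - (int n - 1, int n - 1))) = s"
    proof -
      have "(-1, -1) + (s - (-1, -1)) = s" by (cases s) simp
      then show ?thesis
        unfolding corner by (simp only: wrap_simps) (simp only: wrap_board[OF True[THEN conjunct1]])
    qed
    then show ?thesis
      by (simp only: conf_def start_def fst_conv snd_conv id_apply if_P[OF True])
  next
    case False
    then have "initial_config n s = None"
      by (cases s) (simp only: initial_config_def prod.case if_not_P if_False)
    then show ?thesis
      by (simp only: conf_def start_def fst_conv snd_conv if_not_P[OF False])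
  qed
qed

lemma apply_move_conf:
  assumes "n > 0" "x \<in> states n"
  shows "apply_move n (conf n x) v = conf n (act n x v)"
proof
  fix r
  obtain p e where x: "x = (p, e)" "p permutes pieces n" "e \<in> board n"
    using assms(2) by (auto simp: states_def)
  define t where "t = wrap n (e + v)"
  have t: "t \<in> board n" using assms by (simp add: t_def)
  have lhs: "apply_move n (conf n x) v = (conf n x)(e := conf n x t, t := None)"
    using conf_eq_None_iff[OF assms x(3)] empty_square_conf[OF assms] x(1)
    by (simp add: apply_move_def t_def wrap_def Let_def)
  show "apply_move n (conf n x) v r = conf n (act n x v) r"
  proof (cases "r \<in> board n \<and> r \<noteq> t")
    case False
    then show ?thesis
      unfolding lhs using x by (auto simp: conf_def act_def t_def[symmetric])
  next
    case r: True
    have u: "wrap n (r - t) \<in> pieces n" using r t assms by (intro wrap_diff_in_pieces) auto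
    have uv: "wrap n (wrap n (r - t) + v) = wrap n (r - e)"
      by (simp add: t_def algebra_simps)
    have rhs: "conf n (act n x v) r = initial_config n (wrap n ((-1, -1) + p (slide n v (wrap n (r - t)))))"
      using r x by (simp add: conf_def act_def t_def[symmetric])
    \<comment> \<open>The old empty square \<open>e\<close> receives the piece that stood at
      \<open>t\<close>, at relative position \<open>v\<close>: the exceptional branch of
      \<open>slide\<close>.\<close>
    show ?thesis
    proof (cases "r = e")
      case True
      then have "t \<noteq> e" using r by auto
      moreover have "wrap n (t - e) = wrap n v" by (simp add: t_def)
      moreover have "slide n v (wrap n (r - t)) = wrap n v"
        using u uv True unfolding slide_def by simp
      ultimately show ?thesis
        unfolding lhs rhs using True t r x by (simp add: conf_def)
    next
      case False
      then have "wrap n (r - e) \<noteq> 0" using wrap_diff_eq_0[of n r e] r x by simp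
      then have "slide n v (wrap n (r - t)) = wrap n (r - e)"
        using u uv unfolding slide_def by simp
      then show ?thesis
        unfolding lhs rhs using False r x by (simp add: conf_def)
    qed
  qed
qed

lemma reachable_configs_eq:
  assumes "n > 0"
  shows "reachable_configs n = conf n ` reach n"
proof (intro equalityI subsetI)
  fix c assume "c \<in> reachable_configs n"
  then show "c \<in> conf n ` reach n"
  proof induction
    case initial
    then show ?case using conf_start[OF assms] start_in_reach by (metis image_eqI)
  next
    case (move c v)
    then obtain x where x: "x \<in> reach n" "c = conf n x" by blast
    then have "x \<in> states n" using reach_subset[OF assms] by blast
    then have "apply_move n c v = conf n (act n x v)" using apply_move_conf[OF assms] x(2) by blast
    then show ?case using act_in_reach[OF x(1) move.hyps(2)] by blast
  qed
next
  fix c assume "c \<in> conf n ` reach n"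
  then obtain ws where "c = conf n (foldl (act n) (start n) ws)" "set ws \<subseteq> moves"
    by (auto simp: reach_def)
  then show "c \<in> reachable_configs n"
  proof (induction ws arbitrary: c rule: rev_induct)
    case Nil
    then show ?case using conf_start[OF assms] reachable_configs.initial by simp
  next
    case (snoc v ws)
    have "conf n (foldl (act n) (start n) (ws @ [v]))
        = apply_move n (conf n (foldl (act n) (start n) ws)) v"
      using apply_move_conf[OF assms foldl_act_in_states[OF assms start_in_states[OF assms]]] by simp
    then show ?case using snoc by (auto intro: reachable_configs.move)
  qed
qed

section \<open>The random walk on states\<close>

definition walk_step :: "nat \<Rightarrow> state \<Rightarrow> state pmf" where
  "walk_step n x = map_pmf (act n x) (pmf_of_set moves)"

definition walk :: "nat \<Rightarrow> nat \<Rightarrow> state pmf" where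
  "walk n N = ((\<lambda>p. bind_pmf p (walk_step n)) ^^ N) (return_pmf (start n))"

lemma finite_moves: "finite moves" "moves \<noteq> {}" "card moves = 5"
  by (auto simp: moves_def)

lemma set_pmf_walk: "n > 0 \<Longrightarrow> set_pmf (walk n N) \<subseteq> states n"
proof (induction N)
  case (Suc N)
  have "set_pmf (walk n (Suc N)) = (\<Union>x\<in>set_pmf (walk n N). act n x ` moves)"
    by (simp add: walk_def walk_step_def finite_moves)
  also have "\<dots> \<subseteq> states n"
    using Suc act_in_states[OF Suc.prems] by blast
  finally show ?case .
qed (simp add: walk_def start_in_states)

lemma puzzle_dist_eq:
  assumes "n > 0"
  shows "puzzle_dist n N = map_pmf (conf n) (walk n N)"
proof (induction N)
  case 0
  then show ?case by (simp add: puzzle_dist_def walk_def conf_start[OF assms])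
next
  case (Suc N)
  have "puzzle_dist n (Suc N) = bind_pmf (map_pmf (conf n) (walk n N)) (puzzle_step n)"
    using Suc by (simp add: puzzle_dist_def)
  also have "\<dots> = bind_pmf (walk n N) (\<lambda>x. puzzle_step n (conf n x))" by (rule bind_map_pmf)
  also have "\<dots> = bind_pmf (walk n N) (\<lambda>x. map_pmf (conf n) (walk_step n x))"
  proof (intro bind_pmf_cong refl)
    fix x assume "x \<in> set_pmf (walk n N)"
    then have "x \<in> states n" using set_pmf_walk[OF assms] by auto
    then have "apply_move n (conf n x) = conf n \<circ> act n x"
      using apply_move_conf[OF assms] by (simp add: fun_eq_iff)
    then show "puzzle_step n (conf n x) = map_pmf (conf n) (walk_step n x)"
      by (simp add: puzzle_step_def walk_step_def pmf.map_comp)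
  qed
  also have "\<dots> = map_pmf (conf n) (walk n (Suc N))" by (simp add: walk_def map_bind_pmf)
  finally show ?case .
qed

definition avg :: "nat \<Rightarrow> (state \<Rightarrow> real) \<Rightarrow> state \<Rightarrow> real" where
  "avg n f x = (\<Sum>v\<in>moves. f (act n x v)) / 5"

lemma sum_moves_uminus: "(\<Sum>v\<in>moves. g (- v)) = (\<Sum>v\<in>moves. g v)"
  by (rule sum.reindex_bij_witness[of _ uminus uminus]) (auto simp: uminus_moves)

text \<open>Mass arrives at \<open>x\<close> along inverse moves, and \<open>moves\<close> is closed
  under negation, so densities evolve by the same averaging operator as functions.\<close>

lemma pmf_walk_Suc:
  assumes "n > 0" "x \<in> states n"
  shows "pmf (walk n (Suc N)) x = avg n (pmf (walk n N)) x"
proof -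
  have "walk n (Suc N) = bind_pmf (walk n N) (\<lambda>y. bind_pmf (pmf_of_set moves) (\<lambda>v. return_pmf (act n y v)))"
    by (simp add: walk_def walk_step_def[abs_def] map_pmf_def)
  also have "\<dots> = bind_pmf (pmf_of_set moves) (\<lambda>v. map_pmf (\<lambda>y. act n y v) (walk n N))"
    by (subst bind_commute_pmf) (simp add: map_pmf_def)
  finally have sum: "pmf (walk n (Suc N)) x = (\<Sum>v\<in>moves. pmf (map_pmf (\<lambda>y. act n y v) (walk n N)) x) / 5"
    using finite_moves by (simp add: pmf_bind_pmf_of_set)
  have "pmf (map_pmf (\<lambda>y. act n y v) (walk n N)) x = pmf (walk n N) (act n x (- v))" for v
  proof -
    let ?S = "set_pmf (walk n N)"
    have "(\<lambda>y. act n y v) -` {x} \<inter> ?S = {act n x (- v)} \<inter> ?S"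
    proof (intro equalityI subsetI)
      fix y assume y: "y \<in> (\<lambda>y. act n y v) -` {x} \<inter> ?S"
      then have "y \<in> states n" using set_pmf_walk[OF assms(1), of N] by blast
      then show "y \<in> {act n x (- v)} \<inter> ?S" using act_inverse[OF assms(1), of y v] y by simp
    next
      fix y assume "y \<in> {act n x (- v)} \<inter> ?S"
      then show "y \<in> (\<lambda>y. act n y v) -` {x} \<inter> ?S" using act_inverse'[OF assms, of v] by auto
    qed
    then have "measure (walk n N) ((\<lambda>y. act n y v) -` {x}) = measure (walk n N) {act n x (- v)}"
      using measure_Int_set_pmf[of "walk n N" "(\<lambda>y. act n y v) -` {x}"]
        measure_Int_set_pmf[of "walk n N" "{act n x (- v)}"] by (simp only:)
    then show ?thesis by (simp only: pmf_map measure_pmf_single)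
  qed
  then show ?thesis
    by (simp add: sum avg_def sum_moves_uminus[of "\<lambda>v. pmf (walk n N) (act n x v)"])
qed

definition point :: "'a \<Rightarrow> 'a \<Rightarrow> real" where
  "point x y = (if y = x then 1 else 0)"

lemma pmf_walk:
  assumes "n > 0" "x \<in> states n"
  shows "pmf (walk n N) x = (avg n ^^ N) (point (start n)) x"
  using assms(2)
proof (induction N arbitrary: x)
  case 0
  then show ?case by (simp add: walk_def point_def pmf_return)
next
  case (Suc N)
  then show ?case using pmf_walk_Suc[OF assms(1)] act_in_states[OF assms(1)] by (simp add: avg_def)
qed

section \<open>Spectral gaps by comparison\<close>

text \<open>The Dirichlet form without normalisation: a factor 5 for the moves and a factor 2 from
  expanding the square relate it to \<open>\<langle>f, f - avg f\<rangle>\<close>.\<close>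

definition energy :: "nat \<Rightarrow> (state \<Rightarrow> real) \<Rightarrow> real" where
  "energy n f = (\<Sum>v\<in>moves. \<Sum>x\<in>states n. (f x - f (act n x v))\<^sup>2)"

lemma sum_states_act:
  assumes "n > 0"
  shows "(\<Sum>x\<in>states n. h (act n x v)) = (\<Sum>x\<in>states n. h x)"
  by (rule sum.reindex_bij_witness[of _ "\<lambda>x. act n x (- v)" "\<lambda>x. act n x v"])
    (simp_all add: act_inverse[OF assms] act_inverse'[OF assms] act_in_states[OF assms])

lemma avg_linear: "avg n (\<lambda>x. g x + s * h x) = (\<lambda>x. avg n g x + s * avg n h x)"
  by (simp add: avg_def fun_eq_iff sum.distrib sum_distrib_left add_divide_distrib)

lemma ip_avg_right: "ip (states n) g (avg n h) = (\<Sum>v\<in>moves. ip (states n) g (\<lambda>x. h (act n x v))) / 5"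
proof -
  have "avg n h = (\<lambda>x. (1 / 5) * (\<Sum>v\<in>moves. h (act n x v)))" by (simp add: avg_def fun_eq_iff)
  then show ?thesis by (simp only: ip_scale_right ip_sum_right)
qed

lemma avg_adjoint:
  assumes "n > 0"
  shows "ip (states n) (avg n g) h = ip (states n) g (avg n h)"
proof -
  have shift: "ip (states n) h (\<lambda>x. g (act n x v)) = ip (states n) g (\<lambda>x. h (act n x (- v)))" for v
  proof -
    have "ip (states n) h (\<lambda>x. g (act n x v)) =
        (\<Sum>x\<in>states n. h (act n (act n x v) (- v)) * g (act n x v))"
      by (simp add: ip_def act_inverse[OF assms] cong: sum.cong)
    also have "\<dots> = (\<Sum>x\<in>states n. h (act n x (- v)) * g x)"
      by (rule sum_states_act[OF assms])
    finally show ?thesis by (simp add: ip_def mult.commute)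
  qed
  show ?thesis
    unfolding ip_commute[of _ "avg n g"] ip_avg_right shift
    by (simp add: sum_moves_uminus[of "\<lambda>v. ip (states n) g (\<lambda>x. h (act n x v))"])
qed

lemma ip_act:
  assumes "n > 0"
  shows "ip (states n) (\<lambda>x. f (act n x v)) (\<lambda>x. f (act n x v)) = ip (states n) f f"
  unfolding ip_def by (rule sum_states_act[OF assms])

lemma energy_eq:
  assumes "n > 0"
  shows "energy n f = 10 * (ip (states n) f f - ip (states n) f (avg n f))"
proof -
  define S where "S v = ip (states n) f (\<lambda>x. f (act n x v))" for v
  have "energy n f = (\<Sum>v\<in>moves. 2 * ip (states n) f f - 2 * S v)"
    unfolding energy_def ip_self_diff ip_act[OF assms] S_def by simp
  also have "\<dots> = 10 * ip (states n) f f - 2 * (\<Sum>v\<in>moves. S v)"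
    using finite_moves by (simp add: sum_subtractf sum_distrib_left)
  finally have "energy n f = 10 * ip (states n) f f - 2 * (\<Sum>v\<in>moves. S v)" .
  moreover have "ip (states n) f (avg n f) = (\<Sum>v\<in>moves. S v) / 5"
    unfolding ip_avg_right S_def ..
  ultimately show ?thesis by (simp add: right_diff_distrib)
qed

text \<open>The lazy move excludes eigenvalues near -1: it alone contributes
  \<open>4 * ip (states n) f f\<close> to a sum of squares equal to ten times
  \<open>\<langle>f, f + avg f\<rangle>\<close>.\<close>

lemma ip_avg_lower:
  assumes "n > 0"
  shows "- (3 / 5) * ip (states n) f f \<le> ip (states n) f (avg n f)"
proof -
  have eq: "(\<Sum>x\<in>states n. (f x + f (act n x v))\<^sup>2) =
      2 * ip (states n) f f + 2 * ip (states n) f (\<lambda>x. f (act n x v))" for v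
    using ip_self_diff[of f "\<lambda>x. - f (act n x v)" "states n"] ip_act[OF assms, of f v]
    by (simp add: ip_def sum_negf)
  have "act n x 0 = x" if "x \<in> states n" for x
    using that by (auto simp: act_def slide_zero states_def)
  then have "4 * ip (states n) f f = (\<Sum>x\<in>states n. (f x + f (act n x 0))\<^sup>2)"
    by (simp add: ip_self sum_distrib_left power_mult_distrib cong: sum.cong)
  also have "\<dots> \<le> (\<Sum>v\<in>moves. \<Sum>x\<in>states n. (f x + f (act n x v))\<^sup>2)"
    by (rule member_le_sum) (auto simp: moves_def zero_prod_def intro: sum_nonneg)
  also have "\<dots> = (\<Sum>v\<in>moves. 2 * ip (states n) f f + 2 * ip (states n) f (\<lambda>x. f (act n x v)))"
    unfolding eq ..
  also have "\<dots> = 10 * ip (states n) f f + 2 * (\<Sum>v\<in>moves. ip (states n) f (\<lambda>x. f (act n x v)))"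
    using finite_moves by (simp add: sum.distrib sum_distrib_left)
  also have "\<dots> = 10 * ip (states n) f f + 10 * ip (states n) f (avg n f)"
    unfolding ip_avg_right by simp
  finally show ?thesis by simp
qed

text \<open>Telescoping along the word: every move permutes \<open>states n\<close>, so by the
  triangle inequality each letter costs at most the root of the energy, wherever it occurs.\<close>

lemma L2_set_word_le:
  assumes "n > 0" "set ws \<subseteq> moves"
  shows "L2_set (\<lambda>x. f x - f (foldl (act n) x ws)) (states n) \<le> real (length ws) * sqrt (energy n f)"
  using assms(2)
proof (induction ws)
  case Nil
  then show ?case by (simp add: L2_set_def)
next
  case (Cons v ws)
  let ?g = "\<lambda>y. f y - f (foldl (act n) y ws)"
  have "L2_set (\<lambda>x. f x - f (act n x v)) (states n) \<le> sqrt (energy n f)"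
    unfolding L2_set_def energy_def
    using Cons.prems finite_moves
    by (intro real_sqrt_le_mono member_le_sum[of v moves "\<lambda>v. \<Sum>x\<in>states n. (f x - f (act n x v))\<^sup>2"])
      (auto intro: sum_nonneg)
  moreover have "L2_set (\<lambda>x. ?g (act n x v)) (states n) = L2_set ?g (states n)"
    unfolding L2_set_def by (simp only: sum_states_act[OF assms(1), of "\<lambda>y. (?g y)\<^sup>2"])
  moreover have "L2_set (\<lambda>x. f x - f (foldl (act n) x (v # ws))) (states n) \<le>
      L2_set (\<lambda>x. f x - f (act n x v)) (states n) + L2_set (\<lambda>x. ?g (act n x v)) (states n)"
    using L2_set_triangle_ineq[of "\<lambda>x. f x - f (act n x v)" "\<lambda>x. ?g (act n x v)" "states n"]
    by simp
  ultimately show ?case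
    using Cons by (simp add: algebra_simps)
qed

lemma sum_word_le:
  assumes "n > 0" "set ws \<subseteq> moves" "length ws \<le> L"
  shows "(\<Sum>x\<in>states n. (f x - f (foldl (act n) x ws))\<^sup>2) \<le> (real L)\<^sup>2 * energy n f"
proof -
  have e: "0 \<le> energy n f" unfolding energy_def by (intro sum_nonneg) simp
  have "L2_set (\<lambda>x. f x - f (foldl (act n) x ws)) (states n) \<le> real L * sqrt (energy n f)"
    using L2_set_word_le[OF assms(1,2), of f] assms(3) e
    by (meson mult_right_mono of_nat_mono order_trans real_sqrt_ge_zero)
  then have "(L2_set (\<lambda>x. f x - f (foldl (act n) x ws)) (states n))\<^sup>2 \<le> (real L * sqrt (energy n f))\<^sup>2"
    by (intro power_mono) auto
  then show ?thesis using e by (simp add: L2_set_def power_mult_distrib sum_nonneg)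
qed

text \<open>The bound \<open>\<kappa> \<le> 2 / 5\<close> gives
  \<open>- 3 / 5 \<ge> - (1 - \<kappa>)\<close>, so the lower bound from laziness matches the upper
  bound from the gap and the norm bound applies on \<open>U\<close>.\<close>

lemma avg_contract:
  assumes "n > 0"
    and U: "\<And>g. U g \<Longrightarrow> U (avg n g)" "\<And>g h s. U g \<Longrightarrow> U h \<Longrightarrow> U (\<lambda>x. g x + s * h x)"
    and gap: "\<And>g. U g \<Longrightarrow> \<kappa> * ip (states n) g g \<le> ip (states n) g g - ip (states n) g (avg n g)"
    and \<kappa>: "\<kappa> \<le> 2 / 5" and "U f"
  shows "L2_set ((avg n ^^ N) f) (states n) \<le> (1 - \<kappa>) ^ N * L2_set f (states n)"
proof -
  have step: "L2_set (avg n g) (states n) \<le> (1 - \<kappa>) * L2_set g (states n)" if "U g" for g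
  proof -
    have "ip (states n) (avg n g) (avg n g) \<le> (1 - \<kappa>)\<^sup>2 * ip (states n) g g"
    proof (rule selfadjoint_norm_bound[where U = U])
      fix h assume h: "U h"
      have "3 / 5 * ip (states n) h h \<le> (1 - \<kappa>) * ip (states n) h h"
        using \<kappa> by (intro mult_right_mono) auto
      then show "\<bar>ip (states n) h (avg n h)\<bar> \<le> (1 - \<kappa>) * ip (states n) h h"
        using gap[OF h] ip_avg_lower[OF assms(1), of h] by (simp add: algebra_simps abs_le_iff)
    qed (use assms that avg_adjoint avg_linear in auto)
    then have "sqrt (ip (states n) (avg n g) (avg n g)) \<le> sqrt ((1 - \<kappa>)\<^sup>2 * ip (states n) g g)"
      by (rule real_sqrt_le_mono)
    then show ?thesis using \<kappa> by (simp add: L2_set_ip real_sqrt_mult)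
  qed
  have "U ((avg n ^^ N) f)" for N by (induction N) (auto simp: \<open>U f\<close> U(1))
  note Uf = this
  show ?thesis
  proof (induction N)
    case (Suc N)
    have "L2_set ((avg n ^^ Suc N) f) (states n) \<le> (1 - \<kappa>) * L2_set ((avg n ^^ N) f) (states n)"
      using step[OF Uf] by simp
    also have "\<dots> \<le> (1 - \<kappa>) * ((1 - \<kappa>) ^ N * L2_set f (states n))"
      using Suc \<kappa> by (intro mult_left_mono) auto
    finally show ?case by simp
  qed simp
qed

section \<open>The gap on the levels\<close>

definition level_free :: "nat \<Rightarrow> nat \<Rightarrow> (state \<Rightarrow> real) \<Rightarrow> bool" where
  "level_free n k f \<longleftrightarrow> (\<forall>e\<in>board n. twisted_low_free (pieces n) k (\<lambda>p. f (p, e)))"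

lemma level_free_add:
  "level_free n k f \<Longrightarrow> level_free n k g \<Longrightarrow> level_free n k (\<lambda>x. f x + s * g x)"
  by (simp add: level_free_def twisted_low_free_add)

lemma twisted_low_free_sum:
  "(\<And>i. i \<in> I \<Longrightarrow> twisted_low_free X k (F i)) \<Longrightarrow> twisted_low_free X k (\<lambda>p. \<Sum>i\<in>I. F i p)"
  unfolding twisted_low_free_def by (simp add: sum_distrib_left low_free_sum)

lemma twisted_low_free_scale: "twisted_low_free X k f \<Longrightarrow> twisted_low_free X k (\<lambda>p. s * f p)"
  unfolding twisted_low_free_def
  using low_free_scale[of X k f s] low_free_scale[of X k "\<lambda>p. rsign p * f p" s]
  by (simp add: mult_ac)

text \<open>A move permutes the fibres over the place of the empty square and multiplies the
  permutation on the right, which keeps the length of an indicator.\<close>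

lemma level_free_avg:
  assumes "n > 0" "level_free n k f"
  shows "level_free n k (avg n f)"
  unfolding level_free_def
proof
  fix e assume "e \<in> board n"
  have "twisted_low_free (pieces n) k (\<lambda>p. f (p \<circ> slide n v, wrap n (e + v)))" for v
    using assms by (intro twisted_low_free_right[of _ _ _ "\<lambda>p. f (p, wrap n (e + v))"] slide_permutes)
      (auto simp: level_free_def)
  then have "twisted_low_free (pieces n) k (\<lambda>p. (1 / 5) * (\<Sum>v\<in>moves. f (p \<circ> slide n v, wrap n (e + v))))"
    by (intro twisted_low_free_scale twisted_low_free_sum)
  then show "twisted_low_free (pieces n) k (\<lambda>p. avg n f (p, e))"
    by (simp add: avg_def act_def)
qed

lemma sum_states: "(\<Sum>x\<in>states n. h x) = (\<Sum>e\<in>board n. \<Sum>p\<in>Sym (pieces n). h (p, e))"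
  unfolding states_def by (subst sum.swap) (simp add: sum.cartesian_product)

lemma ip_states: "ip (states n) f g = (\<Sum>e\<in>board n. ip (Sym (pieces n)) (\<lambda>p. f (p, e)) (\<lambda>p. g (p, e)))"
  unfolding ip_def sum_states ..

lemma has_word_foldl:
  assumes "n > 0" "has_word n h L"
  shows "\<exists>ws. set ws \<subseteq> moves \<and> length ws \<le> L \<and>
    (\<forall>x\<in>states n. foldl (act n) x ws = (fst x \<circ> h, snd x))"
proof -
  obtain ws where ws: "set ws \<subseteq> moves" "length ws \<le> L" "wrap n (sum_list ws) = 0" "word_perm n ws = h"
    using assms unfolding has_word_def by blast
  have "wrap n (e + sum_list ws) = e" if "e \<in> board n" for e
  proof -
    have "wrap n (e + sum_list ws) = wrap n (e + wrap n (sum_list ws))" by simp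
    then show ?thesis unfolding ws using that by simp
  qed
  then show ?thesis
    using ws foldl_act[of _ n ws] by (intro exI[of _ ws]) (simp add: states_def mem_Times_iff)
qed

text \<open>Fibrewise \<open>double_swap_bound\<close> is compared with the words for double
  transpositions. After cancelling \<open>m (m - 1)^2\<close> a factor \<open>m \<le> n^2\<close>
  remains, and the squared word length supplies the other \<open>n^2\<close>.\<close>

lemma gap_level:
  assumes n: "n \<ge> 4" and k: "k \<le> card (pieces n)" and f: "level_free n k f"
  shows "real k / (10 ^ 6 * real n ^ 4) * ip (states n) f f \<le> ip (states n) f f - ip (states n) f (avg n f)"
proof -
  define m where "m = card (pieces n)"
  define F where "F = ip (states n) f f"
  define D where "D = F - ip (states n) f (avg n f)"
  have n0: "n > 0" using n by simp
  have nn: "16 \<le> n * n" using mult_le_mono[OF n n] by simp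
  have m: "m \<ge> 2" "real m \<le> (real n)\<^sup>2" "real m = (real n)\<^sup>2 - 1"
  proof -
    have "real m = real (n * n) - 1" using nn by (simp add: m_def card_pieces[OF n0] of_nat_diff del: of_nat_mult)
    then show "real m = (real n)\<^sup>2 - 1" "real m \<le> (real n)\<^sup>2" by (simp_all add: power2_eq_square)
    show "m \<ge> 2" using nn by (simp add: m_def card_pieces[OF n0])
  qed
  have En: "energy n f = 10 * D" by (simp add: energy_eq[OF n0] D_def F_def)
  have "D \<ge> 0"
  proof -
    have "energy n f \<ge> 0" unfolding energy_def by (intro sum_nonneg) simp
    then show ?thesis by (simp add: En)
  qed
  have swap: "(\<Sum>x\<in>states n. (f x - f (fst x \<circ> swap_of y \<circ> swap_of z, snd x))\<^sup>2) \<le> (288 * real n)\<^sup>2 * (10 * D)"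
    if yz: "y \<in> off_diag (pieces n)" "z \<in> off_diag (pieces n)" for y z
  proof -
    obtain ws where ws: "set ws \<subseteq> moves" "length ws \<le> 288 * n"
      "\<And>x. x \<in> states n \<Longrightarrow> foldl (act n) x ws = (fst x \<circ> (swap_of y \<circ> swap_of z), snd x)"
      using has_word_foldl[OF n0 has_word_double_swap[OF n yz]] by blast
    have "(\<Sum>x\<in>states n. (f x - f (fst x \<circ> swap_of y \<circ> swap_of z, snd x))\<^sup>2) =
        (\<Sum>x\<in>states n. (f x - f (foldl (act n) x ws))\<^sup>2)"
      by (intro sum.cong refl) (simp add: ws(3) comp_assoc)
    also have "\<dots> \<le> (real (288 * n))\<^sup>2 * energy n f" by (rule sum_word_le[OF n0 ws(1,2)])
    finally show ?thesis by (simp add: En)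
  qed
  have "8 / 9 * real k * real m * (real m - 1)\<^sup>2 * F =
      (\<Sum>e\<in>board n. 8 / 9 * real k * real m * (real m - 1)\<^sup>2 * ip (Sym (pieces n)) (\<lambda>p. f (p, e)) (\<lambda>p. f (p, e)))"
    by (simp add: F_def ip_states sum_distrib_left)
  also have "\<dots> \<le> (\<Sum>e\<in>board n. \<Sum>y\<in>off_diag (pieces n). \<Sum>z\<in>off_diag (pieces n).
      \<Sum>p\<in>Sym (pieces n). (f (p, e) - f (p \<circ> swap_of y \<circ> swap_of z, e))\<^sup>2)"
    using f k m(1) unfolding m_def level_free_def
    by (intro sum_mono double_swap_bound[OF finite_pieces refl, of n k "\<lambda>p. f (p, _)"]) auto
  also have "\<dots> = (\<Sum>y\<in>off_diag (pieces n). \<Sum>z\<in>off_diag (pieces n). \<Sum>e\<in>board n.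
      \<Sum>p\<in>Sym (pieces n). (f (p, e) - f (p \<circ> swap_of y \<circ> swap_of z, e))\<^sup>2)"
    by (rule sum_rotate[symmetric])
  also have "\<dots> = (\<Sum>y\<in>off_diag (pieces n). \<Sum>z\<in>off_diag (pieces n).
      \<Sum>x\<in>states n. (f x - f (fst x \<circ> swap_of y \<circ> swap_of z, snd x))\<^sup>2)"
    by (simp add: sum_states)
  also have "\<dots> \<le> (\<Sum>y\<in>off_diag (pieces n). \<Sum>z\<in>off_diag (pieces n). (288 * real n)\<^sup>2 * (10 * D))"
    by (intro sum_mono swap)
  also have "\<dots> = (real m * (real m - 1))\<^sup>2 * ((288 * real n)\<^sup>2 * (10 * D))"
    unfolding sum_constant card_off_diag[OF finite_pieces] m_def by (simp add: power2_eq_square)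
  finally have "(real m * (real m - 1)\<^sup>2) * (8 / 9 * real k * F) \<le>
      (real m * (real m - 1)\<^sup>2) * (real m * ((288 * real n)\<^sup>2 * (10 * D)))"
    by (simp add: power2_eq_square mult_ac)
  then have "8 / 9 * real k * F \<le> real m * ((288 * real n)\<^sup>2 * (10 * D))"
    using m(1) by (subst (asm) mult_le_cancel_left_pos) auto
  also have "\<dots> \<le> (real n)\<^sup>2 * ((288 * real n)\<^sup>2 * (10 * D))"
    using m(2) \<open>D \<ge> 0\<close> by (intro mult_right_mono) auto
  \<comment> \<open>Here \<open>829440 = 10 * 288^2\<close>, and 9/8 of it is 933120, below
    \<open>10 ^ 6\<close>.\<close>
  also have "\<dots> = 829440 * (real n ^ 4 * D)" by (simp add: power2_eq_square power4_eq_xxxx)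
  also have "\<dots> \<le> 8 / 9 * (10 ^ 6 * real n ^ 4 * D)"
    using \<open>D \<ge> 0\<close> by (simp add: mult_nonneg_nonneg)
  finally have "real k * F \<le> 10 ^ 6 * real n ^ 4 * D" by (simp add: mult_ac)
  then show ?thesis using n0 by (simp add: F_def D_def field_simps)
qed

section \<open>Reachability, parity and the abelian quotient\<close>

lemma reach_double_swap:
  assumes "n \<ge> 4" "(q, e) \<in> reach n" "y \<in> off_diag (pieces n)" "z \<in> off_diag (pieces n)"
  shows "(q \<circ> (swap_of y \<circ> swap_of z), e) \<in> reach n"
proof -
  have n0: "n > 0" using assms(1) by simp
  obtain ws where ws: "set ws \<subseteq> moves"
    "\<And>x. x \<in> states n \<Longrightarrow> foldl (act n) x ws = (fst x \<circ> (swap_of y \<circ> swap_of z), snd x)"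
    using has_word_foldl[OF n0 has_word_double_swap[OF assms(1,3,4)]] by blast
  show ?thesis
    using foldl_act_in_reach[OF assms(2) ws(1)] ws(2)[of "(q, e)"] reach_subset[OF n0] assms(2) by auto
qed

text \<open>Transpositions are only available in pairs. The induction adds them one at a time, so
  the odd case carries a spare transposition \<open>y\<close> waiting for its partner.\<close>

lemma reach_even:
  assumes "n \<ge> 4" "h permutes pieces n"
  shows "(sign h = 1 \<longrightarrow> (\<forall>q. (q, e) \<in> reach n \<longrightarrow> (q \<circ> h, e) \<in> reach n)) \<and>
    (sign h = -1 \<longrightarrow> (\<forall>q. \<forall>y\<in>off_diag (pieces n). (q, e) \<in> reach n \<longrightarrow> (q \<circ> (swap_of y \<circ> h), e) \<in> reach n))"
  using assms(2) finite_pieces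
proof (induction h rule: permutes_induct)
  case id
  then show ?case by simp
next
  case (swap a b h)
  have ab: "(a, b) \<in> off_diag (pieces n)" using swap by (auto simp: off_diag_def)
  have "permutation h" using swap.hyps finite_pieces permutes_imp_permutation by blast
  then have sign: "sign (transp a b \<circ> h) = - sign h"
    using swap.hyps by (simp add: sign_compose permutation_swap_id sign_swap_id)
  show ?case
  proof (intro conjI impI allI ballI)
    fix q assume "sign (transp a b \<circ> h) = 1" "(q, e) \<in> reach n"
    then have "(q \<circ> (swap_of (a, b) \<circ> h), e) \<in> reach n"
      using swap.IH ab sign by (metis minus_minus)
    then show "(q \<circ> (transp a b \<circ> h), e) \<in> reach n" by (simp only: fst_conv snd_conv)
  next
    fix q y assume *: "sign (transp a b \<circ> h) = - 1" "(q, e) \<in> reach n" "y \<in> off_diag (pieces n)"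
    have "(q \<circ> (swap_of y \<circ> swap_of (a, b)), e) \<in> reach n"
      using reach_double_swap[OF assms(1) *(2,3) ab] .
    moreover have "sign h = 1" using * sign by simp
    ultimately have "(q \<circ> (swap_of y \<circ> swap_of (a, b)) \<circ> h, e) \<in> reach n"
      using swap.IH by blast
    then show "(q \<circ> (swap_of y \<circ> (transp a b \<circ> h)), e) \<in> reach n"
      by (simp add: comp_assoc)
  qed
qed

text \<open>The quotient \<open>inv q \<circ> p\<close> is even. Thus each fibre of
  \<open>reach n\<close> is a union of sign classes, which spares deciding whether both signs
  occur.\<close>

lemma reach_sign:
  assumes "n \<ge> 4" "(q, e) \<in> reach n" "p permutes pieces n" "sign p = sign q"
  shows "(p, e) \<in> reach n"
proof -
  have q: "q permutes pieces n" using reach_subset[of n] assms(1,2) by (auto simp: states_def)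
  have pq: "permutation p" "permutation q"
    using q assms(3) finite_pieces permutes_imp_permutation by blast+
  have "sign (inv q \<circ> p) = 1"
    using pq assms(4) by (simp add: sign_compose permutation_inverse sign_inverse)
  moreover have "inv q \<circ> p permutes pieces n" using q assms(3) by (intro permutes_compose permutes_inv)
  ultimately have "(q \<circ> (inv q \<circ> p), e) \<in> reach n" using reach_even[OF assms(1)] assms(2) by blast
  then show ?thesis using permutes_inv_o(1)[OF q] by (simp flip: comp_assoc)
qed

text \<open>Up to an even permutation a word can be replaced by one of the form
  \<open>right\<^sup>i down\<^sup>j\<close> with \<open>i, j < 2 n\<close>: only the sign and the total displacement matter.\<close>

lemma sign_word_normal:
  assumes "n > 0" "set ws \<subseteq> moves"
  shows "\<exists>i j :: nat. sign (word_perm n ws) = sign (slide n (0, 1)) ^ i * sign (slide n (1, 0)) ^ j \<and>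
    wrap n (sum_list ws) = wrap n (int j, int i)"
  using assms(2)
proof (induction ws)
  case Nil
  then show ?case by (intro exI[of _ 0]) (simp add: zero_prod_def[symmetric])
next
  case (Cons v ws)
  then obtain i j where ij: "sign (word_perm n ws) = sign (slide n (0, 1)) ^ i * sign (slide n (1, 0)) ^ j"
    "wrap n (sum_list ws) = wrap n (int j, int i)" by auto
  have perm: "permutation (slide n v)" "permutation (word_perm n ws)" for v
    using slide_permutes[OF assms(1)] word_perm_permutes[OF assms(1)] permutes_imp_permutation[OF finite_pieces]
    by blast+
  have "sign (slide n v) * sign (slide n (- v)) = 1" for v
    using slide_compose_inverse[OF assms(1), of v] sign_compose[OF perm(1) perm(1)] by (metis sign_id)
  then have "sign (slide n v) * (sign (slide n v) * sign (slide n (- v))) = sign (slide n v) * 1" for v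
    by (rule arg_cong)
  then have sgn: "sign (slide n (- v)) = sign (slide n v)" for v by simp
  have wrapv: "wrap n (sum_list (v # ws)) = wrap n (v + (int j, int i))"
  proof -
    have "wrap n (sum_list (v # ws)) = wrap n (v + wrap n (sum_list ws))" by simp
    then show ?thesis unfolding ij(2) by simp
  qed
  have signv: "sign (word_perm n (v # ws)) = sign (slide n v) * (sign (slide n (0, 1)) ^ i * sign (slide n (1, 0)) ^ j)"
    using perm by (simp add: sign_compose ij)
  \<comment> \<open>The number \<open>2 * n - 1\<close> is odd and congruent to -1 modulo
    \<open>n\<close>, so that many forward moves replace one backward move with the same sign and
    displacement.\<close>
  have odd_pow: "sign p ^ (2 * n - 1) = sign p" for p :: "square \<Rightarrow> square"
  proof -
    have "sign p * sign p ^ (2 * n - 1) = sign p ^ (2 * n)"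
      using assms(1) by (simp flip: power_Suc)
    also have "\<dots> = 1" by (simp add: power_mult power2_eq_square)
    finally have 1: "sign p * sign p ^ (2 * n - 1) = 1" .
    have "sign p ^ (2 * n - 1) = sign p * (sign p * sign p ^ (2 * n - 1))"
      by (simp flip: mult.assoc)
    then show ?thesis unfolding 1 by simp
  qed
  have wrap_neg: "wrap n (int (2 * n - 1) + a, b) = wrap n (a - 1, b)"
    "wrap n (a, int (2 * n - 1) + b) = wrap n (a, b - 1)" for a b
  proof -
    have *: "(int (2 * n - 1) + c) mod int n = (c - 1) mod int n" for c
    proof -
      have "int (2 * n - 1) + c = (c - 1) + int n * 2" using assms(1) by (simp add: of_nat_diff)
      then show ?thesis by (metis mod_mult_self2)
    qed
    show "wrap n (int (2 * n - 1) + a, b) = wrap n (a - 1, b)"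
      "wrap n (a, int (2 * n - 1) + b) = wrap n (a, b - 1)"
      by (simp_all only: wrap_def fst_conv snd_conv *)
  qed
  from Cons.prems have "v \<in> moves" by simp
  then consider "v = 0" | "v = (0, 1)" | "v = - (0, 1)" | "v = - (1, 0)" | "v = (1, 0)"
    by (auto simp: moves_def zero_prod_def)
  then show ?case
  proof cases
    case 1
    show ?thesis
      by (rule exI[of _ i], rule exI[of _ j], simp only: signv wrapv 1) (simp add: slide_zero ij)
  next
    case 2
    show ?thesis
      by (rule exI[of _ "Suc i"], rule exI[of _ j], simp only: signv wrapv, simp only: 2) (simp add: mult_ac)
  next
    case 3
    show ?thesis
      by (rule exI[of _ "(2 * n - 1) + i"], rule exI[of _ j],
          simp only: signv wrapv, simp only: 3 sgn power_add odd_pow of_nat_add wrap_neg) (simp add: mult_ac)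
  next
    case 4
    show ?thesis
      by (rule exI[of _ i], rule exI[of _ "(2 * n - 1) + j"],
          simp only: signv wrapv, simp only: 4 sgn power_add odd_pow of_nat_add wrap_neg) (simp add: mult_ac)
  next
    case 5
    show ?thesis
      by (rule exI[of _ i], rule exI[of _ "Suc j"], simp only: signv wrapv, simp only: 5) (simp add: mult_ac)
  qed
qed

lemma word_perm_replicate: "word_perm n (replicate i v) = slide n v ^^ i"
  by (induction i) auto

lemma short_word:
  assumes "n > 0" "set ws \<subseteq> moves"
  shows "\<exists>us. set us \<subseteq> moves \<and> length us \<le> 4 * n \<and> sign (word_perm n us) = sign (word_perm n ws) \<and>
    wrap n (sum_list us) = wrap n (sum_list ws)"
proof -
  obtain i j where ij: "sign (word_perm n ws) = sign (slide n (0, 1)) ^ i * sign (slide n (1, 0)) ^ j"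
    "wrap n (sum_list ws) = wrap n (int j, int i)" using sign_word_normal[OF assms] by blast
  \<comment> \<open>Reduction modulo \<open>2 * n\<close> is compatible with displacements, which
    have period \<open>n\<close>, and with signs, which have period 2.\<close>
  define i' j' where "i' = i mod (2 * n)" and "j' = j mod (2 * n)"
  let ?us = "replicate i' (0, 1) @ replicate j' (1, 0) :: square list"
  have perm: "permutation (slide n v)" for v
    using slide_permutes[OF assms(1)] permutes_imp_permutation[OF finite_pieces] by blast
  have sign_pow: "sign (slide n v ^^ k) = sign (slide n v) ^ k \<and> permutation (slide n v ^^ k)" for v k
  proof (induction k)
    case (Suc k)
    then show ?case
      using sign_compose[OF perm, of "slide n v ^^ k" v] permutation_compose[OF perm, of "slide n v ^^ k" v]
      by (simp only: funpow.simps power_Suc)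
  qed (simp only: funpow.simps power_0 sign_id permutation_id simp_thms)
  have sign_mod: "sign p ^ (k mod (2 * n)) = sign p ^ k" for p :: "square \<Rightarrow> square" and k
  proof -
    have "sign p ^ k = sign p ^ (2 * n * (k div (2 * n)) + k mod (2 * n))" by simp
    also have "\<dots> = sign p ^ (k mod (2 * n))" unfolding power_add by (simp add: power_mult power2_eq_square)
    finally show ?thesis ..
  qed
  have "sum_list ?us = (int j', int i')"
  proof -
    have "sum_list (replicate k (a, b)) = (int k * a, int k * b)" for k and a b :: int
      by (induction k) (simp_all add: zero_prod_def algebra_simps)
    then show ?thesis by simp
  qed
  moreover have "int (k mod (2 * n)) mod int n = int k mod int n" for k
    by (simp add: zmod_int[symmetric] mod_mod_cancel)
  ultimately have "wrap n (sum_list ?us) = wrap n (sum_list ws)"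
    unfolding ij by (simp add: wrap_def i'_def j'_def)
  moreover have "sign (word_perm n ?us) = sign (word_perm n ws)"
    unfolding ij word_perm_append word_perm_replicate
    by (simp add: sign_compose sign_pow i'_def j'_def sign_mod)
  moreover have "length ?us \<le> 4 * n"
  proof -
    have "i' < 2 * n" "j' < 2 * n" using assms(1) by (simp_all add: i'_def j'_def)
    then show ?thesis by simp
  qed
  moreover have "set ?us \<subseteq> moves" by (auto simp: moves_def)
  ultimately show ?thesis by blast
qed

text \<open>The functions on the abelian quotient of the group of reachable states that are orthogonal
  to the constants, extended by zero.\<close>

definition class_fun :: "nat \<Rightarrow> (state \<Rightarrow> real) \<Rightarrow> bool" where
  "class_fun n f \<longleftrightarrow> (\<forall>x\<in>states n - reach n. f x = 0) \<and> (\<Sum>x\<in>reach n. f x) = 0 \<and>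
    (\<forall>x\<in>states n. \<forall>y\<in>states n. sign (fst x) = sign (fst y) \<longrightarrow> snd x = snd y \<longrightarrow> f x = f y)"

lemma class_fun_add: "class_fun n f \<Longrightarrow> class_fun n g \<Longrightarrow> class_fun n (\<lambda>x. f x + s * g x)"
  unfolding class_fun_def
proof (intro conjI ballI impI; elim conjE)
  fix x y
  assume "x \<in> states n" "y \<in> states n" "sign (fst x) = sign (fst y)" "snd x = snd y"
    and fg: "\<forall>x\<in>states n. \<forall>y\<in>states n. sign (fst x) = sign (fst y) \<longrightarrow> snd x = snd y \<longrightarrow> f x = f y"
      "\<forall>x\<in>states n. \<forall>y\<in>states n. sign (fst x) = sign (fst y) \<longrightarrow> snd x = snd y \<longrightarrow> g x = g y"
  then have "f x = f y" "g x = g y" by blast+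
  then show "f x + s * g x = f y + s * g y" by simp
qed (simp_all add: sum.distrib sum_distrib_left[symmetric])

lemma sum_reach_act:
  assumes "n > 0" "v \<in> moves"
  shows "(\<Sum>x\<in>reach n. h (act n x v)) = (\<Sum>x\<in>reach n. h x)"
proof (rule sum.reindex_bij_witness[of _ "\<lambda>x. act n x (- v)" "\<lambda>x. act n x v"])
  fix x assume x: "x \<in> reach n"
  then have xs: "x \<in> states n" using reach_subset[OF assms(1)] by blast
  show "act n (act n x v) (- v) = x" "act n (act n x (- v)) v = x"
    using act_inverse[OF assms(1) xs] act_inverse'[OF assms(1) xs] by auto
  show "act n x v \<in> reach n" "act n x (- v) \<in> reach n"
    using act_in_reach[OF x] assms(2) uminus_moves by auto
qed simp

lemma class_fun_avg:
  assumes "n > 0" "class_fun n f"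
  shows "class_fun n (avg n f)"
  unfolding class_fun_def
proof (intro conjI ballI impI)
  fix x assume x: "x \<in> states n - reach n"
  have "f (act n x v) = 0" if "v \<in> moves" for v
    using x act_in_reach_iff[OF assms(1) _ that] act_in_states[OF assms(1)] assms(2)
    by (simp add: class_fun_def)
  then show "avg n f x = 0" by (simp add: avg_def)
next
  have "(\<Sum>x\<in>reach n. avg n f x) = (\<Sum>v\<in>moves. \<Sum>x\<in>reach n. f (act n x v)) / 5"
    unfolding avg_def by (subst sum.swap) (simp add: sum_divide_distrib)
  also have "\<dots> = (\<Sum>v\<in>moves. \<Sum>x\<in>reach n. f x) / 5"
    by (intro arg_cong2[where f = "(/)"] sum.cong[OF refl sum_reach_act[OF assms(1)]]) auto
  also have "\<dots> = 0" using assms(2) by (simp add: class_fun_def)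
  finally show "(\<Sum>x\<in>reach n. avg n f x) = 0" .
next
  fix x y assume xy: "x \<in> states n" "y \<in> states n" "sign (fst x) = sign (fst y)" "snd x = snd y"
  have "f (act n x v) = f (act n y v)" for v
  proof -
    have "permutation (fst x)" "permutation (fst y)" "permutation (slide n v)"
      using xy(1,2) slide_permutes[OF assms(1), of v] permutes_imp_permutation[OF finite_pieces]
      unfolding states_def mem_Times_iff mem_Collect_eq by blast+
    then have "sign (fst (act n x v)) = sign (fst (act n y v))" "snd (act n x v) = snd (act n y v)"
      using xy by (simp_all add: act_def sign_compose)
    then show ?thesis
      using assms(2) act_in_states[OF assms(1)] xy(1,2) by (simp add: class_fun_def)
  qed
  then show "avg n f x = avg n f y" by (simp add: avg_def)
qed

text \<open>The variance of a function with mean zero is an average of squared differences over all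
  right multiplications. A class function cannot tell such a multiplication from a word of length at
  most \<open>4 * n\<close> with the same sign and displacement.\<close>

lemma gap_class_fun:
  assumes n: "n \<ge> 4" and f: "class_fun n f"
  shows "1 / (10 ^ 6 * real n ^ 4) * ip (states n) f f \<le> ip (states n) f f - ip (states n) f (avg n f)"
proof -
  have n0: "n > 0" using n by simp
  let ?G = "reach n"
  have fin: "finite ?G" using finite_reach[OF n0] .
  have sub: "?G \<subseteq> states n" by (rule reach_subset[OF n0])
  define F where "F = ip (states n) f f"
  define D where "D = F - ip (states n) f (avg n f)"
  have En: "energy n f = 10 * D" by (simp add: energy_eq[OF n0] D_def F_def)
  have D0: "D \<ge> 0"
  proof -
    have "energy n f \<ge> 0" unfolding energy_def by (intro sum_nonneg) simp
    then show ?thesis by (simp add: En)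
  qed
  have F: "F = (\<Sum>x\<in>?G. (f x)\<^sup>2)"
    unfolding F_def ip_self using f sub finite_states
    by (intro sum.mono_neutral_right) (auto simp: class_fun_def)
  have "\<forall>y\<in>?G. \<exists>ws. set ws \<subseteq> moves \<and> y = foldl (act n) (start n) ws"
    by (auto simp: reach_def)
  then obtain W where W: "\<And>y. y \<in> ?G \<Longrightarrow> set (W y) \<subseteq> moves \<and> y = foldl (act n) (start n) (W y)"
    by metis
  \<comment> \<open>Group multiplication on \<open>reach n\<close>: the word that leads from
    \<open>start n\<close> to \<open>y\<close> is applied at \<open>x\<close>. Its effect depends
    only on \<open>y\<close>, not on the chosen word.\<close>
  define mul where "mul x y = foldl (act n) x (W y)" for x y
  have mul_eq: "mul x y = (fst x \<circ> word_perm n (W y), wrap n (snd x + sum_list (W y)))" if "x \<in> states n" for x y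
    unfolding mul_def by (rule foldl_act[OF that])
  have y_eq: "y = (word_perm n (W y), wrap n (snd (start n) + sum_list (W y)))" if "y \<in> ?G" for y
    using W[OF that] foldl_act[OF start_in_states[OF n0], of "W y"] by (simp add: start_def)
  have bij: "bij_betw (mul x) ?G ?G" if x: "x \<in> ?G" for x
  proof -
    have xs: "x \<in> states n" using x sub by blast
    have "inj_on (mul x) ?G"
    proof (rule inj_onI)
      fix y z assume y: "y \<in> ?G" and z: "z \<in> ?G" and eq: "mul x y = mul x z"
      have "fst x \<circ> word_perm n (W y) = fst x \<circ> word_perm n (W z)"
        "wrap n (sum_list (W y) + snd x) = wrap n (sum_list (W z) + snd x)"
        using eq mul_eq[OF xs] by (simp_all add: add.commute)
      moreover have "inj (fst x)" using xs by (auto simp: states_def intro: permutes_inj)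
      ultimately have 1: "word_perm n (W y) = word_perm n (W z)"
        and "wrap n (sum_list (W y)) = wrap n (sum_list (W z))"
        by (simp_all add: wrap_cancel fun_eq_iff inj_eq)
      then have "wrap n (sum_list (W y) + snd (start n)) = wrap n (sum_list (W z) + snd (start n))"
        by (simp add: wrap_cancel)
      then show "y = z" using y_eq[OF y] y_eq[OF z] 1 by (simp add: add.commute)
    qed
    moreover have "mul x ` ?G \<subseteq> ?G"
      using foldl_act_in_reach[OF x] W by (auto simp: mul_def)
    ultimately show ?thesis using fin by (simp add: bij_betw_def endo_inj_surj)
  qed
  have upper: "(\<Sum>x\<in>?G. (f x - f (mul x y))\<^sup>2) \<le> (real (4 * n))\<^sup>2 * energy n f" if y: "y \<in> ?G" for y
  proof -
    obtain us where us: "set us \<subseteq> moves" "length us \<le> 4 * n" "sign (word_perm n us) = sign (word_perm n (W y))"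
      "wrap n (sum_list us) = wrap n (sum_list (W y))"
      using short_word[OF n0] W[OF y] by blast
    have "f (mul x y) = f (foldl (act n) x us)" if x: "x \<in> states n" for x
    proof -
      have perm: "permutation (fst x)" "permutation (word_perm n us)" "permutation (word_perm n (W y))"
        using x word_perm_permutes[OF n0] permutes_imp_permutation[OF finite_pieces]
        by (auto simp: states_def)
      have "sign (fst (mul x y)) = sign (fst (foldl (act n) x us))"
        unfolding mul_eq[OF x] foldl_act[OF x] using perm us(3) by (simp add: sign_compose)
      moreover have "snd (mul x y) = snd (foldl (act n) x us)"
        using us(4) wrap_cancel[of n "sum_list us" "snd x" "sum_list (W y)"]
        unfolding mul_eq[OF x] foldl_act[OF x] by (simp add: add.commute)
      moreover have "mul x y \<in> states n" "foldl (act n) x us \<in> states n"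
        unfolding mul_def by (intro foldl_act_in_states[OF n0 x])+
      ultimately show ?thesis using f unfolding class_fun_def by blast
    qed
    then have "(\<Sum>x\<in>?G. (f x - f (mul x y))\<^sup>2) = (\<Sum>x\<in>?G. (f x - f (foldl (act n) x us))\<^sup>2)"
      using sub by (intro sum.cong refl) auto
    also have "\<dots> \<le> (\<Sum>x\<in>states n. (f x - f (foldl (act n) x us))\<^sup>2)"
      using sub finite_states by (intro sum_mono2) auto
    also have "\<dots> \<le> (real (4 * n))\<^sup>2 * energy n f" by (rule sum_word_le[OF n0 us(1,2)])
    finally show ?thesis .
  qed
  \<comment> \<open>As \<open>mul x\<close> permutes \<open>reach n\<close>, the cross term is the
    sum of \<open>f\<close> over \<open>reach n\<close>, which vanishes.\<close>
  have row: "(\<Sum>y\<in>?G. (f x - f (mul x y))\<^sup>2) = real (card ?G) * (f x)\<^sup>2 + F" if x: "x \<in> ?G" for x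
  proof -
    have reindex: "(\<Sum>y\<in>?G. h (mul x y)) = (\<Sum>y\<in>?G. h y)" for h :: "_ \<Rightarrow> real"
      by (rule sum.reindex_bij_betw[OF bij[OF x]])
    have "(\<Sum>y\<in>?G. (f x - f (mul x y))\<^sup>2) =
        (\<Sum>y\<in>?G. (f x)\<^sup>2) - 2 * f x * (\<Sum>y\<in>?G. f (mul x y)) + (\<Sum>y\<in>?G. (f (mul x y))\<^sup>2)"
      by (simp add: power2_diff sum.distrib sum_subtractf sum_distrib_left)
    also have "(\<Sum>y\<in>?G. f (mul x y)) = 0" using reindex[of f] f by (simp add: class_fun_def)
    also have "(\<Sum>y\<in>?G. (f (mul x y))\<^sup>2) = F" using reindex[of "\<lambda>z. (f z)\<^sup>2"] by (simp add: F)
    finally show ?thesis by simp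
  qed
  have "2 * real (card ?G) * F = (\<Sum>x\<in>?G. real (card ?G) * (f x)\<^sup>2 + F)"
    by (simp add: sum.distrib F sum_distrib_left[symmetric])
  also have "\<dots> = (\<Sum>x\<in>?G. \<Sum>y\<in>?G. (f x - f (mul x y))\<^sup>2)" using row by simp
  also have "\<dots> = (\<Sum>y\<in>?G. \<Sum>x\<in>?G. (f x - f (mul x y))\<^sup>2)" by (rule sum.swap)
  also have "\<dots> \<le> (\<Sum>y\<in>?G. (real (4 * n))\<^sup>2 * energy n f)" by (intro sum_mono upper)
  also have "\<dots> = real (card ?G) * (160 * (real n)\<^sup>2 * D)" by (simp add: En power2_eq_square)
  finally have "real (card ?G) * (2 * F) \<le> real (card ?G) * (160 * (real n)\<^sup>2 * D)" by simp
  moreover have "card ?G > 0" using start_in_reach fin by (auto simp: card_gt_0_iff)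
  \<comment> \<open>80 is half of \<open>16 * 10\<close>, from \<open>(4 * n)^2\<close> and
    \<open>energy n f = 10 * D\<close>; it is far below the common constant
    \<open>10 ^ 6\<close>.\<close>
  ultimately have "F \<le> 80 * ((real n)\<^sup>2 * D)" by (simp add: mult_ac)
  also have "\<dots> \<le> 10 ^ 6 * (real n ^ 4 * D)"
  proof (intro mult_mono mult_right_mono D0)
    show "(real n)\<^sup>2 \<le> real n ^ 4" using n by (intro power_increasing) auto
  qed (use D0 in auto)
  finally show ?thesis using n0 by (simp add: F_def D_def field_simps)
qed

section \<open>Decomposition by levels and mixing\<close>

lemma sum_rsign:
  assumes "finite X" "card X \<ge> 2"
  shows "(\<Sum>p\<in>Sym X. rsign p) = 0"
proof -
  obtain a b where ab: "a \<in> X" "b \<in> X" "a \<noteq> b"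
    using assms by (metis card_le_Suc0_iff_eq not_less_eq_eq numeral_2_eq_2)
  let ?t = "transp a b"
  have t: "?t permutes X" using ab by (intro permutes_swap_id)
  have "(\<Sum>p\<in>Sym X. rsign p) = (\<Sum>p\<in>Sym X. rsign (p \<circ> ?t))"
    by (rule sum_permutations_compose_right[OF t])
  also have "\<dots> = (\<Sum>p\<in>Sym X. - rsign p)"
    using ab(3) by (intro sum.cong refl) (simp add: rsign_comp[OF assms(1) _ t] sign_swap_id)
  finally show ?thesis by (simp add: sum_negf)
qed

text \<open>\<open>D k\<close> has the same inner products as the point mass at \<open>q\<close>
  with all indicators of length at most \<open>k\<close>, twisted or not, so consecutive differences
  are orthogonal to these. At \<open>k = m\<close> the indicators determine every value, which makes
  \<open>D m\<close> the point mass itself.\<close>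

lemma point_decomposition:
  fixes X :: "'a set"
  assumes "finite X" "card X = m" "m \<ge> 2" "q permutes X"
  obtains D where "D 0 = (\<lambda>p. (1 + rsign p * rsign q) / fact m)"
    and "\<And>k. ip (Sym X) (D k) (D k) \<le> 2 * (real m + 1) ^ (2 * k) / fact m"
    and "\<And>k. twisted_low_free X (Suc k) (\<lambda>p. D (Suc k) p - D k p)"
    and "\<And>p. p permutes X \<Longrightarrow> D m p = (if p = q then 1 else 0)"
proof -
  define good where "good k d \<longleftrightarrow> (\<forall>a b. (a, b) \<in> cells X (Suc k) \<longrightarrow> ip (Sym X) d (agree a b) = agree a b q \<and>
      ip (Sym X) (\<lambda>p. rsign p * d p) (agree a b) = rsign q * agree a b q) \<and>
    ip (Sym X) d d \<le> 2 * (real m + 1) ^ (2 * k) / fact m" for k d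
  have "\<forall>k. \<exists>d. good k d"
    using delta_projection_cells[OF assms(1,4)] unfolding good_def assms(2) by blast
  then obtain d where d: "\<And>k. good k (d k)" by metis
  define d0 :: "('a \<Rightarrow> 'a) \<Rightarrow> real" where "d0 = (\<lambda>p. (1 + rsign p * rsign q) / fact m)"
  have card_Sym: "real (card (Sym X)) = fact m"
    using card_permutations[OF assms(2,1)] by simp
  have rs: "(\<Sum>p\<in>Sym X. rsign p) = 0" using sum_rsign[OF assms(1)] assms(2,3) by simp
  have rs': "(\<Sum>p\<in>Sym X. rsign p * rsign q) = 0" unfolding sum_distrib_right[symmetric] rs by simp
  have s1: "(\<Sum>p\<in>Sym X. d0 p) = 1"
    unfolding d0_def sum_divide_distrib[symmetric] sum.distrib rs' using card_Sym by simp
  have "(\<Sum>p\<in>Sym X. rsign p * d0 p) = (\<Sum>p\<in>Sym X. (rsign p + rsign q) / fact m)"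
    by (intro sum.cong refl) (simp add: d0_def field_simps)
  also have "\<dots> = rsign q"
    unfolding sum_divide_distrib[symmetric] sum.distrib rs using card_Sym by simp
  finally have s2: "(\<Sum>p\<in>Sym X. rsign p * d0 p) = rsign q" .
  have "ip (Sym X) d0 d0 = (\<Sum>p\<in>Sym X. (2 + 2 * (rsign p * rsign q)) / (fact m * fact m))"
    unfolding ip_def
  proof (intro sum.cong refl)
    fix p :: "'a \<Rightarrow> 'a"
    have "(rsign p * rsign q) * (rsign p * rsign q) = (1 :: real)"
      by (simp add: mult_ac)
    then have "(1 + rsign p * rsign q) * (1 + rsign p * rsign q) = 2 + 2 * (rsign p * rsign q :: real)"
      by (simp add: algebra_simps)
    then show "d0 p * d0 p = (2 + 2 * (rsign p * rsign q)) / (fact m * fact m)"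
      by (simp add: d0_def)
  qed
  also have "\<dots> = 2 / fact m"
    unfolding sum_divide_distrib[symmetric] sum.distrib sum_distrib_left[symmetric] rs'
    using card_Sym by simp
  finally have s3: "ip (Sym X) d0 d0 = 2 / fact m" .
  have good0: "good 0 d0"
  proof -
    have "ip (Sym X) f (agree [] []) = (\<Sum>p\<in>Sym X. f p)" for f :: "('a \<Rightarrow> 'a) \<Rightarrow> real"
      by (simp add: ip_def agree_def)
    then show ?thesis using s1 s2 s3 by (auto simp: good_def cells_def agree_def)
  qed
  \<comment> \<open>Level 0 is chosen explicitly, because it must be recognised as a function of the
    sign.\<close>
  define D where "D k = (if k = 0 then d0 else d k)" for k
  have D: "good k (D k)" for k using d good0 by (simp add: D_def)
  have low: "twisted_low_free X (Suc k) (\<lambda>p. D (Suc k) p - D k p)" for k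
    unfolding twisted_low_free_def low_free_def
  proof (intro conjI allI impI)
    fix a b assume ab: "(a, b) \<in> cells X (Suc k)"
    then have ab': "(a, b) \<in> cells X (Suc (Suc k))" using cells_mono[of "Suc k" "Suc (Suc k)" X] by auto
    show "ip (Sym X) (\<lambda>p. D (Suc k) p - D k p) (agree a b) = 0"
      using D[of k] D[of "Suc k"] ab ab' by (simp add: good_def ip_diff_left)
    have "ip (Sym X) (\<lambda>p. rsign p * D (Suc k) p - rsign p * D k p) (agree a b) = 0"
      using D[of k] D[of "Suc k"] ab ab' by (simp add: good_def ip_diff_left)
    then show "ip (Sym X) (\<lambda>p. rsign p * (D (Suc k) p - D k p)) (agree a b) = 0"
      by (simp add: right_diff_distrib)
  qed
  have delta: "D m p = (if p = q then 1 else 0)" if p: "p permutes X" for p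
  proof -
    have "ip (Sym X) (\<lambda>p. if p = q then 1 else 0) g = g q" for g
      using assms(4) finite_permutations[OF assms(1)]
      by (simp add: ip_def if_distrib if_distribR cong: if_cong)
    then have "low_free X (Suc m) (\<lambda>p. D m p - (if p = q then 1 else 0))"
      using D[of m] unfolding low_free_def good_def by (simp add: ip_diff_left)
    from low_free_eq_0[OF assms(1) this _ p] assms(2) show ?thesis by simp
  qed
  show ?thesis
    by (rule that[of D]) (use D low delta in \<open>auto simp: good_def D_def d0_def\<close>)
qed

lemma L2_set_sum_le: "L2_set (\<lambda>x. \<Sum>i\<in>I. F i x) A \<le> (\<Sum>i\<in>I. L2_set (F i) A)"
proof (induction I rule: infinite_finite_induct)
  case (insert i I)
  then show ?case
    using L2_set_triangle_ineq[of "F i" "\<lambda>x. \<Sum>i\<in>I. F i x" A] by simp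
qed (simp_all add: L2_set_def)

section \<open>The uniform measure and powers of the averaging operator\<close>

definition unif :: "nat \<Rightarrow> state \<Rightarrow> real" where
  "unif n x = (if x \<in> reach n then 1 / real (card (reach n)) else 0)"

lemma card_reach_pos: "n > 0 \<Longrightarrow> card (reach n) > 0"
  using start_in_reach finite_reach by (auto simp: card_gt_0_iff)

lemma card_reach_le:
  assumes "n > 0"
  shows "real (card (reach n)) \<le> (real n)\<^sup>2 * fact (card (pieces n))"
proof -
  have "card (reach n) \<le> card (states n)"
    by (intro card_mono finite_states reach_subset assms)
  also have "\<dots> = fact (card (pieces n)) * (n * n)"
    by (simp add: states_def card_cartesian_product card_board card_permutations)
  finally have "real (card (reach n)) \<le> real (fact (card (pieces n)) * (n * n))"
    by (rule of_nat_mono)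
  then show ?thesis by (simp add: power2_eq_square mult_ac)
qed

lemma ip_unif:
  assumes "n > 0"
  shows "ip (states n) (unif n) h = (\<Sum>x\<in>reach n. h x) / real (card (reach n))"
proof -
  have "ip (states n) (unif n) h = (\<Sum>x\<in>reach n. unif n x * h x)"
    unfolding ip_def using reach_subset[OF assms] finite_states
    by (intro sum.mono_neutral_right) (auto simp: unif_def)
  also have "\<dots> = (\<Sum>x\<in>reach n. h x) / real (card (reach n))"
    by (simp add: unif_def sum_divide_distrib)
  finally show ?thesis .
qed

lemma ip_unif_unif: "n > 0 \<Longrightarrow> ip (states n) (unif n) (unif n) = 1 / real (card (reach n))"
  using card_reach_pos[of n] by (simp add: ip_unif unif_def)

lemma avg_cong: "n > 0 \<Longrightarrow> (\<And>x. x \<in> states n \<Longrightarrow> f x = g x) \<Longrightarrow> x \<in> states n \<Longrightarrow> avg n f x = avg n g x"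
  by (simp add: avg_def act_in_states)

lemma avg_pow_cong:
  assumes "n > 0" "\<And>x. x \<in> states n \<Longrightarrow> f x = g x" "x \<in> states n"
  shows "(avg n ^^ N) f x = (avg n ^^ N) g x"
  using assms(3)
proof (induction N arbitrary: x)
  case (Suc N)
  then show ?case using avg_cong[OF assms(1), of "(avg n ^^ N) f" "(avg n ^^ N) g"] by simp
qed (use assms(2) in simp)

lemma avg_pow_linear: "(avg n ^^ N) (\<lambda>x. g x + s * h x) = (\<lambda>x. (avg n ^^ N) g x + s * (avg n ^^ N) h x)"
  by (induction N) (simp_all add: avg_linear)

lemma avg_pow_sum: "(avg n ^^ N) (\<lambda>x. \<Sum>i\<in>I. F i x) = (\<lambda>x. \<Sum>i\<in>I. (avg n ^^ N) (F i) x)"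
proof (induction I rule: infinite_finite_induct)
  case (insert i I)
  then show ?case using avg_pow_linear[of N n "F i" 1 "\<lambda>x. \<Sum>i\<in>I. F i x"] by simp
qed (use avg_pow_linear[of N n "\<lambda>x. 0" "-1" "\<lambda>x. 0"] in simp_all)

lemma avg_pow_adjoint:
  "n > 0 \<Longrightarrow> ip (states n) ((avg n ^^ N) g) h = ip (states n) g ((avg n ^^ N) h)"
  by (induction N arbitrary: g h) (simp_all add: avg_adjoint funpow_swap1)

lemma avg_unif:
  assumes "n > 0" "x \<in> states n"
  shows "(avg n ^^ N) (unif n) x = unif n x"
  using assms(2)
proof (induction N arbitrary: x)
  case (Suc N)
  have "(avg n ^^ Suc N) (unif n) x = avg n (unif n) x"
    using avg_cong[OF assms(1) Suc.IH Suc.prems] by simp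
  also have "\<dots> = unif n x"
    using act_in_reach_iff[OF assms(1) Suc.prems] finite_moves
    by (simp add: avg_def unif_def)
  finally show ?case .
qed simp

text \<open>The norm bound on level \<open>k\<close> comes from its dimension: up to sign there are at most
  \<open>(m + 1)\<close> to the power \<open>2 k\<close> indicators of length at most \<open>k\<close>.\<close>

lemma level_decomposition:
  assumes n: "n \<ge> 4" and x0: "x0 \<in> reach n"
  obtains h where "class_fun n (h 0)"
    and "\<And>k. level_free n (Suc k) (h (Suc k))"
    and "\<And>x. x \<in> states n \<Longrightarrow> point x0 x - unif n x = (\<Sum>k\<le>card (pieces n). h k x)"
    and "\<And>k. sqrt (real (card (reach n))) * L2_set (h k) (states n) \<le> 3 * real n ^ (2 * k + 1)"
proof -
  define m where "m = card (pieces n)"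
  have n0: "n > 0" using n by simp
  have nn: "16 \<le> n * n" using mult_le_mono[OF n n] by simp
  have m: "m \<ge> 2" "real m + 1 = (real n)\<^sup>2"
  proof -
    have "real m = real (n * n) - 1" using nn by (simp add: m_def card_pieces[OF n0] of_nat_diff del: of_nat_mult)
    then show "real m + 1 = (real n)\<^sup>2" by (simp add: power2_eq_square)
    show "m \<ge> 2" using nn by (simp add: m_def card_pieces[OF n0])
  qed
  obtain q e where qe: "x0 = (q, e)" "q permutes pieces n" "e \<in> board n"
    using x0 reach_subset[OF n0] by (auto simp: states_def)
  obtain D where D0: "D 0 = (\<lambda>p. (1 + rsign p * rsign q) / fact m)"
    and D_norm: "\<And>k. ip (Sym (pieces n)) (D k) (D k) \<le> 2 * (real m + 1) ^ (2 * k) / fact m"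
    and D_low: "\<And>k. twisted_low_free (pieces n) (Suc k) (\<lambda>p. D (Suc k) p - D k p)"
    and D_m: "\<And>p. p permutes pieces n \<Longrightarrow> D m p = (if p = q then 1 else 0)"
  proof -
    show thesis
      by (rule point_decomposition[OF finite_pieces m_def[symmetric] m(1) qe(2)]) (rule that; assumption)
  qed
  define E where "E k x = (if snd x = e then D k (fst x) else 0)" for k and x :: "state"
  \<comment> \<open>The levels telescope to the point mass, and the uniform measure is subtracted at
    level 0 only.\<close>
  define h where "h k x = (case k of 0 \<Rightarrow> E 0 x - unif n x | Suc l \<Rightarrow> E (Suc l) x - E l x)" for k x
  define R where "R = sqrt (real (card (reach n)))"
  have R: "R > 0" using card_reach_pos[OF n0] by (simp add: R_def)
  have E_norm: "R * L2_set (E k) (states n) \<le> sqrt 2 * real n ^ (2 * k + 1)" for k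
  proof -
    have "ip (states n) (E k) (E k) = (\<Sum>e'\<in>board n. if e' = e then ip (Sym (pieces n)) (D k) (D k) else 0)"
      unfolding ip_states by (intro sum.cong refl) (auto simp: E_def ip_def)
    also have "\<dots> = ip (Sym (pieces n)) (D k) (D k)" using qe(3) by simp
    also have "\<dots> \<le> 2 * ((real n)\<^sup>2) ^ (2 * k) / fact m" using D_norm[of k] by (simp add: m)
    finally have 1: "ip (states n) (E k) (E k) \<le> 2 * ((real n)\<^sup>2) ^ (2 * k) / fact m" .
    have "R * L2_set (E k) (states n) = sqrt (real (card (reach n)) * ip (states n) (E k) (E k))"
      by (simp add: R_def L2_set_ip real_sqrt_mult)
    \<comment> \<open>The factorial in the bound for \<open>card (reach n)\<close> cancels the one
      in \<open>D_norm\<close>; \<open>n^2\<close> for the board and the dimension bound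
      \<open>2 n^(4 k)\<close> remain.\<close>
    also have "\<dots> \<le> sqrt (((real n)\<^sup>2 * fact m) * (2 * ((real n)\<^sup>2) ^ (2 * k) / fact m))"
      using 1 card_reach_le[OF n0] by (intro real_sqrt_le_mono mult_mono) (auto simp: m_def)
    also have "((real n)\<^sup>2 * fact m) * (2 * ((real n)\<^sup>2) ^ (2 * k) / fact m) = 2 * (real n ^ (2 * k + 1))\<^sup>2"
      by (simp add: power2_eq_square power_mult_distrib power_add mult_ac flip: power_mult)
    also have "sqrt (2 * (real n ^ (2 * k + 1))\<^sup>2) = sqrt 2 * real n ^ (2 * k + 1)"
      by (simp add: real_sqrt_mult)
    finally show ?thesis .
  qed
  have unif_norm: "R * L2_set (unif n) (states n) = 1"
    using card_reach_pos[OF n0] by (simp add: R_def L2_set_ip ip_unif_unif[OF n0] real_sqrt_divide)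
  have L2_diff: "L2_set (\<lambda>x. f x - g x) (states n) \<le> L2_set f (states n) + L2_set g (states n)" for f g
    using L2_set_triangle_ineq[of f "\<lambda>x. - g x" "states n"] by (simp add: L2_set_def)
  \<comment> \<open>Each \<open>h k\<close> is a difference of two functions, so the constant 3 is
    twice this 3/2.\<close>
  have sqrt2: "sqrt 2 \<le> 3 / 2" by (rule real_le_lsqrt) (auto simp: power2_eq_square)
  have n1: "1 \<le> real n" using n by simp
  show ?thesis
  proof (rule that[of h])
    fix k
    show "sqrt (real (card (reach n))) * L2_set (h k) (states n) \<le> 3 * real n ^ (2 * k + 1)"
    proof (cases k)
      case 0
      have "h 0 = (\<lambda>x. E 0 x - unif n x)" by (simp add: h_def fun_eq_iff)
      then have "R * L2_set (h 0) (states n) \<le> R * (L2_set (E 0) (states n) + L2_set (unif n) (states n))"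
        using R L2_diff[of "E 0" "unif n"] by (intro mult_left_mono) auto
      also have "\<dots> \<le> sqrt 2 * real n + 1" using E_norm[of 0] unif_norm by (simp add: distrib_left)
      also have "\<dots> \<le> 3 / 2 * real n + real n" using n1 sqrt2 by (intro add_mono mult_right_mono) auto
      also have "\<dots> \<le> 3 * real n" by simp
      finally show ?thesis by (simp add: R_def 0)
    next
      case (Suc l)
      have "h k = (\<lambda>x. E (Suc l) x - E l x)" by (simp add: h_def fun_eq_iff Suc)
      then have "R * L2_set (h k) (states n) \<le> R * (L2_set (E (Suc l)) (states n) + L2_set (E l) (states n))"
        using R L2_diff[of "E (Suc l)" "E l"] by (intro mult_left_mono) auto
      also have "\<dots> \<le> sqrt 2 * real n ^ (2 * Suc l + 1) + sqrt 2 * real n ^ (2 * l + 1)"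
        using E_norm[of l] E_norm[of "Suc l"] by (simp add: distrib_left)
      also have "\<dots> \<le> 3 / 2 * real n ^ (2 * Suc l + 1) + 3 / 2 * real n ^ (2 * Suc l + 1)"
        using n1 sqrt2 by (intro add_mono mult_mono power_increasing) auto
      finally show ?thesis by (simp add: R_def Suc)
    qed
  next
    fix k
    show "level_free n (Suc k) (h (Suc k))"
      unfolding level_free_def
    proof
      fix e' assume "e' \<in> board n"
      have "(\<lambda>p. h (Suc k) (p, e')) = (\<lambda>p. (if e' = e then 1 else 0) * (D (Suc k) p - D k p))"
        by (auto simp: h_def E_def)
      then show "twisted_low_free (pieces n) (Suc k) (\<lambda>p. h (Suc k) (p, e'))"
        by (simp only: twisted_low_free_scale[OF D_low])
    qed
  next
    fix x assume x: "x \<in> states n"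
    have "(\<Sum>k\<le>l. h k x) = E l x - unif n x" for l
      by (induction l) (simp_all add: h_def)
    moreover have "E m x = point x0 x"
      using x D_m by (auto simp: E_def point_def states_def qe prod_eq_iff)
    ultimately show "point x0 x - unif n x = (\<Sum>k\<le>card (pieces n). h k x)" by (simp add: m_def)
  next
    \<comment> \<open>The factor \<open>1 + rsign p * rsign q\<close> vanishes unless the signs
      agree, and then \<open>reach_sign\<close> makes the state reachable.\<close>
    have E0: "E 0 x = 0" if x: "x \<in> states n - reach n" for x
    proof (cases "snd x = e")
      case True
      have "sign (fst x) \<noteq> sign q"
        using reach_sign[OF n, of q e "fst x"] x x0 qe True by (auto simp: states_def)
      then have "rsign (fst x) * rsign q = - 1"
        by (cases "fst x" rule: sign_cases; cases q rule: sign_cases) simp_all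
      then show ?thesis by (simp add: E_def D0)
    qed (simp add: E_def)
    show "class_fun n (h 0)"
      unfolding class_fun_def
    proof (intro conjI ballI impI)
      fix x assume "x \<in> states n - reach n"
      then show "h 0 x = 0" using E0 by (simp add: h_def unif_def)
    next
      have "(\<Sum>x\<in>reach n. E 0 x) = (\<Sum>x\<in>states n. E 0 x)"
        using E0 reach_subset[OF n0] finite_states by (intro sum.mono_neutral_left) auto
      also have "\<dots> = (\<Sum>e'\<in>board n. if e' = e then \<Sum>p\<in>Sym (pieces n). D 0 p else 0)"
        unfolding sum_states by (intro sum.cong refl) (simp add: E_def)
      also have "\<dots> = (\<Sum>p\<in>Sym (pieces n). D 0 p)" using qe(3) by simp
      also have "\<dots> = ((\<Sum>p\<in>Sym (pieces n). 1) + (\<Sum>p\<in>Sym (pieces n). rsign p) * rsign q) / fact m"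
        unfolding D0 sum_divide_distrib[symmetric] sum.distrib sum_distrib_right ..
      also have "\<dots> = 1"
        using sum_rsign[OF finite_pieces, of n] m(1) card_permutations[OF m_def[symmetric] finite_pieces]
        by (simp add: m_def)
      finally show "(\<Sum>x\<in>reach n. h 0 x) = 0"
        using card_reach_pos[OF n0] by (simp add: h_def sum_subtractf unif_def)
    next
      fix x y assume xy: "x \<in> states n" "y \<in> states n" "sign (fst x) = sign (fst y)" "snd x = snd y"
      have "x \<in> reach n \<longleftrightarrow> y \<in> reach n"
        using reach_sign[OF n, of "fst x" "snd x" "fst y"] reach_sign[OF n, of "fst y" "snd y" "fst x"] xy
        by (auto simp: states_def)
      then show "h 0 x = h 0 y" using xy by (simp add: h_def E_def D0 unif_def)
    qed
  qed
qed

section \<open>Decay on all levels and the doubling of time\<close>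

definition mix_time :: "nat \<Rightarrow> nat" where
  "mix_time n = nat \<lceil>4 * 10 ^ 6 * real n ^ 4 * ln (real n)\<rceil>"

lemma L2_set_avg_level:
  assumes "n \<ge> 4" "k \<ge> 1" "k \<le> card (pieces n)" "level_free n k f"
  shows "L2_set ((avg n ^^ N) f) (states n) \<le> (1 - real k / (10 ^ 6 * real n ^ 4)) ^ N * L2_set f (states n)"
proof (rule avg_contract[where U = "level_free n k"])
  have n0: "n > 0" using assms(1) by simp
  have "real k \<le> real (n * n)" using assms(3) card_pieces[OF n0] by (simp del: of_nat_mult)
  also have "\<dots> = (real n)\<^sup>2" by (simp add: power2_eq_square)
  also have "\<dots> \<le> real n ^ 4" using assms(1) by (intro power_increasing) auto
  finally have "real k / (10 ^ 6 * real n ^ 4) \<le> real n ^ 4 / (10 ^ 6 * real n ^ 4)"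
    by (rule divide_right_mono) simp
  also have "\<dots> \<le> 2 / 5" using n0 by simp
  finally show "real k / (10 ^ 6 * real n ^ 4) \<le> 2 / 5" .
qed (use assms level_free_avg level_free_add gap_level in auto)

lemma L2_set_avg_class:
  assumes "n \<ge> 4" "class_fun n f"
  shows "L2_set ((avg n ^^ N) f) (states n) \<le> (1 - 1 / (10 ^ 6 * real n ^ 4)) ^ N * L2_set f (states n)"
proof (rule avg_contract[where U = "class_fun n"])
  have "1 / (10 ^ 6 * real n ^ 4) \<le> real n ^ 4 / (10 ^ 6 * real n ^ 4)"
    using assms(1) by (intro divide_right_mono) simp_all
  also have "\<dots> \<le> 2 / 5" using assms(1) by simp
  finally show "1 / (10 ^ 6 * real n ^ 4) \<le> 2 / 5" .
qed (use assms class_fun_avg class_fun_add gap_class_fun in auto)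

text \<open>The starting point is arbitrary in \<open>reach n\<close>, because the doubling of time
  uses the bound from both ends of the path.\<close>

lemma L2_set_walk_bound:
  assumes n: "n \<ge> 4" and x0: "x0 \<in> reach n"
  shows "sqrt (real (card (reach n))) *
    L2_set ((avg n ^^ mix_time n) (\<lambda>x. point x0 x - unif n x)) (states n) \<le> 12 / real n"
proof -
  define m where "m = card (pieces n)"
  define N where "N = mix_time n"
  define \<eta> where "\<eta> = 1 / (10 ^ 6 * real n ^ 4)"
  define R where "R = sqrt (real (card (reach n)))"
  have n0: "n > 0" and n1: "real n \<ge> 4" using n by auto
  obtain h where h0: "class_fun n (h 0)"
    and hS: "\<And>k. level_free n (Suc k) (h (Suc k))"
    and h_sum: "\<And>x. x \<in> states n \<Longrightarrow> point x0 x - unif n x = (\<Sum>k\<le>m. h k x)"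
    and h_norm: "\<And>k. R * L2_set (h k) (states n) \<le> 3 * real n ^ (2 * k + 1)"
  proof -
    show thesis
      by (rule level_decomposition[OF n x0, folded m_def R_def]) (rule that; assumption)
  qed
  \<comment> \<open>The factor \<open>4 * 10 ^ 6\<close> in \<open>mix_time\<close> is chosen for
    this: \<open>n^(-4 k)\<close> against the norm \<open>3 n^(2 k + 1)\<close> leaves
    \<open>3 n^(1 - 2 k)\<close>, summable and small for \<open>k \<ge> 1\<close>. A factor 3
    instead of 4 would leave level 1 at constant size.\<close>
  have decay: "(1 - real k * \<eta>) ^ N \<le> (1 / real n ^ 4) ^ k" if "real k * \<eta> \<le> 1" for k
  proof -
    have "4 * 10 ^ 6 * real n ^ 4 * ln (real n) \<le> real N"
      unfolding N_def mix_time_def by (rule real_nat_ceiling_ge)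
    then have 1: "4 * ln (real n) \<le> \<eta> * real N" using n0 by (simp add: \<eta>_def field_simps)
    have "1 - real k * \<eta> \<le> exp (- (real k * \<eta>))" using exp_ge_add_one_self[of "- (real k * \<eta>)"] by simp
    then have "(1 - real k * \<eta>) ^ N \<le> exp (- (real k * \<eta>)) ^ N"
      using that by (intro power_mono) auto
    also have "\<dots> = exp (- (\<eta> * real N)) ^ k" by (simp flip: exp_of_nat_mult add: mult_ac)
    also have "\<dots> \<le> exp (- (4 * ln (real n))) ^ k" using 1 by (intro power_mono) auto
    also have "exp (- (4 * ln (real n))) = 1 / real n ^ 4"
    proof -
      have "exp (4 * ln (real n)) = real n ^ 4"
        using exp_of_nat_mult[of 4 "ln (real n)"] n0 by simp
      then show ?thesis by (simp add: exp_minus field_simps)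
    qed
    finally show ?thesis .
  qed
  have k\<eta>: "real k * \<eta> \<le> 1" if "k \<le> m \<or> k = 1" for k
  proof -
    have "k \<le> n * n" using that n0 by (auto simp: m_def card_pieces)
    then have "real k \<le> (real n)\<^sup>2" by (simp add: power2_eq_square flip: of_nat_mult)
    also have "\<dots> \<le> real n ^ 4" using n by (intro power_increasing) auto
    finally have "real k / (10 ^ 6 * real n ^ 4) \<le> real n ^ 4 / (10 ^ 6 * real n ^ 4)"
      by (rule divide_right_mono) simp
    also have "\<dots> \<le> 1" using n0 by simp
    finally show ?thesis by (simp add: \<eta>_def)
  qed
  have level: "R * L2_set ((avg n ^^ N) (h k)) (states n) \<le> 6 / real n * (1 / 2) ^ k" if k: "k \<le> m" for k
  proof (cases k)
    case 0
    \<comment> \<open>Level 0 decays through the gap for class functions, which is that of level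
      1.\<close>
    have "L2_set ((avg n ^^ N) (h 0)) (states n) \<le> (1 - real 1 * \<eta>) ^ N * L2_set (h 0) (states n)"
      using L2_set_avg_class[OF n h0, of N] by (simp add: \<eta>_def)
    also have "\<dots> \<le> (1 / real n ^ 4) ^ 1 * L2_set (h 0) (states n)"
      by (intro mult_right_mono decay k\<eta>) auto
    finally have "R * L2_set ((avg n ^^ N) (h 0)) (states n) \<le> 1 / real n ^ 4 * (R * L2_set (h 0) (states n))"
      using mult_left_mono[of _ _ R] by (fastforce simp: R_def mult_ac)
    also have "\<dots> \<le> 1 / real n ^ 4 * (3 * real n)"
      using h_norm[of 0] by (intro mult_left_mono) auto
    also have "\<dots> = 3 / real n * (1 / (real n)\<^sup>2)"
      using n0 by (simp add: field_simps power2_eq_square power4_eq_xxxx)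
    also have "\<dots> \<le> 3 / real n * 1" using n1 by (intro mult_left_mono) auto
    also have "\<dots> \<le> 6 / real n" using n0 by (simp add: field_simps)
    finally show ?thesis by (simp add: 0)
  next
    case (Suc l)
    have "L2_set ((avg n ^^ N) (h k)) (states n) \<le> (1 - real k * \<eta>) ^ N * L2_set (h k) (states n)"
      using L2_set_avg_level[OF n _ _ hS[of l], of N] k by (simp add: \<eta>_def Suc m_def)
    also have "\<dots> \<le> (1 / real n ^ 4) ^ k * L2_set (h k) (states n)"
      by (intro mult_right_mono decay k\<eta>) (use k in auto)
    finally have "R * L2_set ((avg n ^^ N) (h k)) (states n) \<le> (1 / real n ^ 4) ^ k * (R * L2_set (h k) (states n))"
      using mult_left_mono[of _ _ R] by (fastforce simp: R_def mult_ac)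
    also have "\<dots> \<le> (1 / real n ^ 4) ^ k * (3 * real n ^ (2 * k + 1))"
      using h_norm[of k] by (intro mult_left_mono) auto
    also have "\<dots> = 3 / real n * (1 / (real n)\<^sup>2) ^ l"
    proof -
      have "(1 / real n ^ 4) ^ k * real n ^ (2 * k) = (1 / (real n)\<^sup>2) ^ k"
        using n0 by (simp add: power_mult power_mult_distrib[symmetric])
          (simp add: power_divide field_simps flip: power_mult power_add)
      then have "(1 / real n ^ 4) ^ k * (3 * real n ^ (2 * k + 1)) = 3 * real n * (1 / (real n)\<^sup>2) ^ k"
        by (simp add: mult_ac)
      also have "\<dots> = 3 / real n * (1 / (real n)\<^sup>2) ^ l"
        using n0 by (simp add: Suc power2_eq_square field_simps)
      finally show ?thesis .
    qed
    also have "\<dots> \<le> 3 / real n * (1 / 2) ^ l"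
    proof -
      have "(2 :: real) \<le> 4\<^sup>2" by simp
      also have "\<dots> \<le> (real n)\<^sup>2" using n1 by (intro power_mono) auto
      finally have "1 / (real n)\<^sup>2 \<le> 1 / 2" using n0 by (intro divide_left_mono) auto
      then show ?thesis by (intro mult_left_mono power_mono) auto
    qed
    also have "\<dots> = 6 / real n * (1 / 2) ^ k" by (simp add: Suc)
    finally show ?thesis .
  qed
  have "L2_set ((avg n ^^ N) (\<lambda>x. point x0 x - unif n x)) (states n) =
      L2_set (\<lambda>x. \<Sum>k\<le>m. (avg n ^^ N) (h k) x) (states n)"
  proof (intro L2_set_cong refl)
    fix x assume "x \<in> states n"
    then show "(avg n ^^ N) (\<lambda>x. point x0 x - unif n x) x = (\<Sum>k\<le>m. (avg n ^^ N) (h k) x)"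
      using avg_pow_cong[OF n0, of "\<lambda>x. point x0 x - unif n x" "\<lambda>x. \<Sum>k\<le>m. h k x" x N] h_sum
      by (simp add: avg_pow_sum)
  qed
  also have "\<dots> \<le> (\<Sum>k\<le>m. L2_set ((avg n ^^ N) (h k)) (states n))" by (rule L2_set_sum_le)
  finally have "R * L2_set ((avg n ^^ N) (\<lambda>x. point x0 x - unif n x)) (states n) \<le>
      R * (\<Sum>k\<le>m. L2_set ((avg n ^^ N) (h k)) (states n))"
    by (intro mult_left_mono) (auto simp: R_def)
  also have "\<dots> = (\<Sum>k\<le>m. R * L2_set ((avg n ^^ N) (h k)) (states n))" by (rule sum_distrib_left)
  also have "\<dots> \<le> (\<Sum>k\<le>m. 6 / real n * (1 / 2) ^ k)" by (intro sum_mono level) simp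
  also have "\<dots> = 6 / real n * (\<Sum>k\<le>m. (1 / 2) ^ k)" by (simp add: sum_distrib_left)
  also have "\<dots> \<le> 6 / real n * 2"
  proof (intro mult_left_mono)
    have "(\<Sum>k\<le>m. (1 / 2 :: real) ^ k) = 2 - (1 / 2) ^ m" by (induction m) (simp_all add: field_simps)
    then show "(\<Sum>k\<le>m. (1 / 2 :: real) ^ k) \<le> 2" by simp
  qed simp
  finally show ?thesis by (simp add: R_def N_def)
qed

text \<open>Half of the \<open>2 N\<close> steps are moved to the point mass at \<open>x\<close> by
  self-adjointness. Both halves deviate from \<open>unif\<close> by functions orthogonal to it, so
  the error is the inner product of two deviations; Cauchy-Schwarz bounds it by the square of
  \<open>12 / n\<close>.\<close>

lemma pmf_walk_bound:
  assumes n: "n \<ge> 4" and x: "x \<in> reach n"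
  shows "real (card (reach n)) * \<bar>pmf (walk n (2 * mix_time n)) x - 1 / real (card (reach n))\<bar> \<le> 144 / (real n)\<^sup>2"
proof -
  define N where "N = mix_time n"
  define C where "C = real (card (reach n))"
  define g where "g x0 = (avg n ^^ N) (\<lambda>x. point x0 x - unif n x)" for x0
  have n0: "n > 0" using n by simp
  have C: "C > 0" using card_reach_pos[OF n0] by (simp add: C_def)
  have sub: "reach n \<subseteq> states n" by (rule reach_subset[OF n0])
  have point: "ip (states n) (point y) f = f y" if "y \<in> states n" for y f
    using that finite_states by (simp add: ip_def point_def if_distribR if_distrib cong: if_cong)
  have expand: "(avg n ^^ N) (point y) z = unif n z + g y z" if "z \<in> states n" for y z
  proof -
    have "g y = (\<lambda>x. (avg n ^^ N) (point y) x + (-1) * (avg n ^^ N) (unif n) x)"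
      unfolding g_def using avg_pow_linear[of N n "point y" "-1" "unif n"] by simp
    then show ?thesis using avg_unif[OF n0 that] by simp
  qed
  have orth: "ip (states n) (unif n) (g y) = 0" if y: "y \<in> reach n" for y
  proof -
    have "ip (states n) (unif n) (g y) = ip (states n) ((avg n ^^ N) (unif n)) (\<lambda>x. point y x - unif n x)"
      unfolding g_def by (rule avg_pow_adjoint[OF n0, symmetric])
    also have "\<dots> = ip (states n) (unif n) (\<lambda>x. point y x - unif n x)"
      by (intro ip_cong avg_unif[OF n0]) auto
    also have "\<dots> = ip (states n) (point y) (unif n) - ip (states n) (unif n) (unif n)"
      by (simp add: ip_diff_right ip_commute)
    also have "\<dots> = 0"
      using y sub by (subst point) (auto simp: ip_unif_unif[OF n0] unif_def)
    finally show ?thesis .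
  qed
  have s: "start n \<in> reach n" by (rule start_in_reach)
  have "pmf (walk n (2 * N)) x = (avg n ^^ (N + N)) (point (start n)) x"
    using pmf_walk[OF n0, of x] x sub by (auto simp: mult_2)
  also have "\<dots> = ip (states n) (point x) ((avg n ^^ N) ((avg n ^^ N) (point (start n))))"
    using x sub by (subst point) (auto simp: funpow_add)
  also have "\<dots> = ip (states n) ((avg n ^^ N) (point x)) ((avg n ^^ N) (point (start n)))"
    by (rule avg_pow_adjoint[OF n0, symmetric])
  also have "\<dots> = ip (states n) (\<lambda>z. unif n z + g x z) (\<lambda>z. unif n z + g (start n) z)"
    by (intro ip_cong expand)
  also have "\<dots> = 1 / C + ip (states n) (g x) (g (start n))"
    using orth[OF x] orth[OF s]
    by (simp add: ip_add_left ip_add_right ip_unif_unif[OF n0] C_def ip_commute[of _ "g x" "unif n"])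
  finally have "pmf (walk n (2 * N)) x - 1 / C = ip (states n) (g x) (g (start n))" by simp
  moreover have "C * \<bar>ip (states n) (g x) (g (start n))\<bar> \<le> 144 / (real n)\<^sup>2"
  proof -
    have bound: "sqrt C * L2_set (g y) (states n) \<le> 12 / real n" if "y \<in> reach n" for y
      using L2_set_walk_bound[OF n that] by (simp add: C_def g_def N_def)
    have "\<bar>ip (states n) (g x) (g (start n))\<bar> \<le> (\<Sum>z\<in>states n. \<bar>g x z\<bar> * \<bar>g (start n) z\<bar>)"
      unfolding ip_def by (rule order_trans[OF sum_abs]) (simp add: abs_mult)
    also have "\<dots> \<le> L2_set (g x) (states n) * L2_set (g (start n)) (states n)"
      by (rule L2_set_mult_ineq)
    finally have "C * \<bar>ip (states n) (g x) (g (start n))\<bar> \<le>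
        C * (L2_set (g x) (states n) * L2_set (g (start n)) (states n))"
      using C by (intro mult_left_mono) auto
    also have "\<dots> = (sqrt C * sqrt C) * (L2_set (g x) (states n) * L2_set (g (start n)) (states n))"
      using C by simp
    also have "\<dots> = (sqrt C * L2_set (g x) (states n)) * (sqrt C * L2_set (g (start n)) (states n))"
      by (simp only: mult_ac)
    also have "\<dots> \<le> (12 / real n) * (12 / real n)"
      using C by (intro mult_mono bound x s) auto
    finally show ?thesis by (simp add: power2_eq_square)
  qed
  ultimately show ?thesis by (simp add: C_def N_def)
qed

section \<open>Transfer to configurations and the mixing times\<close>

lemma puzzle_dist_bound:
  assumes n: "n \<ge> 4" and c: "c \<in> reachable_configs n"
  shows "real (card (reachable_configs n)) *
    \<bar>pmf (puzzle_dist n (2 * mix_time n)) c - pmf (pmf_of_set (reachable_configs n)) c\<bar> \<le> 144 / (real n)\<^sup>2"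
proof -
  have n0: "n > 0" using n by simp
  have sub: "reach n \<subseteq> states n" by (rule reach_subset[OF n0])
  have inj: "inj_on (conf n) (states n)" by (rule inj_on_conf[OF n0])
  obtain x where x: "x \<in> reach n" "c = conf n x" using c unfolding reachable_configs_eq[OF n0] by blast
  have card: "card (reachable_configs n) = card (reach n)"
    unfolding reachable_configs_eq[OF n0] using inj sub by (intro card_image) (rule inj_on_subset)
  have walk: "pmf (map_pmf (conf n) (walk n N)) (conf n x) = pmf (walk n N) x" for N
  proof -
    have "conf n -` {conf n x} \<inter> set_pmf (walk n N) = {x} \<inter> set_pmf (walk n N)"
      using set_pmf_walk[OF n0, of N] inj x sub by (auto dest: inj_onD)
    then have "measure (walk n N) (conf n -` {conf n x}) = measure (walk n N) {x}"
      using measure_Int_set_pmf[of "walk n N" "conf n -` {conf n x}"]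
        measure_Int_set_pmf[of "walk n N" "{x}"] by (simp only:)
    then show ?thesis by (simp only: pmf_map measure_pmf_single)
  qed
  have "pmf (pmf_of_set (reachable_configs n)) c = 1 / real (card (reach n))"
    using finite_reachable_configs[of n] c n0 by (simp add: card)
  then show ?thesis
    using pmf_walk_bound[OF n x(1)] by (simp add: puzzle_dist_eq[OF n0] x(2) walk card)
qed

lemma mixing_time_le:
  assumes "d (reachable_configs n) (puzzle_dist n N) (pmf_of_set (reachable_configs n)) < 1 / exp 1"
  shows "puzzle_mixing_time d n \<le> enat N"
  unfolding puzzle_mixing_time_def by (rule INF_lower) (use assms in simp)

lemma linf_mixing_time_le:
  assumes "n \<ge> 4" "\<epsilon> > 0" "144 / (real n)\<^sup>2 < \<epsilon> / exp 1"
  shows "puzzle_mixing_time (linf_distance \<epsilon>) n \<le> enat (2 * mix_time n)"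
proof (rule mixing_time_le)
  let ?G = "reachable_configs n"
  have fin: "finite ?G" "?G \<noteq> {}" using finite_reachable_configs assms(1) by auto
  then have card: "real (card ?G) > 0" by (simp add: card_gt_0_iff)
  let ?f = "\<lambda>c. \<bar>pmf (puzzle_dist n (2 * mix_time n)) c - pmf (pmf_of_set ?G) c\<bar>"
  have bound: "?f c \<le> 144 / (real n)\<^sup>2 / real (card ?G)" if "c \<in> ?G" for c
    using puzzle_dist_bound[OF assms(1) that]
    unfolding pos_le_divide_eq[OF card] by (simp only: mult.commute)
  then have "(SUP c\<in>?G. ?f c) \<le> 144 / (real n)\<^sup>2 / real (card ?G)"
    by (intro cSUP_least fin(2))
  then have "real (card ?G) / \<epsilon> * (SUP c\<in>?G. ?f c) \<le> real (card ?G) / \<epsilon> * (144 / (real n)\<^sup>2 / real (card ?G))"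
    using assms(2) by (intro mult_left_mono) auto
  also have "\<dots> = 144 / (real n)\<^sup>2 / \<epsilon>" using card by simp
  also have "\<dots> < \<epsilon> / exp 1 / \<epsilon>" by (intro divide_strict_right_mono assms)
  also have "\<dots> = 1 / exp 1" using assms(2) by simp
  finally show "linf_distance \<epsilon> ?G (puzzle_dist n (2 * mix_time n)) (pmf_of_set ?G) < 1 / exp 1"
    by (simp add: linf_distance_def)
qed

lemma tv_mixing_time_le:
  assumes "n \<ge> 4" "144 / (real n)\<^sup>2 < 1 / exp 1"
  shows "puzzle_mixing_time tv_distance n \<le> enat (2 * mix_time n)"
proof (rule mixing_time_le)
  let ?G = "reachable_configs n"
  have fin: "finite ?G" "?G \<noteq> {}" using finite_reachable_configs assms(1) by auto
  then have card: "real (card ?G) > 0" by (simp add: card_gt_0_iff)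
  let ?f = "\<lambda>c. \<bar>pmf (puzzle_dist n (2 * mix_time n)) c - pmf (pmf_of_set ?G) c\<bar>"
  have "?f c \<le> 144 / (real n)\<^sup>2 / real (card ?G)" if "c \<in> ?G" for c
    using puzzle_dist_bound[OF assms(1) that]
    unfolding pos_le_divide_eq[OF card] by (simp only: mult.commute)
  then have "(\<Sum>c\<in>?G. ?f c) \<le> (\<Sum>c\<in>?G. 144 / (real n)\<^sup>2 / real (card ?G))"
    by (intro sum_mono)
  also have "\<dots> = 144 / (real n)\<^sup>2" using card by simp
  finally have "(\<Sum>c\<in>?G. ?f c) \<le> 144 / (real n)\<^sup>2" .
  moreover have "0 \<le> (\<Sum>c\<in>?G. ?f c)" by (intro sum_nonneg) simp
  ultimately show "tv_distance ?G (puzzle_dist n (2 * mix_time n)) (pmf_of_set ?G) < 1 / exp 1"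
    unfolding tv_distance_def using assms(2) by linarith
qed

text \<open>Eventual finiteness accompanies the growth bound, since \<open>the_enat\<close> says
  nothing about an infinite mixing time.\<close>

lemma mix_time_bigo:
  assumes "\<forall>\<^sub>F n in sequentially. T n \<le> enat (2 * mix_time n)"
  shows "(\<forall>\<^sub>F n in sequentially. T n < \<infinity>) \<and>
    (\<lambda>n. real (the_enat (T n))) \<in> O(\<lambda>n. real n ^ 4 * ln (real n))"
proof
  show "\<forall>\<^sub>F n in sequentially. T n < \<infinity>"
    using assms by eventually_elim (metis enat_ord_code(4) order_le_less_trans)
  \<comment> \<open>With \<open>x = n^4 ln n \<ge> 1\<close>, twice
    \<open>4 * 10 ^ 6 * x + 1\<close> is at most \<open>10 ^ 7 * x\<close>; the 1 accounts for the
    ceiling.\<close>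
  have "\<forall>\<^sub>F n in sequentially. real (the_enat (T n)) \<le> 10 ^ 7 * (real n ^ 4 * ln (real n))"
    using assms eventually_ge_at_top[of 4]
  proof eventually_elim
    case (elim n)
    have "the_enat (T n) \<le> 2 * mix_time n"
      using elim(1) by (cases "T n") auto
    then have "real (the_enat (T n)) \<le> 2 * real (mix_time n)" by linarith
    moreover have ln: "ln (real n) \<ge> 1"
    proof -
      have "exp 1 \<le> real n" using exp_le elim(2) by linarith
      then show ?thesis using elim(2) by (subst ln_ge_iff) auto
    qed
    have "real (mix_time n) \<le> 4 * 10 ^ 6 * real n ^ 4 * ln (real n) + 1"
    proof -
      have "0 \<le> 4 * 10 ^ 6 * real n ^ 4 * ln (real n)" using ln by simp
      then have "real (mix_time n) = of_int \<lceil>4 * 10 ^ 6 * real n ^ 4 * ln (real n)\<rceil>"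
        unfolding mix_time_def by (intro of_nat_nat) (simp only: zero_le_ceiling)
      then show ?thesis using of_int_ceiling_le_add_one by simp
    qed
    moreover have "1 * 1 \<le> real n ^ 4 * ln (real n)"
      using ln elim(2) by (intro mult_mono) auto
    ultimately show ?case by simp
  qed
  then show "(\<lambda>n. real (the_enat (T n))) \<in> O(\<lambda>n. real n ^ 4 * ln (real n))"
    by (intro bigoI[of _ "10 ^ 7"]) (auto elim!: eventually_mono)
qed

lemma eventually_144: "c > 0 \<Longrightarrow> \<forall>\<^sub>F n in sequentially. 144 / (real n)\<^sup>2 < c"
proof -
  assume "c > 0"
  have "(\<lambda>n. 144 / (real n)\<^sup>2) \<longlonglongrightarrow> 0"
    by (intro tendsto_divide_0[OF tendsto_const] filterlim_at_top_imp_at_infinity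
        filterlim_pow_at_top filterlim_real_sequentially) simp
  then show ?thesis using \<open>c > 0\<close> by (rule order_tendstoD)
qed

theorem theorem4:
  "(\<forall>\<^sub>F n in sequentially. puzzle_mixing_time tv_distance n < \<infinity>) \<and>
   (\<lambda>n. real (the_enat (puzzle_mixing_time tv_distance n)))
     \<in> O(\<lambda>n. real n ^ 4 * ln (real n)) \<and>
   (\<forall>\<epsilon>::real. 0 < \<epsilon> \<and> \<epsilon> < 1 \<longrightarrow>
     (\<forall>\<^sub>F n in sequentially. puzzle_mixing_time (linf_distance \<epsilon>) n < \<infinity>) \<and>
     (\<lambda>n. real (the_enat (puzzle_mixing_time (linf_distance \<epsilon>) n)))
       \<in> O(\<lambda>n. real n ^ 4 * ln (real n)))"
proof -
  have "\<forall>\<^sub>F n in sequentially. puzzle_mixing_time tv_distance n \<le> enat (2 * mix_time n)"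
    using eventually_ge_at_top[of 4] eventually_144[of "1 / exp 1", simplified]
    by eventually_elim (rule tv_mixing_time_le, simp_all)
  note tv = mix_time_bigo[OF this]
  have "\<forall>\<^sub>F n in sequentially. puzzle_mixing_time (linf_distance \<epsilon>) n \<le> enat (2 * mix_time n)"
    if "0 < \<epsilon>" for \<epsilon> :: real
  proof -
    have "\<epsilon> / exp 1 > 0" using that by simp
    from eventually_ge_at_top[of 4] eventually_144[OF this] show ?thesis
      by eventually_elim (rule linf_mixing_time_le, simp_all add: that)
  qed
  note linf = mix_time_bigo[OF this]
  show ?thesis using tv linf by blast
qed

end
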